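(* Let $n\geqslant 2$ be an integer. For each $j=1,\ldots,n-1$ let $a_j\in\mathbb{R}\setminus\{0\}$ and $k_j\in\{2,3,4,\ldots\}$, and define $R:\mathbb{R}^{n-1}\to\mathbb{R}$ by $$R(\xi')=\sum_{j=1}^{n-1}a_j\xi_j^{k_j},\qquad \xi'=(\xi_1,\ldots,\xi_{n-1}).$$ Let $p\in[1,\infty)$. Then there exists a constant $C_p$, independent of $\phi$, such that $$\left(\int_{\mathbb{R}^{n-1}}\lvert\hat\phi(\xi',R(\xi'))\rvert^2\,d\xi'\right)^{1/2}\leqslant C_p\,\lVert\phi\rVert_{L^p(\mathbb{R}^n)}\quad\text{for } \phi\in L^p(\mathbb{R}^n)$$ if and only if $$p=2-\frac{2}{2+\sum_{j=1}^{n-1}\frac{1}{k_j}}.$$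
   Context: The Fourier transform on $\mathbb{R}^n$ is $\hat f(\xi)=(2\pi)^{-n/2}\int_{\mathbb{R}^n}f(x)e^{-ix\cdot\xi}\,dx$. For $p\in[1,\infty)$, $\lVert f\rVert_{L^p(\mathbb{R}^n)}=\left(\int_{\mathbb{R}^n}\lvert f(x)\rvert^p\,dx\right)^{1/p}$. The inequality is the Fourier restriction inequality for the hypersurface $S=\{\xi\in\mathbb{R}^n;\ \xi_n=R(\xi')\}$ equipped with the measure $d\xi'=d\xi_1\cdots d\xi_{n-1}$. As is standard, since $S$ has Lebesgue measure zero, the inequality for $\phi\in L^p(\mathbb{R}^n)$ is understood as an a priori inequality: it is required for all Schwartz functions $\phi$ on $\mathbb{R}^n$ (with one constant $C_p$), and the restriction of $\hat\phi$ to $S$ for general $\phi\in L^p(\mathbb{R}^n)$ is then defined by density. *)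

theory Defs
  imports "HOL-Analysis.Analysis"
begin

text \<open>The Fourier transform of an integrable function, in its unitary normalisation.\<close>

definition fourier :: "('a::euclidean_space \<Rightarrow> complex) \<Rightarrow> 'a \<Rightarrow> complex" where
  "fourier f \<xi> = complex_of_real ((2 * pi) powr (- (real DIM('a) / 2))) *
     (LINT x|lborel. f x * exp (- (\<i> * complex_of_real (x \<bullet> \<xi>))))"

text \<open>Only meant for \<open>1 \<le> p\<close> and functions whose \<open>p\<close>-th power is integrable: the
  Bochner integral is \<open>0\<close> otherwise.\<close>

definition Lp_norm :: "real \<Rightarrow> ('a::euclidean_space \<Rightarrow> complex) \<Rightarrow> real" where
  "Lp_norm p f = (LINT x|lborel. cmod (f x) powr p) powr (1 / p)"

text \<open>Iterated partial derivatives: the list gives the coordinate directions, the last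
  entry being applied first. The value is meaningful only where the derivatives of lower order
  are differentiable, which \<open>schwartz\<close> demands everywhere and at every order.\<close>

primrec partial_deriv ::
  "'a::euclidean_space list \<Rightarrow> ('a \<Rightarrow> complex) \<Rightarrow> 'a \<Rightarrow> complex" where
  "partial_deriv [] f = f"
| "partial_deriv (b # bs) f = (\<lambda>x. frechet_derivative (partial_deriv bs f) (at x) b)"

definition schwartz :: "('a::euclidean_space \<Rightarrow> complex) \<Rightarrow> bool" where
  "schwartz f \<longleftrightarrow>
     (\<forall>bs\<in>lists Basis.
        (\<forall>x. partial_deriv bs f differentiable (at x)) \<and>
        (\<forall>N::nat. bounded (range (\<lambda>x. norm x ^ N *\<^sub>R partial_deriv bs f x))))"

end

theory Submission
  imports Defs "HOL-Probability.Probability"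
begin

text \<open>
  Sufficiency. Slicing in time writes the square integral of the restricted transform over a box as
  a double integral over times \<open>t, s\<close> of sesquilinear forms in the slices of \<open>\<phi>\<close>, with multiplier
  \<open>exp (- \<i> (t - s) R)\<close> cut off to the box. Van der Corput's lemma in each variable bounds such a
  form by \<open>\<bar>t - s\<bar> powr (- h)\<close> times the product of the $L^1$ norms, where \<open>h\<close> is the sum of the
  \<open>1 / k j\<close>, and a Bessel inequality bounds it by the product of the $L^2$ norms, both uniformly in
  the box. Real interpolation gives the $L^p$ bound with the factor \<open>\<bar>t - s\<bar> powr (- (2 - 2 / p))\<close>,
  exactly when \<open>p\<close> has the stated value, and the diagonal Hardy-Littlewood-Sobolev inequality in
  the time variable sums it up.

  Necessity. Anisotropic dilations of a Gaussian, adapted to the homogeneity of \<open>R\<close>, multiply the two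
  sides by powers of the dilation parameter, which must agree.
\<close>

section \<open>Product integrals\<close>

text \<open>The obstacle is that the multiplier \<open>exp (- \<i> \<tau> R)\<close> has modulus
  one: it is not integrable, so neither its transform nor the exchange of integrals in which it
  occurs makes sense as it stands. A cutoff to a box repairs this and keeps the multiplier a product
  over the coordinates, so that one-dimensional integrals suffice; the price is that every bound
  must be uniform in the size of the box.

  The exponents explain the value of \<open>p\<close>. The $L^1$ endpoint decays like
  \<open>\<bar>\<tau>\<bar> powr - h\<close> and the $L^2$ endpoint does not decay, so interpolation
  yields the power \<open>h * (2 / p - 1)\<close>. A kernel
  \<open>\<bar>t - s\<bar> powr - \<alpha>\<close> pairs two functions in $L^p$ of the line only for
  \<open>\<alpha> = 2 - 2 / p\<close>. Equating the two gives
  \<open>p = (2 + 2 * h) / (2 + h)\<close>, which lies strictly between 1 and 2. Interpolating at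
  fixed times, before the integration in time, leaves a scalar inequality for the $L^p$ norms of the
  slices.\<close>

lemma product_integral_lborel_Basis:
  fixes f :: "'a::euclidean_space \<Rightarrow> real \<Rightarrow> 'b::{real_normed_field,banach,second_countable_topology}"
  assumes f: "\<And>b. b \<in> Basis \<Longrightarrow> integrable lborel (f b)"
  shows integrable_lborel_prod: "integrable lborel (\<lambda>x. \<Prod>b\<in>Basis. f b (x \<bullet> b))"
    and integral_lborel_prod:
      "(LINT x|lborel. (\<Prod>b\<in>Basis. f b (x \<bullet> b))) = (\<Prod>b\<in>Basis. LINT x|lborel. f b x)"
proof -
  interpret product_sigma_finite "\<lambda>_::'a. lborel :: real measure" ..
  let ?P = "\<Pi>\<^sub>M b\<in>(Basis::'a set). (lborel :: real measure)"
  let ?T = "\<lambda>f::'a \<Rightarrow> real. \<Sum>b\<in>Basis. f b *\<^sub>R b"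
  have T: "?T \<in> measurable ?P borel" by measurable
  have bm: "f b \<in> borel_measurable borel" if "b \<in> Basis" for b
    using borel_measurable_integrable[OF f[OF that]] by simp
  have m: "(\<lambda>x. \<Prod>b\<in>Basis. f b (x \<bullet> b)) \<in> borel_measurable borel"
    by (intro borel_measurable_prod measurable_compose[OF _ bm]) measurable
  have eq: "(\<Prod>b\<in>Basis. f b (?T g \<bullet> b)) = (\<Prod>b\<in>Basis. f b (g b))" for g
    by (intro prod.cong refl) simp
  show "integrable lborel (\<lambda>x. \<Prod>b\<in>Basis. f b (x \<bullet> b))"
    unfolding lborel_eq[where 'a='a]
    using product_integrable_prod[OF finite_Basis f]
    by (subst integrable_distr_eq[OF T m]) (simp add: eq del: inner_sum_left_Basis)
  show "(LINT x|lborel. (\<Prod>b\<in>Basis. f b (x \<bullet> b))) = (\<Prod>b\<in>Basis. LINT x|lborel. f b x)"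
    unfolding lborel_eq[where 'a='a]
    using product_integral_prod[OF finite_Basis f]
    by (subst integral_distr[OF T m]) (simp add: eq del: inner_sum_left_Basis)
qed

section \<open>Oscillatory integrals\<close>

text \<open>Integration by parts against \<open>1 / (\<i> * P')\<close>. The remaining integrand has
  modulus \<open>P'' / (P')\<^sup>2\<close>; since \<open>P''\<close> has one sign this is an exact
  derivative, and its integral is a difference of values of \<open>1 / P'\<close>. The boundary
  terms and the remainder cost \<open>2 / m\<close> each.\<close>

lemma van_der_Corput_1:
  fixes P :: "real \<Rightarrow> real"
  assumes ab: "a \<le> b" and m: "m > 0"
    and P: "\<And>x. x \<in> {a..b} \<Longrightarrow> (P has_real_derivative P' x) (at x)"
    and P': "\<And>x. x \<in> {a..b} \<Longrightarrow> (P' has_real_derivative P'' x) (at x)"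
    and ge: "\<And>x. x \<in> {a..b} \<Longrightarrow> P'' x \<ge> 0"
    and big: "\<And>x. x \<in> {a..b} \<Longrightarrow> \<bar>P' x\<bar> \<ge> m"
  shows "norm (integral {a..b} (\<lambda>x. cis (P x))) \<le> 4 / m"
proof -
  define G where "G = (\<lambda>x. cis (P x) / (\<i> * complex_of_real (P' x)))"
  define E where "E = (\<lambda>x. - cis (P x) * complex_of_real (P'' x) / (\<i> * (complex_of_real (P' x))\<^sup>2))"
  have nz: "P' x \<noteq> 0" if "x \<in> {a..b}" for x using big[OF that] m by auto
  have cisd: "((\<lambda>x. cis (P x)) has_vector_derivative (P' x *\<^sub>R (\<i> * cis (P x)))) (at x)"
    if "x \<in> {a..b}" for x
    using P[OF that] unfolding has_vector_derivative_def has_field_derivative_def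
    by (auto intro!: derivative_eq_intros simp: algebra_simps)
  have Wd: "((\<lambda>x. - (1 / P' x)) has_real_derivative (P'' x / (P' x)\<^sup>2)) (at x)" if "x \<in> {a..b}" for x
  proof -
    have "((\<lambda>x. inverse (P' x)) has_real_derivative - (inverse (P' x) * P'' x * inverse (P' x))) (at x)"
      by (rule DERIV_inverse'[OF P'[OF that] nz[OF that]])
    from DERIV_minus[OF this]
    have "((\<lambda>x. - inverse (P' x)) has_real_derivative (P'' x / (P' x)\<^sup>2)) (at x)"
      by (rule DERIV_cong) (simp add: divide_inverse power2_eq_square)
    then show ?thesis by (simp only: inverse_eq_divide)
  qed
  \<comment> \<open>\<open>G\<close> and \<open>E\<close> in product form, by way of
    \<open>1 / \<i> = - \<i>\<close>, so that the product rule applies directly with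
    \<open>Wd\<close>.\<close>
  define G where "G = (\<lambda>x. cis (P x) * (\<i> * complex_of_real (- (1 / P' x))))"
  define E where "E = (\<lambda>x. cis (P x) * (\<i> * complex_of_real (P'' x / (P' x)\<^sup>2)))"
  have Gd: "(G has_vector_derivative (cis (P x) + E x)) (at x within {a..b})" if "x \<in> {a..b}" for x
  proof -
    have "((\<lambda>x. \<i> * complex_of_real (- (1 / P' x))) has_vector_derivative
        \<i> * complex_of_real (P'' x / (P' x)\<^sup>2)) (at x)"
      by (intro has_vector_derivative_mult_right has_vector_derivative_of_real Wd[OF that])
    from has_vector_derivative_mult[OF cisd[OF that] this]
    have "(G has_vector_derivative (cis (P x) + E x)) (at x)"
      unfolding G_def E_def using nz[OF that] by (simp add: scaleR_conv_of_real field_simps)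
    then show ?thesis by (rule has_vector_derivative_at_within)
  qed
  have G_int: "((\<lambda>x. cis (P x) + E x) has_integral (G b - G a)) {a..b}"
    by (rule fundamental_theorem_of_calculus[OF ab Gd])
  have "continuous_on {a..b} (\<lambda>x. cis (P x))"
    by (rule continuous_at_imp_continuous_on) (auto intro: has_vector_derivative_continuous cisd)
  then have cis_int: "(\<lambda>x. cis (P x)) integrable_on {a..b}"
    by (rule integrable_continuous_real)
  have E_int: "E integrable_on {a..b}"
    using integrable_diff[OF has_integral_integrable[OF G_int] cis_int] by simp
  have W_int: "((\<lambda>x. P'' x / (P' x)\<^sup>2) has_integral (- (1 / P' b) - - (1 / P' a))) {a..b}"
    by (rule fundamental_theorem_of_calculus[OF ab])
      (auto intro!: has_field_derivative_at_within Wd simp: has_real_derivative_iff_has_vector_derivative[symmetric])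
  have inv: "\<bar>1 / P' x\<bar> \<le> 1 / m" if "x \<in> {a..b}" for x
    using big[OF that] m by (simp add: abs_divide frac_le)
  have "norm (integral {a..b} E) \<le> integral {a..b} (\<lambda>x. P'' x / (P' x)\<^sup>2)"
    by (rule integral_norm_bound_integral[OF E_int has_integral_integrable[OF W_int]])
      (auto simp: E_def norm_mult norm_divide norm_power ge)
  also have "\<dots> = - (1 / P' b) - - (1 / P' a)" using W_int by (rule integral_unique)
  also have "\<dots> \<le> 2 / m"
  proof -
    have "- (1 / P' b) \<le> 1 / m" "1 / P' a \<le> 1 / m"
      using order_trans[OF abs_ge_minus_self inv[of b]] order_trans[OF abs_ge_self inv[of a]] ab by simp_all
    moreover have "2 / m = 1 / m + 1 / m" by simp
    ultimately show ?thesis by linarith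
  qed
  finally have E: "norm (integral {a..b} E) \<le> 2 / m" .
  have "norm (G x) \<le> 1 / m" if "x \<in> {a..b}" for x
    using inv[OF that] by (simp add: G_def norm_mult norm_divide)
  then have G: "norm (G b - G a) \<le> 2 / m"
    using norm_triangle_ineq4[of "G b" "G a"] ab
    by (smt (verit) atLeastAtMost_iff add_divide_distrib)
  have "integral {a..b} (\<lambda>x. cis (P x)) = (G b - G a) - integral {a..b} E"
    using G_int integral_add[OF cis_int E_int] by (simp add: integral_unique)
  then show ?thesis
    using norm_triangle_ineq4[of "G b - G a" "integral {a..b} E"] E G
    by simp
qed

text \<open>As \<open>P'\<close> grows at rate at least \<open>\<mu>\<close>, it can be small only
  near one point. At distance \<open>r\<close> from that point \<open>\<bar>P'\<bar>\<close> is at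
  least \<open>\<mu> * r\<close>; the radius \<open>r = 1 / sqrt \<mu>\<close> balances the trivial
  bound \<open>2 * r\<close> inside against \<open>4 / (\<mu> * r)\<close> on each side, and 10 is 4
  + 2 + 4.\<close>

lemma van_der_Corput_2_pos:
  fixes P :: "real \<Rightarrow> real"
  assumes ab: "a \<le> b" and \<mu>: "\<mu> > 0"
    and P: "\<And>x. x \<in> {a..b} \<Longrightarrow> (P has_real_derivative P' x) (at x)"
    and P': "\<And>x. x \<in> {a..b} \<Longrightarrow> (P' has_real_derivative P'' x) (at x)"
    and ge: "\<And>x. x \<in> {a..b} \<Longrightarrow> P'' x \<ge> \<mu>"
  shows "norm (integral {a..b} (\<lambda>x. cis (P x))) \<le> 10 / sqrt \<mu>"
proof -
  have mono: "P' y - P' x \<ge> \<mu> * (y - x)" if "a \<le> x" "x \<le> y" "y \<le> b" for x y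
  proof (cases "x = y")
    case False
    then have "x < y" using that by simp
    moreover have "(P' has_real_derivative P'' u) (at u)" if "x \<le> u" "u \<le> y" for u
      using P' that \<open>a \<le> x\<close> \<open>y \<le> b\<close> by simp
    ultimately obtain z where "x < z" "z < y" "P' y - P' x = (y - x) * P'' z"
      using MVT2[of x y P' P''] by blast
    with ge[of z] \<open>x < y\<close> that show ?thesis
      by (smt (verit) atLeastAtMost_iff mult.commute mult_left_mono)
  qed simp
  \<comment> \<open>\<open>x0\<close> is the zero of \<open>P'\<close> if there is one, and
    otherwise the endpoint at which \<open>\<bar>P'\<bar>\<close> is smallest.\<close>
  have "\<exists>x0\<in>{a..b}. \<forall>x\<in>{a..b}. \<bar>P' x\<bar> \<ge> \<mu> * \<bar>x - x0\<bar>"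
  proof (cases "P' a \<ge> 0 \<or> P' b \<le> 0")
    case True
    then show ?thesis
    proof
      assume "P' a \<ge> 0"
      then show ?thesis using mono[of a] ab by (intro bexI[of _ a]) (auto, smt (verit))
    next
      assume "P' b \<le> 0"
      then show ?thesis using mono[of _ b] ab
        by (intro bexI[of _ b]) (auto simp: abs_minus_commute abs_le_iff, force)
    qed
  next
    case False
    have "continuous_on {a..b} P'"
      by (rule continuous_at_imp_continuous_on) (auto intro: DERIV_isCont P')
    then obtain x0 where x0: "a \<le> x0" "x0 \<le> b" "P' x0 = 0"
      using IVT'[of P' a 0 b] False ab by auto
    have "\<bar>P' x\<bar> \<ge> \<mu> * \<bar>x - x0\<bar>" if "x \<in> {a..b}" for x
    proof (cases "x \<le> x0")
      case True
      then show ?thesis using mono[of x x0] x0 that by (simp add: abs_if algebra_simps)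
    next
      case False
      then show ?thesis using mono[of x0 x] x0 that by (simp add: abs_if algebra_simps)
    qed
    with x0 show ?thesis by (intro bexI[of _ x0] ballI) simp_all
  qed
  then obtain x0 where x0: "x0 \<in> {a..b}" and far: "\<And>x. x \<in> {a..b} \<Longrightarrow> \<bar>P' x\<bar> \<ge> \<mu> * \<bar>x - x0\<bar>"
    by blast
  define r where "r = 1 / sqrt \<mu>"
  have r: "r > 0" "\<mu> * r = sqrt \<mu>" using \<mu> by (auto simp: r_def real_div_sqrt)
  define c d where "c = max a (x0 - r)" and "d = min b (x0 + r)"
  have cd: "a \<le> c" "c \<le> d" "d \<le> b" using x0 r ab by (auto simp: c_def d_def)
  have cont: "continuous_on {a..b} (\<lambda>x. cis (P x))"
    unfolding cis_conv_exp
    by (intro continuous_intros continuous_at_imp_continuous_on) (auto intro: DERIV_isCont P)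
  have int: "(\<lambda>x. cis (P x)) integrable_on {u..v}" if "a \<le> u" "v \<le> b" for u v
    by (rule integrable_continuous_real, rule continuous_on_subset[OF cont]) (use that in auto)
  have big: "\<bar>P' x\<bar> \<ge> sqrt \<mu>" if "x \<in> {a..b}" "\<bar>x - x0\<bar> \<ge> r" for x
    using far[OF that(1)] mult_left_mono[OF that(2), of \<mu>] \<mu> r by linarith
  have ge0: "P'' x \<ge> 0" if "x \<in> {a..b}" for x using ge[OF that] \<mu> by simp
  have 1: "norm (integral {a..c} (\<lambda>x. cis (P x))) \<le> 4 / sqrt \<mu>"
  proof (cases "a < c")
    case True
    then show ?thesis using cd \<mu>
      by (intro van_der_Corput_1[where P' = P' and P'' = P''] P P' big ge0) (auto simp: c_def)
  qed (use cd \<mu> in auto)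
  have 3: "norm (integral {d..b} (\<lambda>x. cis (P x))) \<le> 4 / sqrt \<mu>"
  proof (cases "d < b")
    case True
    then show ?thesis using cd \<mu>
      by (intro van_der_Corput_1[where P' = P' and P'' = P''] P P' big ge0) (auto simp: d_def)
  qed (use cd \<mu> in auto)
  have "norm (integral {c..d} (\<lambda>x. cis (P x))) \<le> integral {c..d} (\<lambda>x. 1)"
    using cd by (intro integral_norm_bound_integral int) auto
  also have "\<dots> \<le> 2 * r" using cd by (auto simp: c_def d_def)
  finally have 2: "norm (integral {c..d} (\<lambda>x. cis (P x))) \<le> 2 / sqrt \<mu>" by (simp add: r_def)
  have "integral {a..b} (\<lambda>x. cis (P x)) = integral {a..c} (\<lambda>x. cis (P x)) +
      (integral {c..d} (\<lambda>x. cis (P x)) + integral {d..b} (\<lambda>x. cis (P x)))"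
    using cd int by (simp add: Henstock_Kurzweil_Integration.integral_combine)
  also have "norm \<dots> \<le> 4 / sqrt \<mu> + (2 / sqrt \<mu> + 4 / sqrt \<mu>)"
    using 1 2 3 by (intro norm_triangle_mono)
  finally show ?thesis by (simp add: field_simps)
qed

lemma van_der_Corput_2:
  fixes P :: "real \<Rightarrow> real"
  assumes ab: "a \<le> b" and \<mu>: "\<mu> > 0"
    and P: "\<And>x. x \<in> {a..b} \<Longrightarrow> (P has_real_derivative P' x) (at x)"
    and P': "\<And>x. x \<in> {a..b} \<Longrightarrow> (P' has_real_derivative P'' x) (at x)"
    and ge: "(\<forall>x\<in>{a..b}. P'' x \<ge> \<mu>) \<or> (\<forall>x\<in>{a..b}. P'' x \<le> - \<mu>)"
  shows "norm (integral {a..b} (\<lambda>x. cis (P x))) \<le> 10 / sqrt \<mu>"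
  using ge
proof
  assume "\<forall>x\<in>{a..b}. P'' x \<ge> \<mu>"
  then show ?thesis using van_der_Corput_2_pos[OF ab \<mu> P P'] by blast
next
  assume le: "\<forall>x\<in>{a..b}. P'' x \<le> - \<mu>"
  have "norm (integral {a..b} (\<lambda>x. cis (- P x))) \<le> 10 / sqrt \<mu>"
    by (rule van_der_Corput_2_pos[OF ab \<mu>, where P' = "\<lambda>x. - P' x" and P'' = "\<lambda>x. - P'' x"])
      (use le in \<open>auto intro!: derivative_eq_intros P P' simp: le_minus_iff\<close>)
  moreover have "integral {a..b} (\<lambda>x. cis (- P x)) = cnj (integral {a..b} (\<lambda>x. cis (P x)))"
    by (simp add: integral_cnj cis_cnj)
  ultimately show ?thesis by simp
qed

text \<open>The linear term disappears in the second derivative, hence the uniformity in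
  \<open>z\<close>. At the scale \<open>\<delta>\<close> the monomial has size 1: where
  \<open>\<bar>x\<bar> \<ge> \<delta>\<close> the second derivative is at least
  \<open>1 / \<delta>\<^sup>2\<close> in modulus and each side costs \<open>10 * \<delta>\<close>,
  while the middle costs at most its length \<open>2 * \<delta>\<close>. So the second-derivative
  test alone handles a critical point of any order \<open>k\<close>.\<close>

lemma oscillatory_integral_monomial:
  fixes \<alpha> z N :: real and k :: nat
  assumes \<alpha>: "\<alpha> \<noteq> 0" and k: "k \<ge> 2" and N: "N \<ge> 0"
  shows "norm (integral {-N..N} (\<lambda>x. cis (\<alpha> * x ^ k + z * x))) \<le> 22 * \<bar>\<alpha>\<bar> powr (- (1 / real k))"
proof -
  define \<delta> where "\<delta> = \<bar>\<alpha>\<bar> powr (- (1 / real k))"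
  define P where "P = (\<lambda>x. \<alpha> * x ^ k + z * x)"
  define P' where "P' = (\<lambda>x. \<alpha> * (real k * x ^ (k - 1)) + z)"
  define P'' where "P'' = (\<lambda>x. \<alpha> * (real k * (real (k - 1) * x ^ (k - 2))))"
  have \<delta>: "\<delta> > 0" using \<alpha> by (simp add: \<delta>_def)
  have "\<delta> ^ k = 1 / \<bar>\<alpha>\<bar>"
    using \<alpha> k by (simp add: \<delta>_def powr_realpow[symmetric] powr_powr powr_minus_divide powr_divide)
  then have ak: "\<bar>\<alpha>\<bar> = 1 / \<delta> ^ k" using \<alpha> by simp
  define \<mu> where "\<mu> = 1 / \<delta>\<^sup>2"
  have \<mu>: "\<mu> > 0" "10 / sqrt \<mu> = 10 * \<delta>" using \<delta> by (auto simp: \<mu>_def real_sqrt_divide)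
  have big: "\<bar>P'' x\<bar> \<ge> \<mu>" if "\<bar>x\<bar> \<ge> \<delta>" for x
  proof -
    have "\<mu> = \<bar>\<alpha>\<bar> * (1 * (1 * \<delta> ^ (k - 2)))"
    proof -
      have "\<delta> ^ k = \<delta>\<^sup>2 * \<delta> ^ (k - 2)"
        by (metis k le_add_diff_inverse power_add)
      then show ?thesis using \<delta> by (simp add: ak \<mu>_def)
    qed
    also have "\<dots> \<le> \<bar>\<alpha>\<bar> * (real k * (real (k - 1) * \<bar>x\<bar> ^ (k - 2)))"
      using k \<delta> that by (intro mult_mono power_mono) auto
    also have "\<dots> = \<bar>P'' x\<bar>" by (simp add: P''_def abs_mult power_abs)
    finally show ?thesis .
  qed
  have P: "(P has_real_derivative P' x) (at x)" for x
    unfolding P_def P'_def by (auto intro!: derivative_eq_intros)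
  have P': "(P' has_real_derivative P'' x) (at x)" for x
    unfolding P'_def P''_def by (auto intro!: derivative_eq_intros simp: numeral_2_eq_2)
  have cont: "continuous_on UNIV (\<lambda>x. cis (P x))"
    unfolding P_def cis_conv_exp by (intro continuous_intros)
  have int: "(\<lambda>x. cis (P x)) integrable_on {u..v}" for u v
    by (rule integrable_continuous_real, rule continuous_on_subset[OF cont]) auto
  have triv: "norm (integral {-r..r} (\<lambda>x. cis (P x))) \<le> 2 * r" if "r \<ge> 0" for r
  proof -
    have "norm (integral {-r..r} (\<lambda>x. cis (P x))) \<le> integral {-r..r} (\<lambda>x. 1)"
      by (intro integral_norm_bound_integral int) auto
    then show ?thesis using that by simp
  qed
  show ?thesis
  proof (cases "N \<le> \<delta>")
    case True
    then show ?thesis using triv[OF N] \<delta> unfolding P_def \<delta>_def by linarith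
  next
    case False
    have sgn: "(\<forall>x\<in>{\<delta>..N}. P'' x \<ge> \<mu>) \<or> (\<forall>x\<in>{\<delta>..N}. P'' x \<le> - \<mu>)"
    proof -
      have "\<bar>P'' x\<bar> = (if \<alpha> > 0 then P'' x else - P'' x)" if "x \<ge> \<delta>" for x
        using that \<delta> by (auto simp: P''_def abs_mult)
      with big show ?thesis
        by (cases "\<alpha> > 0") (auto, (metis abs_ge_self abs_of_nonneg dual_order.trans \<delta> less_imp_le), (smt (verit) \<delta>))
    qed
    have sgn': "(\<forall>x\<in>{-N..-\<delta>}. P'' x \<ge> \<mu>) \<or> (\<forall>x\<in>{-N..-\<delta>}. P'' x \<le> - \<mu>)"
    proof -
      have m: "P'' x = (if even k then P'' (- x) else - P'' (- x))" for x
        using k by (auto simp: P''_def)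
      from sgn show ?thesis
      proof
        assume A: "\<forall>x\<in>{\<delta>..N}. P'' x \<ge> \<mu>"
        have "(if even k then P'' x \<ge> \<mu> else P'' x \<le> - \<mu>)" if "x \<in> {-N..-\<delta>}" for x
          using bspec[OF A, of "- x"] that m[of x] by auto
        then show ?thesis by (cases "even k") auto
      next
        assume A: "\<forall>x\<in>{\<delta>..N}. P'' x \<le> - \<mu>"
        have "(if even k then P'' x \<le> - \<mu> else P'' x \<ge> \<mu>)" if "x \<in> {-N..-\<delta>}" for x
          using bspec[OF A, of "- x"] that m[of x] by auto
        then show ?thesis by (cases "even k") auto
      qed
    qed
    have 1: "norm (integral {-N..-\<delta>} (\<lambda>x. cis (P x))) \<le> 10 * \<delta>"
      using van_der_Corput_2[OF _ \<mu>(1) P P' sgn'] False \<mu>(2) by simp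
    have 3: "norm (integral {\<delta>..N} (\<lambda>x. cis (P x))) \<le> 10 * \<delta>"
      using van_der_Corput_2[OF _ \<mu>(1) P P' sgn] False \<mu>(2) by simp
    have "integral {-N..N} (\<lambda>x. cis (P x)) = integral {-N..-\<delta>} (\<lambda>x. cis (P x)) +
      (integral {-\<delta>..\<delta>} (\<lambda>x. cis (P x)) + integral {\<delta>..N} (\<lambda>x. cis (P x)))"
      using False \<delta> int by (simp add: Henstock_Kurzweil_Integration.integral_combine)
    also have "norm \<dots> \<le> 10 * \<delta> + (2 * \<delta> + 10 * \<delta>)"
      using 1 triv[of \<delta>] 3 \<delta> by (intro norm_triangle_mono) auto
    finally show ?thesis by (simp add: P_def \<delta>_def)
  qed
qed

section \<open>Real interpolation of bilinear forms\<close>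

text \<open>A geometric sum is controlled by its largest term, here at
  \<open>k = \<lfloor>log 2 y\<rfloor>\<close>, whatever the lower end \<open>- int K\<close>. It
  sums the dyadic weights in the interpolation, with \<open>\<beta> = 2 - p\<close>; the constant
  blows up as \<open>p\<close> tends to 2.\<close>

lemma geometric_sum_le:
  fixes y \<beta> :: real
  assumes \<beta>: "\<beta> > 0" and y: "y > 0"
  shows "(\<Sum>k \<in> {k\<in>{- int K..<int K}. 2 powr real_of_int k \<le> y}. (2 powr real_of_int (k + 1)) powr \<beta>)
     \<le> (4 powr \<beta> / (2 powr \<beta> - 1)) * y powr \<beta>"
proof -
  define r where "r = (2::real) powr \<beta>"
  have r: "r > 1" using \<beta> by (simp add: r_def gr_one_powr)
  have e: "(2 powr real_of_int (k + 1)) powr \<beta> = r * r powr real_of_int k" for k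
    by (simp add: r_def powr_powr powr_add[symmetric] algebra_simps)
  define m where "m = \<lfloor>log 2 y\<rfloor>"
  have sub: "{k\<in>{- int K..<int K}. 2 powr real_of_int k \<le> y} \<subseteq> {- int K..m}"
    using y by (auto simp: m_def le_floor_iff le_log_iff)
  have geo: "(\<Sum>k \<in> {- int K..m}. r powr real_of_int k) \<le> r powr (real_of_int m + 1) / (r - 1)"
  proof (cases "m \<ge> - int K")
    case False
    then show ?thesis using r by simp
  next
    case True
    then show ?thesis
    proof (induction m rule: int_ge_induct)
      case base
      define u where "u = r powr real_of_int (- int K)"
      have "u * (r - 1) \<le> u * r"
        using r by (intro mult_left_mono) (auto simp: u_def)
      moreover have "r powr (real_of_int (- int K) + 1) = u * r"
        using r powr_add[of r "real_of_int (- int K)" 1] by (simp only: u_def powr_one)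
      moreover have "{- int K..- int K} = {- int K}" by simp
      ultimately show ?case using r
        by (simp add: u_def[symmetric] le_divide_eq del: of_int_minus)
    next
      case (step i)
      have "{- int K..i+1} = insert (i+1) {- int K..i}" using step by auto
      then have "(\<Sum>k \<in> {- int K..i+1}. r powr real_of_int k) =
          r powr (real_of_int i + 1) + (\<Sum>k \<in> {- int K..i}. r powr real_of_int k)" by simp
      also have "\<dots> \<le> r powr (real_of_int i + 1) + r powr (real_of_int i + 1) / (r - 1)"
        using step by simp
      also have "\<dots> = r powr (real_of_int (i + 1) + 1) / (r - 1)"
        using r by (simp add: powr_add power2_eq_square field_simps)
      finally show ?case .
    qed
  qed
  have fm: "r powr real_of_int m \<le> y powr \<beta>"
  proof -
    have "r powr real_of_int m \<le> r powr log 2 y"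
      using r by (intro powr_mono) (auto simp: m_def)
    also have "\<dots> = (2 powr log 2 y) powr \<beta>"
      by (simp only: r_def powr_powr mult.commute)
    finally show ?thesis using y by simp
  qed
  have "(\<Sum>k \<in> {k\<in>{- int K..<int K}. 2 powr real_of_int k \<le> y}. (2 powr real_of_int (k + 1)) powr \<beta>)
     \<le> (\<Sum>k \<in> {- int K..m}. r * r powr real_of_int k)"
    unfolding e using sub r by (intro sum_mono2) auto
  also have "\<dots> \<le> r * (r powr (real_of_int m + 1) / (r - 1))"
    unfolding sum_distrib_left[symmetric] using geo r by (intro mult_left_mono) auto
  also have "\<dots> = (r * r) / (r - 1) * r powr real_of_int m"
  proof -
    have "r powr (real_of_int m + 1) = r powr real_of_int m * r" using r by (simp add: powr_add)
    then show ?thesis by (simp only: times_divide_eq_left times_divide_eq_right mult_ac)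
  qed
  also have "\<dots> \<le> (r * r) / (r - 1) * y powr \<beta>"
    using r fm by (intro mult_left_mono) auto
  also have "r * r = 4 powr \<beta>" by (simp add: r_def flip: powr_mult)
  finally show ?thesis unfolding r_def .
qed


text \<open>This class lies in every $L^p$ with \<open>p \<ge> 1\<close> and is stable under cutting
  off to Borel sets, so each piece of a function may be tested at both endpoints of the
  interpolation. Boundedness also makes the dyadic decomposition stop at the top.\<close>

definition bdd_integrable :: "('a::euclidean_space \<Rightarrow> complex) \<Rightarrow> bool" where
  "bdd_integrable f \<longleftrightarrow> integrable lborel f \<and> (\<exists>K. \<forall>x. cmod (f x) \<le> K)"

lemma bdd_integrable_measurable:
  assumes "bdd_integrable f"
  shows "f \<in> borel_measurable borel"
proof -
  have "integrable lborel f" using assms by (simp add: bdd_integrable_def)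
  from borel_measurable_integrable[OF this] show ?thesis by simp
qed

lemma bdd_integrable_dominated:
  assumes "bdd_integrable f" "g \<in> borel_measurable borel" "\<And>x. cmod (g x) \<le> cmod (f x)"
  shows "bdd_integrable g"
proof -
  obtain K where K: "\<And>x. cmod (f x) \<le> K" and i: "integrable lborel f"
    using assms(1) by (auto simp: bdd_integrable_def)
  have "integrable lborel g"
    by (rule Bochner_Integration.integrable_bound[OF i]) (use assms in auto)
  then show ?thesis
    unfolding bdd_integrable_def using order_trans[OF assms(3) K] by blast
qed

lemma bdd_integrable_indicator:
  assumes "bdd_integrable f" "S \<in> sets borel"
  shows "bdd_integrable (\<lambda>x. indicator S x *\<^sub>R f x)"
proof -
  have [measurable]: "f \<in> borel_measurable borel" "S \<in> sets borel"
    using assms bdd_integrable_measurable by auto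
  show ?thesis
    by (rule bdd_integrable_dominated[OF assms(1)]) (measurable, auto simp: indicator_def)
qed

lemma bdd_integrable_powr:
  assumes f: "bdd_integrable f" and p: "p \<ge> 1"
  shows "integrable lborel (\<lambda>x. cmod (f x) powr p)"
proof -
  have [measurable]: "f \<in> borel_measurable borel" using f by (rule bdd_integrable_measurable)
  obtain K where K: "\<And>x. cmod (f x) \<le> K" using f by (auto simp: bdd_integrable_def)
  have "cmod (f x) powr p \<le> K powr (p - 1) * cmod (f x)" for x
  proof (cases "f x = 0")
    case False
    have "cmod (f x) powr p = cmod (f x) powr (p - 1) * cmod (f x)"
      using False powr_add[of "cmod (f x)" "p - 1" 1] by simp
    also have "\<dots> \<le> K powr (p - 1) * cmod (f x)"
      using p K[of x] by (intro mult_right_mono powr_mono2) auto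
    finally show ?thesis .
  qed simp
  then have le: "norm (cmod (f x) powr p) \<le> norm (K powr (p - 1) * cmod (f x))" for x
    by (simp add: abs_mult)
  have "integrable lborel (\<lambda>x. K powr (p - 1) * cmod (f x))"
    using f unfolding bdd_integrable_def by (intro integrable_mult_right integrable_norm) simp
  then show ?thesis
    by (rule Bochner_Integration.integrable_bound) (measurable, simp only: le always_eventually simp_thms)
qed

lemma bdd_integrable_square:
  assumes f: "bdd_integrable f"
  shows "integrable lborel (\<lambda>x. (cmod (f x))\<^sup>2)"
proof -
  have "(\<lambda>x. cmod (f x) powr 2) = (\<lambda>x. (cmod (f x))\<^sup>2)" by (simp add: fun_eq_iff)
  then show ?thesis using bdd_integrable_powr[OF f, of 2] by simp
qed

lemma bdd_integrable_norm:
  assumes f: "bdd_integrable f"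
  shows "integrable lborel (\<lambda>x. cmod (f x))"
  using f unfolding bdd_integrable_def by (intro integrable_norm) simp

lemma bdd_integrable_add:
  assumes "bdd_integrable f" "bdd_integrable g"
  shows "bdd_integrable (\<lambda>x. f x + g x)"
proof -
  obtain K L where "\<And>x. cmod (f x) \<le> K" "\<And>x. cmod (g x) \<le> L"
    using assms by (auto simp: bdd_integrable_def)
  then have "cmod (f x + g x) \<le> K + L" for x
    by (intro norm_triangle_mono) auto
  moreover have "integrable lborel (\<lambda>x. f x + g x)"
    using assms unfolding bdd_integrable_def by (intro Bochner_Integration.integrable_add) simp_all
  ultimately show ?thesis unfolding bdd_integrable_def by blast
qed

lemma bdd_integrable_sum:
  assumes "finite I" "\<And>i. i \<in> I \<Longrightarrow> bdd_integrable (f i)"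
  shows "bdd_integrable (\<lambda>x. \<Sum>i\<in>I. f i x)"
  using assms
proof (induction I rule: finite_induct)
  case empty
  then show ?case by (auto simp: bdd_integrable_def)
next
  case (insert i I)
  then show ?case by (simp add: bdd_integrable_add)
qed

text \<open>The dyadic piece of \<open>f\<close> at height \<open>2 powr k\<close> is paired with \<open>g\<close> split at height
  \<open>c / 2 powr k\<close>: the high part of \<open>g\<close> is estimated in $L^1$, the low part in $L^2$. Both sums over
  \<open>k\<close> then close up without logarithmic loss; \<open>c\<close> is optimised afterwards.\<close>

lemma bilinear_interpolation_threshold:
  fixes f g :: "'a::euclidean_space \<Rightarrow> complex"
    and B :: "('a \<Rightarrow> complex) \<Rightarrow> ('a \<Rightarrow> complex) \<Rightarrow> complex"
  assumes p: "1 < p" "p < 2"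
    and addL: "\<And>f1 f2 g. bdd_integrable f1 \<Longrightarrow> bdd_integrable f2 \<Longrightarrow> bdd_integrable g \<Longrightarrow>
        B (\<lambda>x. f1 x + f2 x) g = B f1 g + B f2 g"
    and addR: "\<And>f g1 g2. bdd_integrable f \<Longrightarrow> bdd_integrable g1 \<Longrightarrow> bdd_integrable g2 \<Longrightarrow>
        B f (\<lambda>x. g1 x + g2 x) = B f g1 + B f g2"
    and b1: "\<And>f g. bdd_integrable f \<Longrightarrow> bdd_integrable g \<Longrightarrow>
        cmod (B f g) \<le> A * (LINT x|lborel. cmod (f x)) * (LINT x|lborel. cmod (g x))"
    and b2: "\<And>f g. bdd_integrable f \<Longrightarrow> bdd_integrable g \<Longrightarrow>
        cmod (B f g) \<le> D * sqrt (LINT x|lborel. (cmod (f x))\<^sup>2) * sqrt (LINT x|lborel. (cmod (g x))\<^sup>2)"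
    and A: "A \<ge> 0" and D: "D \<ge> 0"
    and f: "bdd_integrable f" and g: "bdd_integrable g" and c: "c > 0"
  defines "F \<equiv> LINT x|lborel. cmod (f x) powr p" and "G \<equiv> LINT x|lborel. cmod (g x) powr p"
    and "C \<equiv> 4 powr (2 - p) / (2 powr (2 - p) - 1)"
  shows "cmod (B f g) \<le> A * c powr (1 - p) * F * G + D * (sqrt F * sqrt (C * c powr (2 - p) * G))"
proof -
  note [measurable] = bdd_integrable_measurable[OF f] bdd_integrable_measurable[OF g]
  define \<beta> where "\<beta> = 2 - p"
  have \<beta>: "0 < \<beta>" using p by (simp add: \<beta>_def)
  define S where "S = (\<lambda>k::int. {x. 2 powr real_of_int k \<le> cmod (f x) \<and> cmod (f x) < 2 powr real_of_int (k + 1)})"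
  define fk where "fk = (\<lambda>k x. indicator (S k) x *\<^sub>R f x)"
  define H where "H = (\<lambda>k::int. {x. cmod (g x) > c / 2 powr real_of_int k})"
  define gh where "gh = (\<lambda>k x. indicator (H k) x *\<^sub>R g x)"
  define gl where "gl = (\<lambda>k x. indicator (- H k) x *\<^sub>R g x)"
  have [measurable]: "S k \<in> sets borel" "H k \<in> sets borel" for k by (auto simp: S_def H_def)
  have adm: "bdd_integrable (fk k)" "bdd_integrable (gh k)" "bdd_integrable (gl k)" for k
    unfolding fk_def gh_def gl_def by (intro bdd_integrable_indicator f g; measurable)+
  have F0: "F \<ge> 0" and G0: "G \<ge> 0" by (simp_all add: F_def G_def)
  define N where "N = (\<lambda>k. LINT x|lborel. cmod (fk k x) powr p)"
  have N0: "N k \<ge> 0" for k by (simp add: N_def)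
  define q where "q = (\<lambda>k. LINT x|lborel. (cmod (gl k x))\<^sup>2)"
  have q0: "q k \<ge> 0" for k by (simp add: q_def)
  have 1: "(LINT x|lborel. cmod (fk k x)) \<le> (2 powr real_of_int k) powr (1 - p) * N k" for k
  proof -
    have "(LINT x|lborel. cmod (fk k x)) \<le> (LINT x|lborel. (2 powr real_of_int k) powr (1 - p) * cmod (fk k x) powr p)"
    proof (intro integral_mono integrable_mult_right bdd_integrable_powr bdd_integrable_norm adm)
      fix x
      show "cmod (fk k x) \<le> (2 powr real_of_int k) powr (1 - p) * cmod (fk k x) powr p"
      proof (cases "x \<in> S k")
        case True
        then have *: "2 powr real_of_int k \<le> cmod (f x)" by (simp add: S_def)
        then have pos: "0 < cmod (f x)" by (smt (verit) powr_gt_zero)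
        have "cmod (f x) = cmod (f x) powr (1 - p) * cmod (f x) powr p"
          using pos powr_add[of "cmod (f x)" "1 - p" p] by simp
        also have "\<dots> \<le> (2 powr real_of_int k) powr (1 - p) * cmod (f x) powr p"
          using p * by (intro mult_right_mono powr_mono2') auto
        finally show ?thesis using True by (simp add: fk_def)
      qed (simp add: fk_def)
    qed (use p in auto)
    then show ?thesis by (simp add: N_def)
  qed
  have 2: "(LINT x|lborel. (cmod (fk k x))\<^sup>2) \<le> (2 powr real_of_int (k + 1)) powr \<beta> * N k" for k
  proof -
    have "(LINT x|lborel. (cmod (fk k x))\<^sup>2) \<le> (LINT x|lborel. (2 powr real_of_int (k + 1)) powr \<beta> * cmod (fk k x) powr p)"
    proof (intro integral_mono integrable_mult_right bdd_integrable_powr bdd_integrable_square adm)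
      fix x
      show "(cmod (fk k x))\<^sup>2 \<le> (2 powr real_of_int (k + 1)) powr \<beta> * cmod (fk k x) powr p"
      proof (cases "x \<in> S k")
        case True
        then have *: "2 powr real_of_int k \<le> cmod (f x)" "cmod (f x) \<le> 2 powr real_of_int (k + 1)"
          by (simp_all add: S_def)
        then have pos: "0 < cmod (f x)" by (smt (verit) powr_gt_zero)
        have "(cmod (f x))\<^sup>2 = cmod (f x) powr \<beta> * cmod (f x) powr p"
          using pos powr_add[of "cmod (f x)" \<beta> p] by (simp add: \<beta>_def)
        also have "\<dots> \<le> (2 powr real_of_int (k + 1)) powr \<beta> * cmod (f x) powr p"
          using \<beta> * by (intro mult_right_mono powr_mono2) auto
        finally show ?thesis using True by (simp add: fk_def)
      qed (simp add: fk_def)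
    qed (use p in auto)
    then show ?thesis by (simp add: N_def)
  qed
  have 3: "(LINT x|lborel. cmod (gh k x)) \<le> (c / 2 powr real_of_int k) powr (1 - p) * G" for k
  proof -
    have "(LINT x|lborel. cmod (gh k x)) \<le> (LINT x|lborel. (c / 2 powr real_of_int k) powr (1 - p) * cmod (g x) powr p)"
    proof (intro integral_mono integrable_mult_right bdd_integrable_powr bdd_integrable_norm adm g)
      fix x
      show "cmod (gh k x) \<le> (c / 2 powr real_of_int k) powr (1 - p) * cmod (g x) powr p"
      proof (cases "x \<in> H k")
        case True
        then have *: "c / 2 powr real_of_int k \<le> cmod (g x)" by (simp add: H_def)
        moreover have c2: "c / 2 powr real_of_int k > 0" using c by simp
        ultimately have pos: "0 < cmod (g x)" by linarith
        have "cmod (g x) = cmod (g x) powr (1 - p) * cmod (g x) powr p"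
          using pos powr_add[of "cmod (g x)" "1 - p" p] by simp
        also have "\<dots> \<le> (c / 2 powr real_of_int k) powr (1 - p) * cmod (g x) powr p"
          using p * c2 by (intro mult_right_mono powr_mono2') auto
        finally show ?thesis using True by (simp add: gh_def)
      qed (simp add: gh_def)
    qed (use p in auto)
    then show ?thesis by (simp add: G_def)
  qed
  \<comment> \<open>The heights \<open>2 powr k\<close> for \<open>f\<close> and
    \<open>c / 2 powr k\<close> for \<open>g\<close> have product \<open>c\<close>, so the powers of
    2 cancel in the $L^1$ term, which becomes a fixed multiple of \<open>N k\<close>. Only the $L^2$
    term keeps a power of 2, to be absorbed by the sum of the \<open>q k\<close>.\<close>
  have tm: "cmod (B (fk k) g) \<le> A * c powr (1 - p) * G * N k
      + D * (sqrt (N k) * sqrt ((2 powr real_of_int (k + 1)) powr \<beta> * q k))" for k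
  proof -
    have "g = (\<lambda>x. gh k x + gl k x)" by (auto simp: gh_def gl_def indicator_def fun_eq_iff)
    then have "B (fk k) g = B (fk k) (gh k) + B (fk k) (gl k)" using addR adm by metis
    then have "cmod (B (fk k) g) \<le> cmod (B (fk k) (gh k)) + cmod (B (fk k) (gl k))"
      by (simp add: norm_triangle_ineq)
    also have "cmod (B (fk k) (gh k)) \<le> A * (LINT x|lborel. cmod (fk k x)) * (LINT x|lborel. cmod (gh k x))"
      by (rule b1[OF adm(1) adm(2)])
    also have "\<dots> \<le> A * ((2 powr real_of_int k) powr (1 - p) * N k) * ((c / 2 powr real_of_int k) powr (1 - p) * G)"
      using A N0 1 3 by (intro mult_mono mult_left_mono mult_nonneg_nonneg) auto
    also have "\<dots> = A * ((2 powr real_of_int k) * (c / 2 powr real_of_int k)) powr (1 - p) * G * N k"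
      by (subst powr_mult) (use c in auto)
    also have "(2 powr real_of_int k) * (c / 2 powr real_of_int k) = c" by simp
    also have "cmod (B (fk k) (gl k)) \<le> D * sqrt (LINT x|lborel. (cmod (fk k x))\<^sup>2) * sqrt (q k)"
      unfolding q_def by (rule b2[OF adm(1) adm(3)])
    also have "\<dots> \<le> D * sqrt ((2 powr real_of_int (k + 1)) powr \<beta> * N k) * sqrt (q k)"
      using D 2[of k] q0[of k] by (intro mult_right_mono mult_left_mono) auto
    also have "\<dots> = D * (sqrt (N k) * sqrt ((2 powr real_of_int (k + 1)) powr \<beta> * q k))"
      by (simp add: real_sqrt_mult)
    finally show ?thesis by simp
  qed
  obtain K0 where K0: "\<And>x. cmod (f x) \<le> K0" using f by (auto simp: bdd_integrable_def)
  obtain k0 :: nat where k0: "2 ^ k0 > K0" using real_arch_pow[of 2 K0] by auto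
  \<comment> \<open>\<open>B\<close> is only additive, so the decomposition has to be finite. The
    bound on \<open>f\<close> ends it above; the remainder below height
    \<open>2 powr - real K\<close> is estimated by \<open>b2\<close> and vanishes as
    \<open>K\<close> grows.\<close>
  define L where "L = (\<lambda>K::nat. {x. cmod (f x) < 2 powr - real K})"
  define low where "low = (\<lambda>K x. indicator (L K) x *\<^sub>R f x)"
  have [measurable]: "L K \<in> sets borel" for K by (auto simp: L_def)
  have adm': "bdd_integrable (low K)" for K
    unfolding low_def by (intro bdd_integrable_indicator f; measurable)
  have ind: "indicator (S k) x = (if k = \<lfloor>log 2 (cmod (f x))\<rfloor> then 1 else 0 :: real)" if "f x \<noteq> 0" for k x
  proof -
    have "x \<in> S k \<longleftrightarrow> k = \<lfloor>log 2 (cmod (f x))\<rfloor>"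
      using that by (auto simp: S_def le_log_iff log_less_iff eq_commute[of k] floor_eq_iff)
    then show ?thesis by (simp add: indicator_def)
  qed
  have decomp: "f x = low K x + (\<Sum>k\<in>{- int K..<int K}. fk k x)" if "K \<ge> k0" for K x
  proof (cases "f x = 0")
    case True
    then show ?thesis by (simp add: low_def fk_def)
  next
    case False
    define m where "m = \<lfloor>log 2 (cmod (f x))\<rfloor>"
    have "cmod (f x) < 2 ^ k0" using K0[of x] k0 by linarith
    also have "(2::real) ^ k0 \<le> 2 ^ K" using that by simp
    finally have "log 2 (cmod (f x)) < real K"
      using False by (simp add: log_less_iff powr_realpow)
    then have mK: "m < int K" by (simp add: m_def floor_less_iff)
    have mL: "x \<in> L K \<longleftrightarrow> m < - int K"
      using False by (simp add: m_def floor_less_iff L_def log_less_iff)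
    have "(\<Sum>k\<in>{- int K..<int K}. fk k x) = (\<Sum>k\<in>{- int K..<int K}. if k = m then f x else 0)"
      unfolding fk_def ind[OF False] m_def by (intro sum.cong) auto
    also have "\<dots> = (if m < - int K then 0 else f x)" using mK by (auto simp: sum.delta')
    finally show ?thesis using mL by (simp add: low_def)
  qed
  define X where "X = A * c powr (1 - p) * F * G + D * (sqrt F * sqrt (C * c powr (2 - p) * G))"
  have main: "cmod (B f g) \<le> X + D * sqrt (2 powr (- real K * \<beta>) * F) * sqrt (LINT x|lborel. (cmod (g x))\<^sup>2)"
    if K: "K \<ge> k0" for K
  proof -
    let ?I = "{- int K..<int K}"
    have sumB: "B (\<lambda>x. \<Sum>k\<in>I. fk k x) g = (\<Sum>k\<in>I. B (fk k) g)" if "finite I" for I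
      using that
    proof (induction I rule: finite_induct)
      case empty
      have "bdd_integrable (\<lambda>x::'a. 0)" by (auto simp: bdd_integrable_def)
      from b1[OF this g] show ?case by simp
    next
      case (insert i I)
      then show ?case by (simp add: addL adm g bdd_integrable_sum)
    qed
    have "f = (\<lambda>x. low K x + (\<Sum>k\<in>?I. fk k x))" using decomp[OF K] by auto
    then have "B f g = B (low K) g + (\<Sum>k\<in>?I. B (fk k) g)"
      using addL[OF adm'[of K] bdd_integrable_sum g, of ?I fk] adm sumB[of ?I] by simp
    then have "cmod (B f g) \<le> cmod (B (low K) g) + (\<Sum>k\<in>?I. cmod (B (fk k) g))"
      using norm_triangle_mono[OF order_refl norm_sum] by metis
    also have "(\<Sum>k\<in>?I. cmod (B (fk k) g)) \<le> (\<Sum>k\<in>?I. A * c powr (1 - p) * G * N k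
      + D * (sqrt (N k) * sqrt ((2 powr real_of_int (k + 1)) powr \<beta> * q k)))"
      by (intro sum_mono tm)
    also have "\<dots> = A * c powr (1 - p) * G * (\<Sum>k\<in>?I. N k)
      + D * (\<Sum>k\<in>?I. sqrt (N k) * sqrt ((2 powr real_of_int (k + 1)) powr \<beta> * q k))"
      by (simp add: sum.distrib sum_distrib_left)
    also have "\<dots> \<le> A * c powr (1 - p) * G * F + D * (sqrt F * sqrt (C * c powr \<beta> * G))"
    proof (intro add_mono mult_left_mono)
      have "(\<Sum>k\<in>?I. N k) = (LINT x|lborel. (\<Sum>k\<in>?I. cmod (fk k x) powr p))"
        unfolding N_def using p
        by (subst Bochner_Integration.integral_sum) (auto intro!: bdd_integrable_powr adm)
      also have "\<dots> \<le> F" unfolding F_def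
      proof (intro integral_mono Bochner_Integration.integrable_sum bdd_integrable_powr adm f)
        fix x
        show "(\<Sum>k\<in>?I. cmod (fk k x) powr p) \<le> cmod (f x) powr p"
        proof (cases "f x = 0")
          case False
          have "(\<Sum>k\<in>?I. cmod (fk k x) powr p) = (\<Sum>k\<in>?I. if k = \<lfloor>log 2 (cmod (f x))\<rfloor> then cmod (f x) powr p else 0)"
            unfolding fk_def ind[OF False] by (intro sum.cong) auto
          then show ?thesis by (auto simp: sum.delta')
        qed (simp add: fk_def)
      qed (use p in auto)
      finally show NF: "(\<Sum>k\<in>?I. N k) \<le> F" .
      have "(\<Sum>k\<in>?I. (2 powr real_of_int (k + 1)) powr \<beta> * q k)
          = (LINT x|lborel. (\<Sum>k\<in>?I. (2 powr real_of_int (k + 1)) powr \<beta> * (cmod (gl k x))\<^sup>2))"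
        unfolding q_def
        by (subst Bochner_Integration.integral_sum) (auto intro!: integrable_mult_right bdd_integrable_square adm)
      also have "\<dots> \<le> (LINT x|lborel. C * c powr \<beta> * cmod (g x) powr p)"
      proof (intro integral_mono Bochner_Integration.integrable_sum integrable_mult_right
          bdd_integrable_square bdd_integrable_powr adm g)
        fix x
        show "(\<Sum>k\<in>?I. (2 powr real_of_int (k + 1)) powr \<beta> * (cmod (gl k x))\<^sup>2) \<le> C * c powr \<beta> * cmod (g x) powr p"
        proof (cases "g x = 0")
          case False
          then have pos: "cmod (g x) > 0" by simp
          \<comment> \<open>For fixed \<open>x\<close> the value \<open>gl k x\<close> is nonzero
            exactly for those \<open>k\<close> with \<open>2 powr k \<le> c / cmod (g x)\<close>, so
            the weights form a geometric series ending there.\<close>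
          have "(\<Sum>k\<in>?I. (2 powr real_of_int (k + 1)) powr \<beta> * (cmod (gl k x))\<^sup>2)
            = (\<Sum>k\<in>?I. if 2 powr real_of_int k \<le> c / cmod (g x) then (2 powr real_of_int (k + 1)) powr \<beta> * (cmod (g x))\<^sup>2 else 0)"
            using pos by (intro sum.cong) (auto simp: gl_def H_def indicator_def field_simps)
          also have "\<dots> = (\<Sum>k\<in>{k\<in>?I. 2 powr real_of_int k \<le> c / cmod (g x)}. (2 powr real_of_int (k + 1)) powr \<beta>) * (cmod (g x))\<^sup>2"
            by (subst sum.inter_filter[symmetric]) (auto simp: sum_distrib_right)
          also have "\<dots> \<le> (C * (c / cmod (g x)) powr \<beta>) * (cmod (g x))\<^sup>2"
            unfolding C_def \<beta>_def[symmetric] using pos c \<beta>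
            by (intro mult_right_mono geometric_sum_le) auto
          also have "\<dots> = C * c powr \<beta> * cmod (g x) powr p"
          proof -
            have "(c / cmod (g x)) powr \<beta> * (cmod (g x))\<^sup>2 = c powr \<beta> * cmod (g x) powr p"
              using pos c powr_add[of "cmod (g x)" \<beta> p]
              by (simp add: powr_divide \<beta>_def field_simps)
            then show ?thesis by (simp only: mult.assoc)
          qed
          finally show ?thesis .
        qed (simp add: gl_def)
      qed (use p in auto)
      finally have qG: "(\<Sum>k\<in>?I. (2 powr real_of_int (k + 1)) powr \<beta> * q k) \<le> C * c powr \<beta> * G"
        by (simp add: G_def)
      \<comment> \<open>Cauchy-Schwarz over the dyadic levels reduces the sum of square roots to the
        two sums just bounded; this is what avoids a factor counting the levels.\<close>
      have "(\<Sum>k\<in>?I. sqrt (N k) * sqrt ((2 powr real_of_int (k + 1)) powr \<beta> * q k))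
        \<le> sqrt ((\<Sum>k\<in>?I. (sqrt (N k))\<^sup>2) * (\<Sum>k\<in>?I. (sqrt ((2 powr real_of_int (k + 1)) powr \<beta> * q k))\<^sup>2))"
        using Cauchy_Schwarz_ineq_sum by (rule real_le_rsqrt)
      also have "\<dots> = sqrt (\<Sum>k\<in>?I. N k) * sqrt (\<Sum>k\<in>?I. (2 powr real_of_int (k + 1)) powr \<beta> * q k)"
        using N0 q0 by (simp add: real_sqrt_mult power_mult_distrib)
      also have "\<dots> \<le> sqrt F * sqrt (C * c powr \<beta> * G)"
        using NF qG F0 N0 q0 by (intro mult_mono) (auto intro!: sum_nonneg)
      finally show "(\<Sum>k\<in>?I. sqrt (N k) * sqrt ((2 powr real_of_int (k + 1)) powr \<beta> * q k))
        \<le> sqrt F * sqrt (C * c powr \<beta> * G)" .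
    qed (use A D G0 in auto)
    also have "\<dots> = X" by (simp add: X_def \<beta>_def)
    also have "cmod (B (low K) g) \<le> D * sqrt (LINT x|lborel. (cmod (low K x))\<^sup>2) * sqrt (LINT x|lborel. (cmod (g x))\<^sup>2)"
      by (rule b2[OF adm' g])
    also have "(LINT x|lborel. (cmod (low K x))\<^sup>2) \<le> (LINT x|lborel. 2 powr (- real K * \<beta>) * cmod (f x) powr p)"
    proof (intro integral_mono integrable_mult_right bdd_integrable_powr bdd_integrable_square adm' f)
      fix x
      show "(cmod (low K x))\<^sup>2 \<le> 2 powr (- real K * \<beta>) * cmod (f x) powr p"
      proof (cases "x \<in> L K \<and> f x \<noteq> 0")
        case True
        then have *: "cmod (f x) \<le> 2 powr - real K" by (simp add: L_def)
        have "(cmod (f x))\<^sup>2 = cmod (f x) powr \<beta> * cmod (f x) powr p"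
          using True powr_add[of "cmod (f x)" \<beta> p] by (simp add: \<beta>_def)
        also have "\<dots> \<le> (2 powr - real K) powr \<beta> * cmod (f x) powr p"
          using \<beta> * by (intro mult_right_mono powr_mono2) auto
        finally show ?thesis using True by (simp add: low_def powr_powr)
      qed (auto simp: low_def)
    qed (use p in auto)
    finally show ?thesis
      using D by (simp add: F_def mult_left_mono mult_right_mono)
  qed
  have "((\<lambda>K. X + D * sqrt (2 powr (- real K * \<beta>) * F) * sqrt (LINT x|lborel. (cmod (g x))\<^sup>2))
      \<longlongrightarrow> X + D * sqrt (0 * F) * sqrt (LINT x|lborel. (cmod (g x))\<^sup>2)) sequentially"
  proof (intro tendsto_intros)
    have "(\<lambda>K. (2 powr - \<beta>) ^ K) \<longlonglongrightarrow> 0"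
      using \<beta> by (intro LIMSEQ_power_zero) (auto simp: powr_less_one)
    then show "(\<lambda>K. 2 powr (- real K * \<beta>)) \<longlonglongrightarrow> 0"
      by (simp add: powr_realpow[symmetric] powr_powr mult.commute)
  qed
  then have "cmod (B f g) \<le> X + D * sqrt (0 * F) * sqrt (LINT x|lborel. (cmod (g x))\<^sup>2)"
    by (rule tendsto_lowerbound) (use main in \<open>auto intro!: eventually_sequentiallyI[of k0]\<close>)
  then show ?thesis by (simp add: X_def)
qed

text \<open>The threshold is optimised: with \<open>Q = sqrt (F * G)\<close>, the choice
  \<open>c = (A * Q) powr (2 / p)\<close> gives both terms the same powers of \<open>A\<close> and
  \<open>Q\<close>. \<open>D\<close> stays out of the balance because it will depend on the
  dimension alone, whereas \<open>A\<close> will carry the time decay, which emerges with the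
  exponent \<open>2 / p - 1\<close>.\<close>

lemma bilinear_interpolation:
  fixes f g :: "'a::euclidean_space \<Rightarrow> complex"
    and B :: "('a \<Rightarrow> complex) \<Rightarrow> ('a \<Rightarrow> complex) \<Rightarrow> complex"
  assumes p: "1 < p" "p < 2"
    and addL: "\<And>f1 f2 g. bdd_integrable f1 \<Longrightarrow> bdd_integrable f2 \<Longrightarrow> bdd_integrable g \<Longrightarrow>
        B (\<lambda>x. f1 x + f2 x) g = B f1 g + B f2 g"
    and addR: "\<And>f g1 g2. bdd_integrable f \<Longrightarrow> bdd_integrable g1 \<Longrightarrow> bdd_integrable g2 \<Longrightarrow>
        B f (\<lambda>x. g1 x + g2 x) = B f g1 + B f g2"
    and b1: "\<And>f g. bdd_integrable f \<Longrightarrow> bdd_integrable g \<Longrightarrow>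
        cmod (B f g) \<le> A * (LINT x|lborel. cmod (f x)) * (LINT x|lborel. cmod (g x))"
    and b2: "\<And>f g. bdd_integrable f \<Longrightarrow> bdd_integrable g \<Longrightarrow>
        cmod (B f g) \<le> D * sqrt (LINT x|lborel. (cmod (f x))\<^sup>2) * sqrt (LINT x|lborel. (cmod (g x))\<^sup>2)"
    and A: "A > 0" and D: "D \<ge> 0"
    and f: "bdd_integrable f" and g: "bdd_integrable g"
  defines "F \<equiv> LINT x|lborel. cmod (f x) powr p" and "G \<equiv> LINT x|lborel. cmod (g x) powr p"
  shows "cmod (B f g) \<le> (1 + D * sqrt (4 powr (2 - p) / (2 powr (2 - p) - 1)))
           * A powr (2 / p - 1) * (F * G) powr (1 / p)"
proof -
  define C where "C = (4::real) powr (2 - p) / (2 powr (2 - p) - 1)"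
  have aux: "cmod (B f g) \<le> A * c powr (1 - p) * F * G + D * (sqrt F * sqrt (C * c powr (2 - p) * G))"
    if "c > 0" for c
    unfolding F_def G_def C_def
    by (rule bilinear_interpolation_threshold[OF p addL addR b1 b2 _ D f g that]) (use A in auto)
  have FG: "F \<ge> 0" "G \<ge> 0" by (simp_all add: F_def G_def)
  show ?thesis
  proof (cases "F = 0 \<or> G = 0")
    \<comment> \<open>The balancing \<open>c\<close> would be 0 here and thus not admissible, but
      the bound already vanishes at \<open>c = 1\<close>.\<close>
    case True
    then show ?thesis using aux[of 1] by auto
  next
    case False
    define Q where "Q = sqrt (F * G)"
    have Q: "Q > 0" "F * G = Q\<^sup>2" using FG False by (auto simp: Q_def)
    define c where "c = (A * Q) powr (2 / p)"
    have AQ: "A * Q > 0" using A Q by simp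
    have e1: "2 / p * (1 - p) = 2 / p - 2" and e2: "2 / p * (2 - p) * (1 / 2) = 2 / p - 1"
      using p by (simp_all add: field_simps)
    have c1: "c powr (1 - p) = A powr (2 / p - 2) * Q powr (2 / p - 2)"
      using A Q by (simp only: c_def powr_powr e1) (simp add: powr_mult)
    have A1: "A * A powr (2 / p - 2) = A powr (2 / p - 1)"
      using A powr_add[of A 1 "2 / p - 2"] by simp
    have Q1: "Q\<^sup>2 * Q powr (2 / p - 2) = Q powr (2 / p)"
      using Q powr_add[of Q 2 "2 / p - 2"] by simp
    have "A * c powr (1 - p) * F * G = (A * A powr (2 / p - 2)) * (Q\<^sup>2 * Q powr (2 / p - 2))"
      unfolding c1 Q(2)[symmetric] by (simp only: mult_ac)
    then have 1: "A * c powr (1 - p) * F * G = A powr (2 / p - 1) * Q powr (2 / p)"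
      by (simp only: A1 Q1)
    have "sqrt (c powr (2 - p)) = (c powr (2 - p)) powr (1 / 2)"
      by (simp add: powr_half_sqrt)
    also have "\<dots> = A powr (2 / p - 1) * Q powr (2 / p - 1)"
      using A Q by (simp only: c_def powr_powr e2) (simp add: powr_mult)
    finally have 2: "sqrt (c powr (2 - p)) = A powr (2 / p - 1) * Q powr (2 / p - 1)" .
    have 3: "Q * Q powr (2 / p - 1) = Q powr (2 / p)"
      using Q powr_add[of Q 1 "2 / p - 1"] by simp
    have "sqrt F * sqrt (C * c powr (2 - p) * G) = sqrt C * sqrt (c powr (2 - p)) * Q"
      by (simp only: Q_def real_sqrt_mult mult_ac)
    also have "\<dots> = sqrt C * (A powr (2 / p - 1) * Q powr (2 / p))"
      unfolding 2 3[symmetric] by (simp only: mult_ac)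
    finally have 4: "sqrt F * sqrt (C * c powr (2 - p) * G) = sqrt C * (A powr (2 / p - 1) * Q powr (2 / p))" .
    have 5: "Q powr (2 / p) = (F * G) powr (1 / p)"
    proof -
      have "Q = (F * G) powr (1 / 2)" using FG by (simp add: Q_def powr_half_sqrt)
      then show ?thesis by (simp add: powr_powr)
    qed
    have "c > 0" using A Q by (simp add: c_def)
    from aux[OF this] show ?thesis
      unfolding C_def[symmetric] 1 4 5[symmetric] by (simp only: distrib_right mult_1 mult.assoc)
  qed
qed

section \<open>The diagonal Hardy-Littlewood-Sobolev inequality\<close>

lemma nn_integral_even_le:
  fixes h :: "real \<Rightarrow> ennreal"
  assumes [measurable]: "h \<in> borel_measurable borel"
  shows "(\<integral>\<^sup>+u. h \<bar>u\<bar> \<partial>lborel) \<le> 2 * (\<integral>\<^sup>+u. indicator {0..} u * h u \<partial>lborel)"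
proof -
  have "(\<integral>\<^sup>+u. h \<bar>u\<bar> \<partial>lborel) \<le> (\<integral>\<^sup>+u. indicator {0..} u * h u + indicator {0..} (0 + -1 * u) * h (0 + -1 * u) \<partial>lborel)"
    by (intro nn_integral_mono) (auto simp: indicator_def abs_if)
  also have "\<dots> = (\<integral>\<^sup>+u. indicator {0..} u * h u \<partial>lborel) + (\<integral>\<^sup>+u. indicator {0..} (0 + -1 * u) * h (0 + -1 * u) \<partial>lborel)"
    by (intro nn_integral_add) auto
  also have "(\<integral>\<^sup>+u. indicator {0..} (0 + -1 * u) * h (0 + -1 * u) \<partial>lborel) = (\<integral>\<^sup>+u. indicator {0..} u * h u \<partial>lborel)"
    by (subst nn_integral_real_affine[where c = "-1" and t = 0 and f = "\<lambda>u. indicator {0..} u * h u"]) auto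
  finally show ?thesis by (simp add: mult_2)
qed

lemma nn_integral_abs_powr_near:
  fixes \<alpha> \<delta> :: real
  assumes "0 < \<alpha>" "\<alpha> < 1" "\<delta> > 0"
  shows "(\<integral>\<^sup>+u. ennreal (\<bar>u\<bar> powr - \<alpha>) * indicator {..\<delta>} \<bar>u\<bar> \<partial>lborel) \<le> ennreal (2 * \<delta> powr (1 - \<alpha>) / (1 - \<alpha>))"
proof -
  have "(\<integral>\<^sup>+u. ennreal (\<bar>u\<bar> powr - \<alpha>) * indicator {..\<delta>} \<bar>u\<bar> \<partial>lborel)
      \<le> 2 * (\<integral>\<^sup>+u. indicator {0..} u * (ennreal (u powr - \<alpha>) * indicator {..\<delta>} u) \<partial>lborel)"
    by (rule nn_integral_even_le) measurable
  also have "(\<integral>\<^sup>+u. indicator {0..} u * (ennreal (u powr - \<alpha>) * indicator {..\<delta>} u) \<partial>lborel)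
      = (\<integral>\<^sup>+u. ennreal (indicator {0..\<delta>} u * u powr - \<alpha>) \<partial>lborel)"
    by (intro nn_integral_cong) (auto simp: indicator_def)
  also have "\<dots> = ennreal (\<delta> powr (- \<alpha> + 1) / (- \<alpha> + 1))"
    using assms by (intro nn_integral_has_integral_lebesgue has_integral_powr_from_0) auto
  finally show ?thesis
    using assms by (simp add: ennreal_mult[symmetric] flip: ennreal_numeral)
qed

lemma nn_integral_inverse_square_far:
  fixes \<delta> :: real
  assumes "\<delta> > 0"
  shows "(\<integral>\<^sup>+u. ennreal (\<bar>u\<bar> powr - 2) * indicator {\<delta><..} \<bar>u\<bar> \<partial>lborel) \<le> ennreal (2 / \<delta>)"
proof -
  have "(\<integral>\<^sup>+u. ennreal (\<bar>u\<bar> powr - 2) * indicator {\<delta><..} \<bar>u\<bar> \<partial>lborel)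
      \<le> 2 * (\<integral>\<^sup>+u. indicator {0..} u * (ennreal (u powr - 2) * indicator {\<delta><..} u) \<partial>lborel)"
    by (rule nn_integral_even_le) measurable
  also have "(\<integral>\<^sup>+u. indicator {0..} u * (ennreal (u powr - 2) * indicator {\<delta><..} u) \<partial>lborel)
      \<le> (\<integral>\<^sup>+u. ennreal (indicator {\<delta>..} u * u powr - 2) \<partial>lborel)"
    by (intro nn_integral_mono) (auto simp: indicator_def)
  also have "\<dots> = ennreal (- (\<delta> powr (- 2 + 1)) / (- 2 + 1))"
    using assms by (intro nn_integral_has_integral_lebesgue has_integral_powr_to_inf) auto
  finally show ?thesis
    using assms by (simp add: ennreal_mult[symmetric] powr_minus_divide mult_left_mono flip: ennreal_numeral)
qed

text \<open>A form of Young's inequality, by dichotomy: if the first term on the right does not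
  dominate alone, then \<open>y\<close> is at most
  \<open>\<mu> powr (- 1 / (p - 1)) * u powr (- \<alpha> / (p - 1))\<close>. The relation imposed on
  \<open>\<alpha>\<close> says that \<open>u powr - \<alpha>\<close>, raised to the exponent
  conjugate to \<open>p\<close>, is \<open>u powr - 2\<close>.\<close>

lemma hls_pointwise:
  fixes y u \<mu> p \<alpha> :: real
  assumes p: "1 < p" and y: "0 \<le> y" and u: "u > 0" and m: "\<mu> > 0"
    and al: "\<alpha> * p = 2 * (p - 1)"
  shows "y * u powr - \<alpha> \<le> \<mu> * y powr p + \<mu> powr (- 1 / (p - 1)) * u powr - 2"
proof (cases "y * u powr - \<alpha> \<le> \<mu> * y powr p")
  case True
  then show ?thesis using m by (simp add: add_increasing2)
next
  case False
  then have y: "y > 0" using assms(2) m by (cases "y = 0") auto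
  have "\<mu> * y powr (p - 1) < u powr - \<alpha>"
  proof -
    have "y powr p = y powr (p - 1) * y" using y powr_add[of y "p - 1" 1] by simp
    with False have "(\<mu> * y powr (p - 1)) * y < u powr - \<alpha> * y" by (simp add: mult_ac)
    then show ?thesis using y by simp
  qed
  then have "(\<mu> * y powr (p - 1)) powr (1 / (p - 1)) \<le> (u powr - \<alpha>) powr (1 / (p - 1))"
    using p m y by (intro powr_mono2) auto
  then have "\<mu> powr (1 / (p - 1)) * y \<le> u powr (- \<alpha> / (p - 1))"
    using p m y by (simp add: powr_mult powr_powr)
  then have "y \<le> \<mu> powr (- 1 / (p - 1)) * u powr (- \<alpha> / (p - 1))"
  proof -
    have i: "\<mu> powr (- 1 / (p - 1)) * \<mu> powr (1 / (p - 1)) = 1"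
      using m by (simp add: powr_add[symmetric])
    assume "\<mu> powr (1 / (p - 1)) * y \<le> u powr (- \<alpha> / (p - 1))"
    from mult_left_mono[OF this, of "\<mu> powr (- 1 / (p - 1))"] show ?thesis
      by (simp only: mult.assoc[symmetric] i) simp
  qed
  then have "y * u powr - \<alpha> \<le> \<mu> powr (- 1 / (p - 1)) * (u powr (- \<alpha> / (p - 1)) * u powr - \<alpha>)"
    using mult_right_mono[of y _ "u powr - \<alpha>"] by (simp only: mult.assoc[symmetric] powr_ge_zero)
  also have "u powr (- \<alpha> / (p - 1)) * u powr - \<alpha> = u powr - 2"
  proof -
    have "- \<alpha> / (p - 1) + - \<alpha> = - 2" using p al by (simp add: field_simps)
    then show ?thesis by (simp add: powr_add[symmetric])
  qed
  finally show ?thesis using m by (simp add: add_increasing)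
qed

text \<open>By symmetry the double integral may be restricted to \<open>H t \<le> H s\<close>. There the kernel is
  integrable against \<open>H s\<close> near the diagonal, and Young's inequality with an \<open>s\<close>-dependent weight
  handles the rest, because the conjugate power of the kernel decays like an inverse square.\<close>

lemma hls_one_sided:
  fixes H :: "real \<Rightarrow> real"
  assumes [measurable]: "H \<in> borel_measurable borel" and H0: "\<And>t. H t \<ge> 0"
    and p: "1 < p" "p < 2" and \<alpha>: "\<alpha> = 2 - 2 / p" and M: "M > 0"
    and HM: "(\<integral>\<^sup>+t. ennreal (H t powr p) \<partial>lborel) \<le> ennreal M"
  shows "(\<integral>\<^sup>+t. ennreal (H s * H t * \<bar>t - s\<bar> powr - \<alpha>) * indicator {t. H t \<le> H s} t \<partial>lborel)
     \<le> ennreal ((2 / (1 - \<alpha>) + 3) * M powr (2 / p - 1) * H s powr p)"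
proof (cases "H s = 0")
  case True
  then show ?thesis by simp
next
  case False
  then have h: "H s > 0" using H0[of s] by simp
  \<comment> \<open>With these choices the near part, the part with \<open>H t powr p\<close> and
    the far part all become multiples of the same quantity \<open>X\<close>. \<open>\<delta>\<close>
    is the length of an interval on which the constant value \<open>H s\<close> has
    \<open>p\<close>-mass \<open>M\<close>.\<close>
  define \<delta> where "\<delta> = M * H s powr - p"
  define \<mu> where "\<mu> = M powr (2 / p - 2) * H s powr (p - 1)"
  have \<delta>: "\<delta> > 0" and \<mu>: "\<mu> > 0" using M h by (simp_all add: \<delta>_def \<mu>_def)
  have al: "0 < \<alpha>" "\<alpha> < 1" "\<alpha> * p = 2 * (p - 1)" using p by (auto simp: \<alpha> field_simps)
  define X where "X = M powr (2 / p - 1) * H s powr p"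
  have X0: "X \<ge> 0" by (simp add: X_def)
  define near where "near = (\<lambda>u. ennreal (\<bar>u\<bar> powr - \<alpha>) * indicator {..\<delta>} \<bar>u\<bar>)"
  define far where "far = (\<lambda>u. ennreal (\<bar>u\<bar> powr - 2) * indicator {\<delta><..} \<bar>u\<bar>)"
  have [measurable]: "near \<in> borel_measurable borel" "far \<in> borel_measurable borel"
    unfolding near_def far_def by measurable
  define \<nu> where "\<nu> = \<mu> powr (- 1 / (p - 1))"
  have transl: "(\<integral>\<^sup>+t. k (t - s) \<partial>lborel) = (\<integral>\<^sup>+u. k u \<partial>lborel)"
    if [measurable]: "k \<in> borel_measurable borel" for k :: "real \<Rightarrow> ennreal"
    by (subst nn_integral_real_affine[where c = 1 and t = s]) auto
  have pw: "ennreal (H s * H t * \<bar>t - s\<bar> powr - \<alpha>) * indicator {t. H t \<le> H s} t \<le>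
     ennreal ((H s)\<^sup>2) * near (t - s) + (ennreal (H s * \<mu>) * ennreal (H t powr p)
       + ennreal (H s * \<nu>) * far (t - s))" for t
  \<comment> \<open>At \<open>t = s\<close> the kernel is \<open>0 powr - \<alpha> = 0\<close>, so
    the diagonal belongs to the trivial case together with the points outside the indicator
    set.\<close>
  proof (cases "H t \<le> H s \<and> t \<noteq> s")
    case True
    show ?thesis
    proof (cases "\<bar>t - s\<bar> \<le> \<delta>")
      case near: True
      have "H s * H t * \<bar>t - s\<bar> powr - \<alpha> \<le> (H s)\<^sup>2 * \<bar>t - s\<bar> powr - \<alpha>"
        using True h by (intro mult_right_mono) (auto simp: power2_eq_square mult_left_mono)
      then have "ennreal (H s * H t * \<bar>t - s\<bar> powr - \<alpha>) \<le> ennreal ((H s)\<^sup>2) * ennreal (\<bar>t - s\<bar> powr - \<alpha>)"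
        by (simp add: ennreal_mult[symmetric] ennreal_leI)
      then show ?thesis using near by (simp add: near_def True add_increasing2)
    next
      case far: False
      have "H t * \<bar>t - s\<bar> powr - \<alpha> \<le> \<mu> * H t powr p + \<nu> * \<bar>t - s\<bar> powr - 2"
        unfolding \<nu>_def using True H0 p \<mu> al h by (intro hls_pointwise) auto
      then have "H s * (H t * \<bar>t - s\<bar> powr - \<alpha>) \<le> H s * (\<mu> * H t powr p + \<nu> * \<bar>t - s\<bar> powr - 2)"
        using h by (intro mult_left_mono) auto
      then have "ennreal (H s * H t * \<bar>t - s\<bar> powr - \<alpha>) \<le> ennreal (H s * \<mu> * H t powr p + H s * \<nu> * \<bar>t - s\<bar> powr - 2)"
        by (intro ennreal_leI) (simp add: algebra_simps)
      also have "\<dots> = ennreal (H s * \<mu>) * ennreal (H t powr p) + ennreal (H s * \<nu>) * ennreal (\<bar>t - s\<bar> powr - 2)"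
        using h \<mu> by (subst ennreal_plus) (auto simp: ennreal_mult \<nu>_def)
      finally show ?thesis using far True by (simp add: far_def add_increasing)
    qed
  qed auto
  have "(\<integral>\<^sup>+t. ennreal (H s * H t * \<bar>t - s\<bar> powr - \<alpha>) * indicator {t. H t \<le> H s} t \<partial>lborel) \<le>
    (\<integral>\<^sup>+t. ennreal ((H s)\<^sup>2) * near (t - s) + (ennreal (H s * \<mu>) * ennreal (H t powr p)
       + ennreal (H s * \<nu>) * far (t - s)) \<partial>lborel)"
    by (intro nn_integral_mono pw)
  also have "\<dots> = ennreal ((H s)\<^sup>2) * (\<integral>\<^sup>+u. near u \<partial>lborel) + (ennreal (H s * \<mu>) * (\<integral>\<^sup>+t. ennreal (H t powr p) \<partial>lborel)
       + ennreal (H s * \<nu>) * (\<integral>\<^sup>+u. far u \<partial>lborel))"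
    using transl[of near] transl[of far] by (simp add: nn_integral_add nn_integral_cmult)
  also have "\<dots> \<le> ennreal ((H s)\<^sup>2) * ennreal (2 * \<delta> powr (1 - \<alpha>) / (1 - \<alpha>)) + (ennreal (H s * \<mu>) * ennreal M
       + ennreal (H s * \<nu>) * ennreal (2 / \<delta>))"
    unfolding near_def far_def
    by (intro add_mono mult_left_mono nn_integral_abs_powr_near nn_integral_inverse_square_far HM al \<delta>) auto
  also have "\<dots> = ennreal ((H s)\<^sup>2 * (2 * \<delta> powr (1 - \<alpha>) / (1 - \<alpha>)) + (H s * \<mu> * M + H s * \<nu> * (2 / \<delta>)))"
  proof -
    have e: "ennreal x * ennreal y + (ennreal z * ennreal w + ennreal u * ennreal v) = ennreal (x * y + (z * w + u * v))"
      if "x \<ge> 0" "y \<ge> 0" "z \<ge> 0" "w \<ge> 0" "u \<ge> 0" "v \<ge> 0" for x y z w u v :: real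
      using that by (simp add: ennreal_mult)
    show ?thesis by (rule e) (use h \<mu> M al \<delta> in \<open>auto simp: \<nu>_def\<close>)
  qed
  also have "(H s)\<^sup>2 * (2 * \<delta> powr (1 - \<alpha>) / (1 - \<alpha>)) = 2 / (1 - \<alpha>) * X"
  proof -
    have "- p * (2 / p - 1) = p - 2" using p by (simp add: field_simps)
    then have "\<delta> powr (1 - \<alpha>) = M powr (2 / p - 1) * H s powr (p - 2)"
      using M h by (simp add: \<delta>_def \<alpha> powr_mult powr_powr)
    moreover have "(H s)\<^sup>2 * H s powr (p - 2) = H s powr p"
      using h powr_add[of "H s" 2 "p - 2"] by simp
    ultimately show ?thesis by (simp add: X_def mult_ac)
  qed
  also have "H s * \<mu> * M = X"
  proof -
    have "M * M powr (2 / p - 2) = M powr (2 / p - 1)" using M powr_add[of M 1 "2 / p - 2"] by simp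
    moreover have "H s * H s powr (p - 1) = H s powr p" using h powr_add[of "H s" 1 "p - 1"] by simp
    moreover have "H s * \<mu> * M = (M * M powr (2 / p - 2)) * (H s * H s powr (p - 1))"
      by (simp only: \<mu>_def mult_ac)
    ultimately show ?thesis by (simp only: X_def)
  qed
  also have "H s * \<nu> * (2 / \<delta>) = 2 * X"
  proof -
    have e: "(2 / p - 2) * (- 1 / (p - 1)) = 2 / p" "(p - 1) * (- 1 / (p - 1)) = - 1"
      using p by (simp_all add: divide_simps)
    have "\<nu> = M powr (2 / p) * H s powr - 1"
      unfolding \<nu>_def \<mu>_def using M h by (subst powr_mult) (auto simp only: powr_powr e powr_ge_zero)
    then have "H s * \<nu> = M powr (2 / p)" using h by (simp add: powr_minus)
    moreover have "1 / \<delta> = M powr - 1 * H s powr p"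
      using M h by (simp add: \<delta>_def powr_minus field_simps)
    moreover have "M powr (2 / p) * M powr - 1 = M powr (2 / p - 1)"
      using powr_add[of M "2 / p" "- 1"] by simp
    moreover have "H s * \<nu> * (2 / \<delta>) = 2 * ((H s * \<nu>) * (1 / \<delta>))"
      by simp
    ultimately show ?thesis by (simp only: X_def mult.assoc[symmetric])
  qed
  also have "2 / (1 - \<alpha>) * X + (X + 2 * X) = (2 / (1 - \<alpha>) + 3) * M powr (2 / p - 1) * H s powr p"
    by (simp add: X_def algebra_simps)
  finally show ?thesis .
qed

text \<open>For each pair one of the two orders of \<open>H s\<close> and \<open>H t\<close> holds,
  so the kernel is at most its one-sided part plus the transposed one, and Tonelli makes the two
  integrals equal. A majorant \<open>M > 0\<close> stands for the integral because the splitting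
  radius must be positive; mass zero is recovered at the end of the sufficiency proof through small
  \<open>M\<close>.\<close>

lemma hls_diagonal:
  fixes H :: "real \<Rightarrow> real"
  assumes [measurable]: "H \<in> borel_measurable borel" and H0: "\<And>t. H t \<ge> 0"
    and p: "1 < p" "p < 2" and \<alpha>: "\<alpha> = 2 - 2 / p" and M: "M > 0"
    and HM: "(\<integral>\<^sup>+t. ennreal (H t powr p) \<partial>lborel) \<le> ennreal M"
  shows "(\<integral>\<^sup>+s. (\<integral>\<^sup>+t. ennreal (H s * H t * \<bar>t - s\<bar> powr - \<alpha>) \<partial>lborel) \<partial>lborel)
     \<le> ennreal (2 * (2 / (1 - \<alpha>) + 3) * M powr (2 / p))"
proof -
  define k where "k = (\<lambda>s t. ennreal (H s * H t * \<bar>t - s\<bar> powr - \<alpha>) * indicator {t. H t \<le> H s} t)"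
  have [measurable]: "case_prod k \<in> borel_measurable (lborel \<Otimes>\<^sub>M lborel)"
    unfolding k_def by (auto simp: indicator_def)
  define Y where "Y = (2 / (1 - \<alpha>) + 3) * M powr (2 / p - 1)"
  have al: "\<alpha> < 1" using p by (simp add: \<alpha> field_simps)
  then have Y0: "Y \<ge> 0" by (simp add: Y_def)
  have one: "(\<integral>\<^sup>+s. (\<integral>\<^sup>+t. k s t \<partial>lborel) \<partial>lborel) \<le> ennreal (Y * M)"
  proof -
    have "(\<integral>\<^sup>+s. (\<integral>\<^sup>+t. k s t \<partial>lborel) \<partial>lborel) \<le> (\<integral>\<^sup>+s. ennreal Y * ennreal (H s powr p) \<partial>lborel)"
      unfolding k_def Y_def ennreal_mult[OF Y0[unfolded Y_def] powr_ge_zero, symmetric]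
      by (intro nn_integral_mono hls_one_sided assms)
    also have "\<dots> = ennreal Y * (\<integral>\<^sup>+s. ennreal (H s powr p) \<partial>lborel)"
      by (simp add: nn_integral_cmult)
    also have "\<dots> \<le> ennreal Y * ennreal M" by (intro mult_left_mono HM) auto
    finally show ?thesis using Y0 M by (simp add: ennreal_mult)
  qed
  have "(\<integral>\<^sup>+s. (\<integral>\<^sup>+t. ennreal (H s * H t * \<bar>t - s\<bar> powr - \<alpha>) \<partial>lborel) \<partial>lborel) \<le>
     (\<integral>\<^sup>+s. (\<integral>\<^sup>+t. k s t + k t s \<partial>lborel) \<partial>lborel)"
    by (intro nn_integral_mono) (auto simp: k_def indicator_def abs_minus_commute mult.commute)
  also have "\<dots> = (\<integral>\<^sup>+s. (\<integral>\<^sup>+t. k s t \<partial>lborel) + (\<integral>\<^sup>+t. k t s \<partial>lborel) \<partial>lborel)"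
    by (intro nn_integral_cong nn_integral_add) measurable
  also have "\<dots> = (\<integral>\<^sup>+s. (\<integral>\<^sup>+t. k s t \<partial>lborel) \<partial>lborel) + (\<integral>\<^sup>+s. (\<integral>\<^sup>+t. k t s \<partial>lborel) \<partial>lborel)"
    by (intro nn_integral_add) measurable
  also have "(\<integral>\<^sup>+s. (\<integral>\<^sup>+t. k t s \<partial>lborel) \<partial>lborel) = (\<integral>\<^sup>+s. (\<integral>\<^sup>+t. k s t \<partial>lborel) \<partial>lborel)"
    by (rule lborel_pair.Fubini'[symmetric]) measurable
  also have "(\<integral>\<^sup>+s. (\<integral>\<^sup>+t. k s t \<partial>lborel) \<partial>lborel) + (\<integral>\<^sup>+s. (\<integral>\<^sup>+t. k s t \<partial>lborel) \<partial>lborel)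
      \<le> ennreal (Y * M) + ennreal (Y * M)"
    by (intro add_mono one)
  also have "\<dots> = ennreal (2 * (Y * M))"
    using Y0 M by (subst ennreal_plus[symmetric]) auto
  also have "2 * (Y * M) = 2 * (2 / (1 - \<alpha>) + 3) * M powr (2 / p)"
  proof -
    have "M powr (2 / p - 1) * M = M powr (2 / p)" using M powr_add[of M "2 / p - 1" 1] by simp
    then show ?thesis by (simp add: Y_def mult.assoc)
  qed
  finally show ?thesis .
qed

section \<open>The Fourier transform without normalisation\<close>

definition ft :: "('a::euclidean_space \<Rightarrow> complex) \<Rightarrow> 'a \<Rightarrow> complex" where
  "ft f \<xi> = (LINT x|lborel. f x * cis (- (x \<bullet> \<xi>)))"

lemma fourier_eq_ft:
  "fourier f \<xi> = complex_of_real ((2 * pi) powr (- (real DIM('a) / 2))) * ft f (\<xi>::'a::euclidean_space)"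
  by (simp add: fourier_def ft_def cis_conv_exp)

lemma borel_measurable_cis [measurable]: "cis \<in> borel_measurable borel"
  by (intro borel_measurable_continuous_onI continuous_intros)

lemma borel_measurable_cnj [measurable]: "cnj \<in> borel_measurable borel"
  by (intro borel_measurable_continuous_onI continuous_intros)

lemma integrable_cis_mult:
  assumes "integrable lborel f" and [measurable]: "\<theta> \<in> borel_measurable lborel"
  shows "integrable lborel (\<lambda>x. f x * cis (\<theta> x) :: complex)"
  by (rule Bochner_Integration.integrable_bound[OF assms(1)])
    (use borel_measurable_integrable[OF assms(1)] in \<open>auto simp: norm_mult\<close>)

lemma integrable_ft_integrand:
  assumes "integrable lborel f"
  shows "integrable lborel (\<lambda>x. f x * cis (- (x \<bullet> \<xi>)))"
  by (rule integrable_cis_mult[OF assms]) measurable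

lemma norm_ft_le:
  assumes "integrable lborel f"
  shows "cmod (ft f \<xi>) \<le> (LINT x|lborel. cmod (f x))"
proof -
  have "cmod (ft f \<xi>) \<le> (LINT x|lborel. cmod (f x * cis (- (x \<bullet> \<xi>))))"
    unfolding ft_def by (rule integral_norm_bound)
  then show ?thesis by (simp add: norm_mult)
qed

lemma ft_add:
  assumes "integrable lborel f" "integrable lborel g"
  shows "ft (\<lambda>x. f x + g x) \<xi> = ft f \<xi> + ft g \<xi>"
  unfolding ft_def distrib_right
  by (intro Bochner_Integration.integral_add integrable_ft_integrand assms)

lemma borel_measurable_ft [measurable]:
  assumes [measurable]: "f \<in> borel_measurable borel"
  shows "ft f \<in> borel_measurable borel"
  unfolding ft_def by measurable

lemma cis_sum: "finite I \<Longrightarrow> cis (\<Sum>i\<in>I. \<theta> i) = (\<Prod>i\<in>I. cis (\<theta> i))"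
  by (induction I rule: finite_induct) (auto simp: cis_mult[symmetric])

lemma cis_inner: "cis (- (x \<bullet> \<xi>)) = (\<Prod>b\<in>Basis. cis (- ((x \<bullet> b) * (\<xi> \<bullet> b))))"
  by (subst euclidean_inner) (simp add: sum_negf[symmetric] cis_sum)

lemma ft_prod:
  fixes f :: "'a::euclidean_space \<Rightarrow> real \<Rightarrow> complex"
  assumes f: "\<And>b. b \<in> Basis \<Longrightarrow> integrable lborel (f b)"
  shows "ft (\<lambda>x. \<Prod>b\<in>Basis. f b (x \<bullet> b)) \<xi> = (\<Prod>b\<in>Basis. LINT x|lborel. f b x * cis (- (x * (\<xi> \<bullet> b))))"
proof -
  have "ft (\<lambda>x. \<Prod>b\<in>Basis. f b (x \<bullet> b)) \<xi>
      = (LINT x|lborel. (\<Prod>b\<in>Basis. f b (x \<bullet> b) * cis (- ((x \<bullet> b) * (\<xi> \<bullet> b)))))"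
    unfolding ft_def by (simp add: cis_inner prod.distrib)
  also have "\<dots> = (\<Prod>b\<in>Basis. LINT x|lborel. f b x * cis (- (x * (\<xi> \<bullet> b))))"
    by (rule integral_lborel_prod[where f = "\<lambda>b x. f b x * cis (- (x * (\<xi> \<bullet> b)))"]) (intro integrable_cis_mult f; measurable)
  finally show ?thesis .
qed

lemma integrable_pair_mult:
  fixes f :: "'a::euclidean_space \<Rightarrow> complex" and g :: "'b::euclidean_space \<Rightarrow> complex"
  assumes f: "integrable lborel f" and g: "integrable lborel g"
  shows "integrable (lborel \<Otimes>\<^sub>M lborel) (\<lambda>(x, y). f x * g y)"
proof -
  note [measurable] = borel_measurable_integrable[OF f] borel_measurable_integrable[OF g]
  show ?thesis
    by (rule lborel_pair.Fubini_integrable) (use f g in \<open>auto simp: norm_mult\<close>)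
qed

text \<open>The identity behind both endpoints. A supremum bound on \<open>ft w\<close> makes the
  right-hand side an $L^1$ estimate; a bound on the integral of \<open>\<bar>ft w\<bar>\<close>,
  available for a Gaussian \<open>w\<close>, makes it an $L^2$ estimate. Integrability of all three
  functions gives absolute convergence of the triple integral, hence Fubini.\<close>

lemma ft_form:
  fixes f g w :: "'a::euclidean_space \<Rightarrow> complex"
  assumes f: "integrable lborel f" and g: "integrable lborel g" and w: "integrable lborel w"
  shows "(LINT \<xi>|lborel. w \<xi> * ft f \<xi> * cnj (ft g \<xi>)) =
         (LINT (x, y)|(lborel \<Otimes>\<^sub>M lborel). f x * cnj (g y) * ft w (x - y))"
proof -
  note [measurable] = borel_measurable_integrable[OF f] borel_measurable_integrable[OF g] borel_measurable_integrable[OF w]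
  define h where "h = (\<lambda>z::'a \<times> 'a. f (fst z) * cnj (g (snd z)))"
  have "h \<in> borel_measurable (lborel \<Otimes>\<^sub>M lborel)" unfolding h_def by measurable
  then have [measurable]: "h \<in> borel_measurable borel" by (simp add: lborel_prod)
  have [measurable]: "fst \<in> borel_measurable (borel :: ('a \<times> 'a) measure)" "snd \<in> borel_measurable (borel :: ('a \<times> 'a) measure)"
    by (intro borel_measurable_continuous_onI continuous_intros)+
  have g': "integrable lborel (\<lambda>y. cnj (g y))" using g by simp
  have h: "integrable lborel h"
    using integrable_pair_mult[OF f g'] unfolding lborel_prod h_def by (simp add: case_prod_unfold)
  define k where "k = (\<lambda>\<xi> z. w \<xi> * h z * cis (- ((fst z - snd z) \<bullet> \<xi>)))"
  have k: "integrable (lborel \<Otimes>\<^sub>M lborel) (case_prod k)"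
    by (rule Bochner_Integration.integrable_bound[OF integrable_pair_mult[OF w h]])
      (auto simp: k_def norm_mult case_prod_unfold)
  have 1: "w \<xi> * ft f \<xi> * cnj (ft g \<xi>) = (LINT z|lborel. k \<xi> z)" for \<xi>
  proof -
    have fi: "integrable lborel (\<lambda>x. f x * cis (- (x \<bullet> \<xi>)))" by (rule integrable_ft_integrand[OF f])
    have gi: "integrable lborel (\<lambda>y. cnj (g y) * cis (y \<bullet> \<xi>))" by (rule integrable_cis_mult[OF g']) measurable
    have "cnj (ft g \<xi>) = (LINT y|lborel. cnj (g y) * cis (y \<bullet> \<xi>))"
      unfolding ft_def by (subst Bochner_Integration.integral_cnj[symmetric]) (simp add: cis_cnj)
    then have "ft f \<xi> * cnj (ft g \<xi>) = (LINT x|lborel. (LINT y|lborel. (f x * cis (- (x \<bullet> \<xi>))) * (cnj (g y) * cis (y \<bullet> \<xi>))))"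
      unfolding ft_def by simp
    also have "\<dots> = (LINT (x, y)|(lborel \<Otimes>\<^sub>M lborel). (f x * cis (- (x \<bullet> \<xi>))) * (cnj (g y) * cis (y \<bullet> \<xi>)))"
      by (rule lborel_pair.integral_fst[OF integrable_pair_mult[OF fi gi]])
    also have "\<dots> = (LINT z|lborel. h z * cis (- ((fst z - snd z) \<bullet> \<xi>)))"
    proof -
      have "cis (- (x \<bullet> \<xi>)) * cis (y \<bullet> \<xi>) = cis (- ((x - y) \<bullet> \<xi>))" for x y
        by (simp add: cis_mult inner_diff_left)
      then show ?thesis
        unfolding lborel_prod
        by (intro Bochner_Integration.integral_cong refl) (simp add: h_def case_prod_unfold mult_ac)
    qed
    finally show ?thesis by (simp add: k_def mult.assoc)
  qed
  have 2: "(LINT \<xi>|lborel. k \<xi> z) = h z * ft w (fst z - snd z)" for z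
  proof -
    have "(LINT \<xi>|lborel. k \<xi> z) = (LINT \<xi>|lborel. h z * (w \<xi> * cis (- (\<xi> \<bullet> (fst z - snd z)))))"
      by (intro Bochner_Integration.integral_cong refl) (simp add: k_def inner_commute mult_ac)
    then show ?thesis by (simp add: ft_def)
  qed
  have "(LINT \<xi>|lborel. w \<xi> * ft f \<xi> * cnj (ft g \<xi>)) = (LINT z|lborel. (LINT \<xi>|lborel. k \<xi> z))"
    unfolding 1 by (rule lborel_pair.Fubini_integral[OF k, symmetric])
  then show ?thesis unfolding 2 by (simp add: lborel_prod h_def case_prod_unfold)
qed

section \<open>A Bessel inequality on boxes\<close>

text \<open>The rescaled characteristic function of the normal law. The result is kept as a multiple
  of a density instead of an exponential, so that its total mass can be read off.\<close>

lemma fourier_normal_density: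
  fixes \<sigma> z :: real
  assumes \<sigma>: "\<sigma> > 0"
  shows "(LINT x|lborel. complex_of_real (normal_density 0 \<sigma> x) * cis (- (x * z)))
      = complex_of_real (sqrt (2 * pi) / \<sigma> * normal_density 0 (1 / \<sigma>) z)"
proof -
  have sc: "normal_density 0 \<sigma> (\<sigma> * u) = std_normal_density u / \<sigma>" for u
    using \<sigma> by (simp add: normal_density_def real_sqrt_mult power_mult_distrib)
  have "(LINT x|lborel. complex_of_real (normal_density 0 \<sigma> x) * cis (- (x * z)))
     = \<bar>\<sigma>\<bar> *\<^sub>R (LINT u|lborel. complex_of_real (normal_density 0 \<sigma> (0 + \<sigma> * u)) * cis (- ((0 + \<sigma> * u) * z)))"
    using \<sigma> by (intro lborel_integral_real_affine) auto
  also have "\<dots> = (LINT u|lborel. \<bar>\<sigma>\<bar> *\<^sub>R (complex_of_real (normal_density 0 \<sigma> (0 + \<sigma> * u)) * cis (- ((0 + \<sigma> * u) * z))))"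
    by simp
  also have "\<dots> = (LINT u|lborel. std_normal_density u *\<^sub>R iexp ((- (\<sigma> * z)) * u))"
    using \<sigma> by (intro Bochner_Integration.integral_cong refl)
      (simp add: sc sc[unfolded mult.commute[of \<sigma>]] scaleR_conv_of_real cis_conv_exp mult_ac)
  also have "\<dots> = char std_normal_distribution (- (\<sigma> * z))"
    unfolding char_def by (subst integral_density) auto
  also have "\<dots> = complex_of_real (exp (- ((\<sigma> * z)\<^sup>2) / 2))"
    by (simp add: char_std_normal_distribution)
  also have "exp (- ((\<sigma> * z)\<^sup>2) / 2) = sqrt (2 * pi) / \<sigma> * normal_density 0 (1 / \<sigma>) z"
    using \<sigma> by (simp add: normal_density_def real_sqrt_mult real_sqrt_divide power_mult_distrib field_simps)
  finally show ?thesis .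
qed

lemma normal_density_diff: "normal_density 0 \<sigma> (a - t) = normal_density a \<sigma> t"
  by (simp add: normal_density_def power2_commute)

lemma normal_density_diff': "normal_density 0 \<sigma> (t - a) = normal_density a \<sigma> t"
  by (simp add: normal_density_def)

definition sym_box :: "real \<Rightarrow> 'a::euclidean_space set" where
  "sym_box N = {x. \<forall>b\<in>Basis. \<bar>x \<bullet> b\<bar> \<le> N}"

lemma sym_box_eq_cbox: "sym_box N = cbox (- (N *\<^sub>R One)) (N *\<^sub>R One)"
  by (auto simp: sym_box_def cbox_def abs_le_iff)

lemma sym_box_sets [measurable]: "sym_box N \<in> sets borel"
  by (simp add: sym_box_eq_cbox)

lemma indicator_sym_box:
  "(indicator (sym_box N) x :: 'b::{comm_semiring_1}) = (\<Prod>b\<in>Basis. indicator {-N..N} (x \<bullet> b))"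
proof (cases "x \<in> sym_box N")
  case True
  then show ?thesis by (auto simp: sym_box_def abs_le_iff indicator_def intro!: prod.neutral)
next
  case False
  then obtain b where "b \<in> Basis" "\<not> \<bar>x \<bullet> b\<bar> \<le> N" by (auto simp: sym_box_def)
  then show ?thesis using False
    by (auto simp: abs_le_iff intro!: prod_zero bexI[of _ b])
qed

text \<open>A Gaussian weight dominates the indicator of the box; its transform is a nonnegative kernel
  whose integral does not depend on \<open>N\<close>, so Schur's test applies.\<close>

lemma bessel_box:
  fixes f :: "'a::euclidean_space \<Rightarrow> complex"
  assumes f: "bdd_integrable f" and N: "N > 0"
  shows "(\<integral>\<^sup>+\<xi>. ennreal (indicator (sym_box N) \<xi> * (cmod (ft f \<xi>))\<^sup>2) \<partial>lborel)
      \<le> ennreal ((2 * pi * exp (1 / 2)) ^ DIM('a) * (LINT x|lborel. (cmod (f x))\<^sup>2))"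
proof -
  note [measurable] = bdd_integrable_measurable[OF f]
  have fi: "integrable lborel f" using f by (simp add: bdd_integrable_def)
  \<comment> \<open>\<open>N * sqrt (2 * pi)\<close> removes the normalisation of the density, and
    \<open>exp (1 / 2)\<close> lifts its value at \<open>\<bar>x\<bar> = N\<close> to exactly 1. The
    transform of the resulting product weight is \<open>W\<close>, with mass
    \<open>2 * pi * exp (1 / 2)\<close> per coordinate.\<close>
  define v where "v = (\<lambda>x. N * sqrt (2 * pi) * exp (1 / 2) * normal_density 0 N x)"
  define w where "w = (\<lambda>\<xi>::'a. \<Prod>b\<in>Basis. v (\<xi> \<bullet> b))"
  define W where "W = (\<lambda>z::'a. \<Prod>b\<in>Basis. 2 * pi * exp (1 / 2) * normal_density 0 (1 / N) (z \<bullet> b))"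
  define D where "D = (2 * pi * exp (1 / 2 :: real)) ^ DIM('a)"
  have D0: "D \<ge> 0" by (simp add: D_def)
  have v0: "v x \<ge> 0" for x using N by (simp add: v_def)
  have v1: "v x \<ge> 1" if "\<bar>x\<bar> \<le> N" for x
  proof -
    define q where "q = x\<^sup>2 / (2 * N\<^sup>2)"
    have "x\<^sup>2 \<le> N\<^sup>2" using that N by (simp add: abs_le_square_iff[symmetric])
    then have "0 \<le> 1 / 2 + - q" using N by (simp add: q_def field_simps)
    then have "1 \<le> exp (1 / 2 + - q)" by simp
    also have "\<dots> = exp (1 / 2) * exp (- q)" by (rule exp_add)
    also have "\<dots> = v x" using N by (simp add: v_def normal_density_def real_sqrt_mult q_def)
    finally show ?thesis .
  qed
  have vi: "integrable lborel v" unfolding v_def using N by simp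
  have wi: "integrable lborel w"
    unfolding w_def by (rule integrable_lborel_prod[where f = "\<lambda>b. v"]) (rule vi)
  have w0: "w \<xi> \<ge> 0" for \<xi> by (simp add: w_def prod_nonneg v0)
  have W0: "W z \<ge> 0" for z by (simp add: W_def prod_nonneg)
  have [measurable]: "W \<in> borel_measurable borel" unfolding W_def by measurable
  have ftw: "ft (\<lambda>\<xi>. complex_of_real (w \<xi>)) z = complex_of_real (W z)" for z
  proof -
    have "ft (\<lambda>\<xi>. complex_of_real (w \<xi>)) z = (\<Prod>b\<in>Basis. LINT x|lborel. complex_of_real (v x) * cis (- (x * (z \<bullet> b))))"
      unfolding w_def of_real_prod by (rule ft_prod) (use vi in simp)
    also have "\<dots> = (\<Prod>b\<in>Basis. complex_of_real (2 * pi * exp (1 / 2) * normal_density 0 (1 / N) (z \<bullet> b)))"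
    proof (intro prod.cong refl)
      fix b
      have "(LINT x|lborel. complex_of_real (v x) * cis (- (x * (z \<bullet> b)))) =
         complex_of_real (N * sqrt (2 * pi) * exp (1 / 2)) * (LINT x|lborel. complex_of_real (normal_density 0 N x) * cis (- (x * (z \<bullet> b))))"
        by (subst integral_mult_right_zero[symmetric]) (simp add: v_def mult_ac)
      also have "\<dots> = complex_of_real (N * sqrt (2 * pi) * exp (1 / 2) * (sqrt (2 * pi) / N * normal_density 0 (1 / N) (z \<bullet> b)))"
        unfolding fourier_normal_density[OF N] of_real_mult ..
      also have "N * sqrt (2 * pi) * exp (1 / 2) * (sqrt (2 * pi) / N * normal_density 0 (1 / N) (z \<bullet> b))
          = (sqrt (2 * pi) * sqrt (2 * pi)) * exp (1 / 2) * normal_density 0 (1 / N) (z \<bullet> b)"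
        using N by (simp only: field_simps) simp
      also have "sqrt (2 * pi) * sqrt (2 * pi) = 2 * pi" by (simp add: real_sqrt_mult[symmetric] del: real_sqrt_mult)
      finally show "(LINT x|lborel. complex_of_real (v x) * cis (- (x * (z \<bullet> b)))) =
        complex_of_real (2 * pi * exp (1 / 2) * normal_density 0 (1 / N) (z \<bullet> b))" .
    qed
    finally show ?thesis by (simp only: W_def of_real_prod)
  qed
  have nd: "(\<integral>\<^sup>+t. ennreal (2 * pi * exp (1 / 2) * normal_density a (1 / N) t) \<partial>lborel) = ennreal (2 * pi * exp (1 / 2))" for a
    using N by (subst nn_integral_eq_integral) (auto intro!: integrable_mult_right)
  have W1: "(\<integral>\<^sup>+y. ennreal (W (x - y)) \<partial>lborel) = ennreal D" for x
  proof -
    have "(\<integral>\<^sup>+y. ennreal (W (x - y)) \<partial>lborel) = (\<integral>\<^sup>+y. (\<Prod>b\<in>Basis. ennreal (2 * pi * exp (1 / 2) * normal_density (x \<bullet> b) (1 / N) (y \<bullet> b))) \<partial>lborel)"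
      unfolding W_def by (intro nn_integral_cong) (simp add: prod_ennreal inner_diff_left normal_density_diff)
    also have "\<dots> = (\<Prod>b\<in>Basis. (\<integral>\<^sup>+t. ennreal (2 * pi * exp (1 / 2) * normal_density (x \<bullet> b) (1 / N) t) \<partial>lborel))"
      by (rule nn_integral_lborel_prod) auto
    also have "\<dots> = ennreal D" unfolding nd by (simp add: D_def ennreal_power)
    finally show ?thesis .
  qed
  have W2: "(\<integral>\<^sup>+x. ennreal (W (x - y)) \<partial>lborel) = ennreal D" for y
  proof -
    have "(\<integral>\<^sup>+x. ennreal (W (x - y)) \<partial>lborel) = (\<integral>\<^sup>+x. (\<Prod>b\<in>Basis. ennreal (2 * pi * exp (1 / 2) * normal_density (y \<bullet> b) (1 / N) (x \<bullet> b))) \<partial>lborel)"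
      unfolding W_def by (intro nn_integral_cong) (simp add: prod_ennreal inner_diff_left normal_density_diff')
    also have "\<dots> = (\<Prod>b\<in>Basis. (\<integral>\<^sup>+t. ennreal (2 * pi * exp (1 / 2) * normal_density (y \<bullet> b) (1 / N) t) \<partial>lborel))"
      by (rule nn_integral_lborel_prod) auto
    also have "\<dots> = ennreal D" unfolding nd by (simp add: D_def ennreal_power)
    finally show ?thesis .
  qed
  define X where "X = (LINT \<xi>|lborel. w \<xi> * (cmod (ft f \<xi>))\<^sup>2)"
  have X0: "X \<ge> 0" unfolding X_def using w0 by (intro integral_nonneg_AE) auto
  have wf: "integrable lborel (\<lambda>\<xi>. w \<xi> * (cmod (ft f \<xi>))\<^sup>2)"
  proof (rule Bochner_Integration.integrable_bound)
    show "integrable lborel (\<lambda>\<xi>. w \<xi> * (LINT x|lborel. cmod (f x))\<^sup>2)" using wi by simp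
    show "AE \<xi> in lborel. norm (w \<xi> * (cmod (ft f \<xi>))\<^sup>2) \<le> norm (w \<xi> * (LINT x|lborel. cmod (f x))\<^sup>2)"
      using w0 norm_ft_le[OF fi] by (auto simp: abs_mult intro!: mult_left_mono power_mono)
  qed (use borel_measurable_integrable[OF wi] in measurable)
  let ?k = "\<lambda>(x, y). f x * cnj (f y) * complex_of_real (W (x - y))"
  have "complex_of_real X = (LINT \<xi>|lborel. complex_of_real (w \<xi>) * ft f \<xi> * cnj (ft f \<xi>))"
    unfolding X_def integral_complex_of_real[symmetric]
    by (intro Bochner_Integration.integral_cong refl) (simp add: complex_norm_square[symmetric] mult.assoc)
  also have "\<dots> = (LINT z|(lborel \<Otimes>\<^sub>M lborel). ?k z)"
    by (subst ft_form[OF fi fi]) (use wi in \<open>simp_all add: ftw\<close>)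
  finally have XE: "complex_of_real X = (LINT z|(lborel \<Otimes>\<^sub>M lborel). ?k z)" .
  have "ennreal X = ennreal (cmod (LINT z|(lborel \<Otimes>\<^sub>M lborel). ?k z))"
    using X0 by (simp flip: XE)
  \<comment> \<open>Were the kernel not integrable, its Bochner integral would be 0 and the bound
    trivial; hence the case distinction instead of an integrability proof.\<close>
  also have "\<dots> \<le> (\<integral>\<^sup>+z. ennreal (cmod (?k z)) \<partial>(lborel \<Otimes>\<^sub>M lborel))"
    by (cases "integrable (lborel \<Otimes>\<^sub>M lborel) ?k")
      (auto intro: integral_norm_bound_ennreal simp: not_integrable_integral_eq)
  \<comment> \<open>The arithmetic-geometric mean separates \<open>f x\<close> from
    \<open>f y\<close>; in each half the kernel is then integrated over the variable that
    \<open>f\<close> does not involve.\<close>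
  also have "\<dots> \<le> (\<integral>\<^sup>+z. (\<lambda>(x, y). ennreal ((cmod (f x))\<^sup>2 / 2) * ennreal (W (x - y)) + ennreal ((cmod (f y))\<^sup>2 / 2) * ennreal (W (x - y))) z \<partial>(lborel \<Otimes>\<^sub>M lborel))"
  proof (intro nn_integral_mono, clarify)
    fix x y :: 'a
    have "cmod (f x * cnj (f y) * complex_of_real (W (x - y))) = cmod (f x) * cmod (f y) * W (x - y)"
      using W0 by (simp add: norm_mult)
    also have "\<dots> \<le> ((cmod (f x))\<^sup>2 / 2 + (cmod (f y))\<^sup>2 / 2) * W (x - y)"
      using W0 sum_squares_bound[of "cmod (f x)" "cmod (f y)"] by (intro mult_right_mono) auto
    also have "ennreal \<dots> = ennreal ((cmod (f x))\<^sup>2 / 2) * ennreal (W (x - y)) + ennreal ((cmod (f y))\<^sup>2 / 2) * ennreal (W (x - y))"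
      using W0 by (simp add: ennreal_mult[symmetric] distrib_right)
    finally show "ennreal (cmod (f x * cnj (f y) * complex_of_real (W (x - y)))) \<le>
      ennreal ((cmod (f x))\<^sup>2 / 2) * ennreal (W (x - y)) + ennreal ((cmod (f y))\<^sup>2 / 2) * ennreal (W (x - y))"
      by (simp add: ennreal_leI)
  qed
  also have "\<dots> = (\<integral>\<^sup>+z. (\<lambda>(x, y). ennreal ((cmod (f x))\<^sup>2 / 2) * ennreal (W (x - y))) z \<partial>(lborel \<Otimes>\<^sub>M lborel))
     + (\<integral>\<^sup>+z. (\<lambda>(x, y). ennreal ((cmod (f y))\<^sup>2 / 2) * ennreal (W (x - y))) z \<partial>(lborel \<Otimes>\<^sub>M lborel))"
    by (subst nn_integral_add[symmetric]) (auto simp: case_prod_unfold)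
  also have "(\<integral>\<^sup>+z. (\<lambda>(x, y). ennreal ((cmod (f x))\<^sup>2 / 2) * ennreal (W (x - y))) z \<partial>(lborel \<Otimes>\<^sub>M lborel))
     = (\<integral>\<^sup>+x. (\<integral>\<^sup>+y. ennreal ((cmod (f x))\<^sup>2 / 2) * ennreal (W (x - y)) \<partial>lborel) \<partial>lborel)"
    by (subst lborel.nn_integral_fst[symmetric]) auto
  also have "\<dots> = (\<integral>\<^sup>+x. ennreal ((cmod (f x))\<^sup>2 / 2) * ennreal D \<partial>lborel)"
    by (simp add: nn_integral_cmult W1)
  also have "(\<integral>\<^sup>+z. (\<lambda>(x, y). ennreal ((cmod (f y))\<^sup>2 / 2) * ennreal (W (x - y))) z \<partial>(lborel \<Otimes>\<^sub>M lborel))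
     = (\<integral>\<^sup>+y. (\<integral>\<^sup>+x. ennreal ((cmod (f y))\<^sup>2 / 2) * ennreal (W (x - y)) \<partial>lborel) \<partial>lborel)"
    by (subst lborel_pair.nn_integral_snd[symmetric]) auto
  also have "\<dots> = (\<integral>\<^sup>+x. ennreal ((cmod (f x))\<^sup>2 / 2) * ennreal D \<partial>lborel)"
    by (simp add: nn_integral_cmult W2)
  also have "(\<integral>\<^sup>+x. ennreal ((cmod (f x))\<^sup>2 / 2) * ennreal D \<partial>lborel) = ennreal ((LINT x|lborel. (cmod (f x))\<^sup>2 / 2) * D)"
  proof -
    have "(\<integral>\<^sup>+x. ennreal ((cmod (f x))\<^sup>2 / 2) \<partial>lborel) = ennreal (LINT x|lborel. (cmod (f x))\<^sup>2 / 2)"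
      using bdd_integrable_square[OF f] by (intro nn_integral_eq_integral) auto
    then show ?thesis
      by (subst nn_integral_multc) (auto simp: ennreal_mult[symmetric] D0 integral_nonneg_AE)
  qed
  also have "\<dots> + \<dots> = ennreal (D * (LINT x|lborel. (cmod (f x))\<^sup>2))"
    using D0 by (subst ennreal_plus[symmetric]) (auto simp: field_simps)
  finally have XD: "ennreal X \<le> ennreal (D * (LINT x|lborel. (cmod (f x))\<^sup>2))" .
  have "(\<integral>\<^sup>+\<xi>. ennreal (indicator (sym_box N) \<xi> * (cmod (ft f \<xi>))\<^sup>2) \<partial>lborel)
     \<le> (\<integral>\<^sup>+\<xi>. ennreal (w \<xi> * (cmod (ft f \<xi>))\<^sup>2) \<partial>lborel)"
  proof (intro nn_integral_mono ennreal_leI mult_right_mono)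
    fix \<xi> :: 'a
    show "indicator (sym_box N) \<xi> \<le> w \<xi>"
      using w0 by (auto simp: indicator_def sym_box_def w_def intro!: prod_ge_1 v1)
  qed auto
  also have "\<dots> = ennreal X"
    unfolding X_def using w0 by (intro nn_integral_eq_integral wf) auto
  finally show ?thesis using XD unfolding D_def by (rule order_trans)
qed

section \<open>Fixed time estimates\<close>

definition power_phase :: "('a::euclidean_space \<Rightarrow> real) \<Rightarrow> ('a \<Rightarrow> nat) \<Rightarrow> 'a \<Rightarrow> real" where
  "power_phase a k \<xi> = (\<Sum>b\<in>Basis. a b * (\<xi> \<bullet> b) ^ k b)"

lemma borel_measurable_power_phase [measurable]: "power_phase a k \<in> borel_measurable borel"
  unfolding power_phase_def by measurable

text \<open>A box, not a ball: its indicator factorises over the coordinates just as the phase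
  factor does.\<close>

definition cut_phase :: "('a::euclidean_space \<Rightarrow> real) \<Rightarrow> ('a \<Rightarrow> nat) \<Rightarrow> real \<Rightarrow> real \<Rightarrow> 'a \<Rightarrow> complex" where
  "cut_phase a k N \<tau> \<xi> = indicator (sym_box N) \<xi> * cis (- (\<tau> * power_phase a k \<xi>))"

lemma cut_phase_prod:
  "cut_phase a k N \<tau> \<xi> = (\<Prod>b\<in>Basis. indicator {-N..N} (\<xi> \<bullet> b) * cis (- (\<tau> * a b * (\<xi> \<bullet> b) ^ k b)))"
proof -
  have "- (\<tau> * power_phase a k \<xi>) = (\<Sum>b\<in>Basis. - (\<tau> * a b * (\<xi> \<bullet> b) ^ k b))"
    by (simp add: power_phase_def sum_distrib_left sum_negf mult.assoc)
  then show ?thesis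
    by (simp add: cut_phase_def indicator_sym_box prod.distrib cis_sum)
qed

lemma norm_cut_phase: "cmod (cut_phase a k N \<tau> \<xi>) = indicator (sym_box N) \<xi>"
  by (simp add: cut_phase_def norm_mult indicator_def)

lemma integrable_indicator_cis:
  fixes \<theta> :: "real \<Rightarrow> real"
  assumes [measurable]: "\<theta> \<in> borel_measurable borel"
  shows "integrable lborel (\<lambda>x. indicator {-N..N} x * cis (\<theta> x))"
proof (rule integrable_cis_mult)
  have "integrable lborel (\<lambda>x. complex_of_real (indicator {-N..N} x))"
    by (intro integrable_of_real) (simp add: emeasure_lborel_Icc_eq)
  then show "integrable lborel (\<lambda>x. indicator {-N..N} x :: complex)"
    by (simp add: of_real_indicator)
qed simp

lemma integrable_cut_phase: "integrable lborel (cut_phase a k N \<tau>)"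
proof -
  have "integrable lborel (\<lambda>\<xi>. \<Prod>b\<in>Basis. indicator {-N..N} (\<xi> \<bullet> b) * cis (- (\<tau> * a b * (\<xi> \<bullet> b) ^ k b)))"
    by (rule integrable_lborel_prod[where f = "\<lambda>b x. indicator {-N..N} x * cis (- (\<tau> * a b * x ^ k b))"])
      (intro integrable_indicator_cis, measurable)
  then show ?thesis by (simp add: cut_phase_prod[abs_def])
qed

text \<open>The transform is a product of one-variable integrals, in which \<open>z\<close> only
  adds a linear term to the phase and the side of the box only sets the range of integration;
  neither affects the bound. The time exponents of the factors add up.\<close>

lemma norm_ft_cut_phase_le:
  fixes a :: "'a::euclidean_space \<Rightarrow> real"
  assumes a: "\<And>b. b \<in> Basis \<Longrightarrow> a b \<noteq> 0" and k: "\<And>b. b \<in> Basis \<Longrightarrow> k b \<ge> 2"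
    and N: "N \<ge> 0" and \<tau>: "\<tau> \<noteq> 0"
  shows "cmod (ft (cut_phase a k N \<tau>) z) \<le>
     (\<Prod>b\<in>Basis. 22 * \<bar>a b\<bar> powr - (1 / real (k b))) * \<bar>\<tau>\<bar> powr - (\<Sum>b\<in>Basis. 1 / real (k b))"
proof -
  have one: "cmod (LINT x|lborel. indicator {-N..N} x * cis (- (\<tau> * a b * x ^ k b)) * cis (- (x * (z \<bullet> b))))
     \<le> 22 * \<bar>a b\<bar> powr - (1 / real (k b)) * \<bar>\<tau>\<bar> powr - (1 / real (k b))" if b: "b \<in> Basis" for b
  proof -
    define g where "g = (\<lambda>x. cis ((- (\<tau> * a b)) * x ^ k b + (- (z \<bullet> b)) * x))"
    have eq: "indicator {-N..N} x * cis (- (\<tau> * a b * x ^ k b)) * cis (- (x * (z \<bullet> b))) = indicator {-N..N} x *\<^sub>R g x" for x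
      by (simp add: g_def cis_mult indicator_def algebra_simps)
    have gi: "set_integrable lborel {-N..N} g"
      unfolding set_integrable_def eq[symmetric] mult.assoc cis_mult
      by (rule integrable_indicator_cis) measurable
    have "(LINT x|lborel. indicator {-N..N} x * cis (- (\<tau> * a b * x ^ k b)) * cis (- (x * (z \<bullet> b))))
       = integral {-N..N} g"
      unfolding eq using set_borel_integral_eq_integral(2)[OF gi] by (simp add: set_lebesgue_integral_def)
    also have "cmod \<dots> \<le> 22 * \<bar>- (\<tau> * a b)\<bar> powr - (1 / real (k b))"
      unfolding g_def using a[OF b] k[OF b] N \<tau> by (intro oscillatory_integral_monomial) auto
    also have "\<dots> = 22 * \<bar>a b\<bar> powr - (1 / real (k b)) * \<bar>\<tau>\<bar> powr - (1 / real (k b))"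
      by (simp add: abs_mult powr_mult)
    finally show ?thesis .
  qed
  have "ft (cut_phase a k N \<tau>) z = (\<Prod>b\<in>Basis. LINT x|lborel. indicator {-N..N} x * cis (- (\<tau> * a b * x ^ k b)) * cis (- (x * (z \<bullet> b))))"
    unfolding cut_phase_prod[abs_def]
    by (rule ft_prod[where f = "\<lambda>b x. indicator {-N..N} x * cis (- (\<tau> * a b * x ^ k b))"])
      (intro integrable_indicator_cis, measurable)
  then have "cmod (ft (cut_phase a k N \<tau>) z) = (\<Prod>b\<in>Basis. cmod (LINT x|lborel. indicator {-N..N} x * cis (- (\<tau> * a b * x ^ k b)) * cis (- (x * (z \<bullet> b)))))"
    by (simp add: prod_norm)
  also have "\<dots> \<le> (\<Prod>b\<in>Basis. 22 * \<bar>a b\<bar> powr - (1 / real (k b)) * \<bar>\<tau>\<bar> powr - (1 / real (k b)))"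
    by (intro prod_mono conjI norm_ge_zero one)
  also have "\<dots> = (\<Prod>b\<in>Basis. 22 * \<bar>a b\<bar> powr - (1 / real (k b))) * \<bar>\<tau>\<bar> powr - (\<Sum>b\<in>Basis. 1 / real (k b))"
  proof -
    have "\<bar>\<tau>\<bar> powr - (\<Sum>b\<in>Basis. 1 / real (k b)) = (\<Prod>b\<in>Basis. \<bar>\<tau>\<bar> powr - (1 / real (k b)))"
      using \<tau> by (subst powr_sum[symmetric]) (auto simp: sum_negf)
    then show ?thesis by (simp only: prod.distrib)
  qed
  finally show ?thesis .
qed

section \<open>Sesquilinear forms in Fourier transforms\<close>

definition ft_pairing :: "('a::euclidean_space \<Rightarrow> complex) \<Rightarrow> ('a \<Rightarrow> complex) \<Rightarrow> ('a \<Rightarrow> complex) \<Rightarrow> complex" where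
  "ft_pairing w f g = (LINT \<xi>|lborel. w \<xi> * ft f \<xi> * cnj (ft g \<xi>))"

lemma integrable_ft_pairing:
  assumes w: "integrable lborel w" and f: "integrable lborel f" and g: "integrable lborel g"
  shows "integrable lborel (\<lambda>\<xi>. w \<xi> * ft f \<xi> * cnj (ft g \<xi>))"
proof (rule Bochner_Integration.integrable_bound)
  let ?F = "LINT x|lborel. cmod (f x)" and ?G = "LINT x|lborel. cmod (g x)"
  note [measurable] = borel_measurable_integrable[OF w] borel_measurable_integrable[OF f] borel_measurable_integrable[OF g]
  show "integrable lborel (\<lambda>\<xi>. w \<xi> * complex_of_real (?F * ?G))" using w by simp
  show "(\<lambda>\<xi>. w \<xi> * ft f \<xi> * cnj (ft g \<xi>)) \<in> borel_measurable lborel" by measurable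
  have "cmod (w \<xi>) * cmod (ft f \<xi>) * cmod (ft g \<xi>) \<le> cmod (w \<xi>) * ?F * ?G" for \<xi>
    using norm_ft_le[OF f] norm_ft_le[OF g] by (intro mult_mono mult_left_mono) auto
  then show "AE \<xi> in lborel. norm (w \<xi> * ft f \<xi> * cnj (ft g \<xi>)) \<le> norm (w \<xi> * complex_of_real (?F * ?G))"
    by (auto simp: norm_mult mult.assoc)
qed

lemma ft_pairing_add_left:
  assumes "integrable lborel w" "integrable lborel f1" "integrable lborel f2" "integrable lborel g"
  shows "ft_pairing w (\<lambda>x. f1 x + f2 x) g = ft_pairing w f1 g + ft_pairing w f2 g"
  unfolding ft_pairing_def ft_add[OF assms(2,3)] distrib_left distrib_right
  by (intro Bochner_Integration.integral_add integrable_ft_pairing assms)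

lemma ft_pairing_add_right:
  assumes "integrable lborel w" "integrable lborel f" "integrable lborel g1" "integrable lborel g2"
  shows "ft_pairing w f (\<lambda>x. g1 x + g2 x) = ft_pairing w f g1 + ft_pairing w f g2"
  unfolding ft_pairing_def ft_add[OF assms(3,4)] distrib_left complex_cnj_add
  by (intro Bochner_Integration.integral_add integrable_ft_pairing assms)

lemma norm_ft_pairing_le_L1:
  fixes f g w :: "'a::euclidean_space \<Rightarrow> complex"
  assumes w: "integrable lborel w" and f: "integrable lborel f" and g: "integrable lborel g"
    and A: "\<And>z. cmod (ft w z) \<le> A"
  shows "cmod (ft_pairing w f g) \<le> A * (LINT x|lborel. cmod (f x)) * (LINT x|lborel. cmod (g x))"
proof -
  note [measurable] = borel_measurable_integrable[OF w] borel_measurable_integrable[OF f] borel_measurable_integrable[OF g]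
  have cf: "integrable lborel (\<lambda>x. complex_of_real (cmod (f x)))" and cg: "integrable lborel (\<lambda>x. complex_of_real (A * cmod (g x)))"
    using f g by simp_all
  have fg: "integrable (lborel \<Otimes>\<^sub>M lborel) (\<lambda>(x, y). cmod (f x) * (A * cmod (g y)))"
    using integrable_Re[OF integrable_pair_mult[OF cf cg]] by (simp add: case_prod_unfold)
  have A0: "A \<ge> 0" using order_trans[OF norm_ge_zero A] .
  have le: "cmod (f x * cnj (g y) * ft w (x - y)) \<le> cmod (f x) * (A * cmod (g y))" for x y
    using mult_left_mono[OF A[of "x - y"], of "cmod (f x) * cmod (g y)"] by (simp add: norm_mult mult_ac)
  have ki: "integrable (lborel \<Otimes>\<^sub>M lborel) (\<lambda>(x, y). f x * cnj (g y) * ft w (x - y))"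
    by (rule Bochner_Integration.integrable_bound[OF fg])
      (auto intro!: order_trans[OF le] simp: case_prod_unfold)
  have "cmod (ft_pairing w f g) \<le> (LINT z|(lborel \<Otimes>\<^sub>M lborel). norm ((\<lambda>(x, y). f x * cnj (g y) * ft w (x - y)) z))"
    unfolding ft_pairing_def ft_form[OF f g w] by (rule integral_norm_bound)
  also have "\<dots> \<le> (LINT (x, y)|(lborel \<Otimes>\<^sub>M lborel). cmod (f x) * (A * cmod (g y)))"
    by (intro integral_mono integrable_norm ki fg) (auto simp del: norm_mult intro!: le)
  also have "\<dots> = (LINT x|lborel. (LINT y|lborel. cmod (f x) * (A * cmod (g y))))"
    by (rule lborel_pair.integral_fst[OF fg, symmetric])
  finally show ?thesis by (simp add: mult_ac)
qed

text \<open>The multiplier is unimodular on the box and zero elsewhere, so \<open>\<tau>\<close> and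
  the phase drop out: Cauchy-Schwarz on the box, then the Bessel inequality for each factor.\<close>

lemma norm_ft_pairing_le_L2:
  fixes f g :: "'a::euclidean_space \<Rightarrow> complex"
  assumes f: "bdd_integrable f" and g: "bdd_integrable g" and N: "N > 0"
  shows "cmod (ft_pairing (cut_phase a k N \<tau>) f g) \<le> (2 * pi * exp (1 / 2)) ^ DIM('a) *
     sqrt (LINT x|lborel. (cmod (f x))\<^sup>2) * sqrt (LINT x|lborel. (cmod (g x))\<^sup>2)"
proof -
  note [measurable] = bdd_integrable_measurable[OF f] bdd_integrable_measurable[OF g]
  have fi: "integrable lborel f" "integrable lborel g" using f g by (auto simp: bdd_integrable_def)
  define D where "D = (2 * pi * exp (1 / 2 :: real)) ^ DIM('a)"
  have D0: "D \<ge> 0" by (simp add: D_def)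
  define F G where "F = (LINT x|lborel. (cmod (f x))\<^sup>2)" and "G = (LINT x|lborel. (cmod (g x))\<^sup>2)"
  have FG: "F \<ge> 0" "G \<ge> 0" by (simp_all add: F_def G_def)
  let ?u = "\<lambda>h \<xi>. ennreal (indicator (sym_box N) \<xi> * cmod (ft h \<xi>))"
  have sq: "(?u h \<xi>)\<^sup>2 = ennreal (indicator (sym_box N) \<xi> * (cmod (ft h \<xi>))\<^sup>2)" for h :: "'a \<Rightarrow> complex" and \<xi>
    by (cases "\<xi> \<in> sym_box N") (simp_all add: ennreal_power)
  have "ennreal (cmod (ft_pairing (cut_phase a k N \<tau>) f g)) \<le>
     (\<integral>\<^sup>+\<xi>. ennreal (cmod (cut_phase a k N \<tau> \<xi> * ft f \<xi> * cnj (ft g \<xi>))) \<partial>lborel)"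
    unfolding ft_pairing_def by (intro integral_norm_bound_ennreal integrable_ft_pairing integrable_cut_phase fi)
  also have "\<dots> = (\<integral>\<^sup>+\<xi>. ?u f \<xi> * ?u g \<xi> \<partial>lborel)"
  proof (intro nn_integral_cong)
    fix \<xi>
    show "ennreal (cmod (cut_phase a k N \<tau> \<xi> * ft f \<xi> * cnj (ft g \<xi>))) = ?u f \<xi> * ?u g \<xi>"
      by (cases "\<xi> \<in> sym_box N") (simp_all add: norm_mult norm_cut_phase ennreal_mult)
  qed
  finally have le: "ennreal (cmod (ft_pairing (cut_phase a k N \<tau>) f g)) \<le> (\<integral>\<^sup>+\<xi>. ?u f \<xi> * ?u g \<xi> \<partial>lborel)" .
  have "ennreal ((cmod (ft_pairing (cut_phase a k N \<tau>) f g))\<^sup>2) = (ennreal (cmod (ft_pairing (cut_phase a k N \<tau>) f g)))\<^sup>2"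
    by (simp add: ennreal_power)
  also have "\<dots> \<le> (\<integral>\<^sup>+\<xi>. ?u f \<xi> * ?u g \<xi> \<partial>lborel)\<^sup>2"
    by (rule power_mono[OF le]) simp
  also have "\<dots> \<le> (\<integral>\<^sup>+\<xi>. (?u f \<xi>)\<^sup>2 \<partial>lborel) * (\<integral>\<^sup>+\<xi>. (?u g \<xi>)\<^sup>2 \<partial>lborel)"
    by (rule Cauchy_Schwarz_nn_integral) measurable
  also have "\<dots> \<le> ennreal (D * F) * ennreal (D * G)"
    unfolding sq D_def F_def G_def by (intro mult_mono bessel_box f g N) auto
  also have "\<dots> = ennreal ((D * F) * (D * G))"
    using D0 FG by (intro ennreal_mult[symmetric] mult_nonneg_nonneg)
  also have "(D * F) * (D * G) = (D * sqrt F * sqrt G)\<^sup>2"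
  proof -
    have "(D * sqrt F * sqrt G)\<^sup>2 = D\<^sup>2 * F * G" using FG by (simp add: power_mult_distrib)
    moreover have "(D * F) * (D * G) = D\<^sup>2 * F * G" by (simp only: power2_eq_square mult_ac)
    ultimately show ?thesis by (simp only:)
  qed
  finally have "(cmod (ft_pairing (cut_phase a k N \<tau>) f g))\<^sup>2 \<le> (D * sqrt F * sqrt G)\<^sup>2"
    by (simp only: ennreal_le_iff zero_le_power2)
  then have "cmod (ft_pairing (cut_phase a k N \<tau>) f g) \<le> D * sqrt F * sqrt G"
    by (rule power2_le_imp_le) (intro mult_nonneg_nonneg D0 real_sqrt_ge_zero FG)
  then show ?thesis by (simp only: D_def F_def G_def)
qed

text \<open>The order of quantifiers matters: \<open>C\<close> precedes \<open>N\<close>, which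
  later tends to infinity, and \<open>\<tau>\<close>, which later runs over all differences of
  distinct times. Interpolation is applied with
  \<open>A = A0 * \<bar>\<tau>\<bar> powr - h\<close>.\<close>

lemma fixed_time_estimate:
  fixes a :: "'a::euclidean_space \<Rightarrow> real"
  assumes a: "\<And>b. b \<in> Basis \<Longrightarrow> a b \<noteq> 0" and k: "\<And>b. b \<in> Basis \<Longrightarrow> k b \<ge> 2"
  defines "h \<equiv> \<Sum>b\<in>Basis. 1 / real (k b)"
  assumes p: "p = 2 - 2 / (2 + h)"
  shows "\<exists>C\<ge>0. \<forall>N>0. \<forall>\<tau>. \<forall>f g. \<tau> \<noteq> 0 \<longrightarrow> bdd_integrable f \<longrightarrow> bdd_integrable g \<longrightarrow>
    cmod (ft_pairing (cut_phase a k N \<tau>) f g) \<le> C * \<bar>\<tau>\<bar> powr - (2 - 2 / p) *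
      ((LINT x|lborel. cmod (f x) powr p) * (LINT x|lborel. cmod (g x) powr p)) powr (1 / p)"
proof -
  have h: "h > 0" unfolding h_def using k by (intro sum_pos) (auto, force)
  have p12: "1 < p" "p < 2" using h by (auto simp: p field_simps)
  \<comment> \<open>On the left is the decay that interpolation delivers, on the right the one that
    the diagonal Hardy-Littlewood-Sobolev inequality demands. They agree exactly when
    \<open>p * (2 + h) = 2 + 2 * h\<close>.\<close>
  have hp: "h * (2 / p - 1) = 2 - 2 / p"
  proof -
    have "p * (2 + h) = 2 + 2 * h" using h by (simp add: p field_simps)
    then have "h * (2 - p) = 2 * p - 2" by (simp add: algebra_simps)
    moreover have "h * (2 / p - 1) = h * (2 - p) / p" "2 - 2 / p = (2 * p - 2) / p"
      using p12 by (simp_all add: field_simps)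
    ultimately show ?thesis by simp
  qed
  define A0 where "A0 = (\<Prod>b\<in>Basis. 22 * \<bar>a b\<bar> powr - (1 / real (k b)))"
  have A0: "A0 > 0" unfolding A0_def using a by (intro prod_pos) auto
  define K where "K = 1 + (2 * pi * exp (1 / 2)) ^ DIM('a) * sqrt (4 powr (2 - p) / (2 powr (2 - p) - 1))"
  have K: "K \<ge> 0"
    unfolding K_def using p12 ge_one_powr_ge_zero[of 2 "2 - p"] by (intro add_nonneg_nonneg mult_nonneg_nonneg) auto
  have "cmod (ft_pairing (cut_phase a k N \<tau>) f g) \<le> K * A0 powr (2 / p - 1) * \<bar>\<tau>\<bar> powr - (2 - 2 / p) *
      ((LINT x|lborel. cmod (f x) powr p) * (LINT x|lborel. cmod (g x) powr p)) powr (1 / p)"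
    if N: "N > 0" and \<tau>: "\<tau> \<noteq> 0" and f: "bdd_integrable f" and g: "bdd_integrable g" for N \<tau> f g
  proof -
    have i: "integrable lborel u" if "bdd_integrable u" for u :: "'a \<Rightarrow> complex"
      using that by (simp add: bdd_integrable_def)
    have "cmod (ft_pairing (cut_phase a k N \<tau>) f g) \<le> K * (A0 * \<bar>\<tau>\<bar> powr - h) powr (2 / p - 1) *
      ((LINT x|lborel. cmod (f x) powr p) * (LINT x|lborel. cmod (g x) powr p)) powr (1 / p)"
      unfolding K_def
    proof (rule bilinear_interpolation[OF p12, where B = "ft_pairing (cut_phase a k N \<tau>)"])
      fix f g :: "'a \<Rightarrow> complex" assume fg: "bdd_integrable f" "bdd_integrable g"
      show "cmod (ft_pairing (cut_phase a k N \<tau>) f g) \<le> A0 * \<bar>\<tau>\<bar> powr - h * (LINT x|lborel. cmod (f x)) * (LINT x|lborel. cmod (g x))"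
        unfolding A0_def h_def
        by (rule norm_ft_pairing_le_L1[OF integrable_cut_phase i[OF fg(1)] i[OF fg(2)]],
            rule norm_ft_cut_phase_le) (use a k N \<tau> in auto)
      show "cmod (ft_pairing (cut_phase a k N \<tau>) f g) \<le> (2 * pi * exp (1 / 2)) ^ DIM('a) *
        sqrt (LINT x|lborel. (cmod (f x))\<^sup>2) * sqrt (LINT x|lborel. (cmod (g x))\<^sup>2)"
        by (rule norm_ft_pairing_le_L2[OF fg N])
    qed (use A0 \<tau> f g in \<open>auto intro!: ft_pairing_add_left ft_pairing_add_right integrable_cut_phase i\<close>)
    also have "(A0 * \<bar>\<tau>\<bar> powr - h) powr (2 / p - 1) = A0 powr (2 / p - 1) * \<bar>\<tau>\<bar> powr - (2 - 2 / p)"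
      using A0 by (simp add: powr_mult powr_powr hp[symmetric])
    finally show ?thesis by (simp add: mult.assoc)
  qed
  then show ?thesis
    using K A0 by (intro exI[of _ "K * A0 powr (2 / p - 1)"]) auto
qed

section \<open>The restriction estimate\<close>

lemma integrable_slice_norm:
  fixes \<phi> :: "'a::euclidean_space \<times> real \<Rightarrow> complex"
  assumes "integrable lborel \<phi>"
  shows "integrable lborel (\<lambda>t. LINT x|lborel. cmod (\<phi> (x, t)))"
proof -
  have "integrable (lborel \<Otimes>\<^sub>M lborel) (\<lambda>(x, t). cmod (\<phi> (x, t)))"
    using integrable_norm[OF assms] by (simp add: lborel_prod case_prod_unfold)
  then show ?thesis by (rule lborel_pair.integrable_snd)
qed

lemma ft_slice:
  fixes \<phi> :: "'a::euclidean_space \<times> real \<Rightarrow> complex"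
  assumes "integrable lborel \<phi>"
  shows "ft \<phi> (\<xi>, \<eta>) = (LINT t|lborel. cis (- (t * \<eta>)) * ft (\<lambda>x. \<phi> (x, t)) \<xi>)"
proof -
  let ?f = "\<lambda>x t. \<phi> (x, t) * cis (- ((x, t) \<bullet> (\<xi>, \<eta>)))"
  have i: "integrable (lborel \<Otimes>\<^sub>M lborel) (case_prod ?f)"
    using integrable_ft_integrand[OF assms, of "(\<xi>, \<eta>)"]
    by (simp only: lborel_prod case_prod_unfold prod.collapse)
  have "ft \<phi> (\<xi>, \<eta>) = integral\<^sup>L (lborel \<Otimes>\<^sub>M lborel) (case_prod ?f)"
    by (simp only: ft_def lborel_prod case_prod_unfold prod.collapse)
  also have "\<dots> = (LINT t|lborel. (LINT x|lborel. ?f x t))"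
    by (rule lborel_pair.integral_snd[OF i, symmetric])
  also have "\<dots> = (LINT t|lborel. cis (- (t * \<eta>)) * ft (\<lambda>x. \<phi> (x, t)) \<xi>)"
  proof (intro Bochner_Integration.integral_cong refl)
    fix t
    have "?f x t = cis (- (t * \<eta>)) * (\<phi> (x, t) * cis (- (x \<bullet> \<xi>)))" for x
    proof -
      have "cis (- ((x, t) \<bullet> (\<xi>, \<eta>))) = cis (- (t * \<eta>)) * cis (- (x \<bullet> \<xi>))"
        by (simp add: cis_mult algebra_simps)
      then show ?thesis by (simp only: mult_ac)
    qed
    then show "(LINT x|lborel. ?f x t) = cis (- (t * \<eta>)) * ft (\<lambda>x. \<phi> (x, t)) \<xi>"
      unfolding ft_def by (simp only: integral_mult_right_zero)
  qed
  finally show ?thesis .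
qed

text \<open>The squared modulus of a time integral is a double integral over \<open>t\<close> and
  \<open>s\<close>; exchanged with the frequency integral, it leaves for each pair the form in
  \<open>fixed\<close> at \<open>\<tau> = t - s\<close>. The exchange is justified by the majorant
  \<open>n t * n s\<close> on the box, since the $L^1$ norm \<open>n t\<close> of a slice bounds its
  transform at every frequency.\<close>

lemma box_restriction_estimate:
  fixes a :: "'a::euclidean_space \<Rightarrow> real" and \<phi> :: "'a \<times> real \<Rightarrow> complex"
  assumes fixed: "\<And>\<tau> f g. \<tau> \<noteq> 0 \<Longrightarrow> bdd_integrable f \<Longrightarrow> bdd_integrable g \<Longrightarrow>
      cmod (ft_pairing (cut_phase a k N \<tau>) f g) \<le> C * \<bar>\<tau>\<bar> powr - (2 - 2 / p) *
      ((LINT x|lborel. cmod (f x) powr p) * (LINT x|lborel. cmod (g x) powr p)) powr (1 / p)"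
    and p: "1 < p" "p < 2" and C: "C \<ge> 0"
    and \<phi>: "integrable lborel \<phi>" and slice: "\<And>t. bdd_integrable (\<lambda>x. \<phi> (x, t))"
    and M: "M > 0" and \<phi>M: "(\<integral>\<^sup>+z. ennreal (cmod (\<phi> z) powr p) \<partial>lborel) \<le> ennreal M"
  shows "(\<integral>\<^sup>+\<xi>. ennreal (indicator (sym_box N) \<xi> * (cmod (ft \<phi> (\<xi>, power_phase a k \<xi>)))\<^sup>2) \<partial>lborel)
     \<le> ennreal (C * (2 * (2 / (1 - (2 - 2 / p)) + 3)) * M powr (2 / p))"
proof -
  have [measurable]: "\<phi> \<in> borel_measurable (lborel \<Otimes>\<^sub>M lborel)"
    using borel_measurable_integrable[OF \<phi>] by (simp add: lborel_prod)
  define n where "n = (\<lambda>t. LINT x|lborel. cmod (\<phi> (x, t)))"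
  have ni: "integrable lborel n" unfolding n_def by (rule integrable_slice_norm[OF \<phi>])
  define u where "u = (\<lambda>\<xi> t. cis (- (t * power_phase a k \<xi>)) * ft (\<lambda>x. \<phi> (x, t)) \<xi>)"
  have slice': "integrable lborel (\<lambda>x. \<phi> (x, t))" for t using slice[of t] by (simp add: bdd_integrable_def)
  have un: "cmod (u \<xi> t) \<le> n t" for \<xi> t
    unfolding u_def n_def using norm_ft_le[OF slice'] by (simp add: norm_mult)
  have um [measurable]: "case_prod u \<in> borel_measurable (lborel \<Otimes>\<^sub>M lborel)"
    unfolding u_def ft_def by measurable
  define V where "V = (\<lambda>\<xi>. ft \<phi> (\<xi>, power_phase a k \<xi>))"
  have V: "V \<xi> = (LINT t|lborel. u \<xi> t)" for \<xi>
    unfolding V_def u_def by (rule ft_slice[OF \<phi>])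
  have ui: "integrable lborel (u \<xi>)" for \<xi>
  proof (rule Bochner_Integration.integrable_bound[OF ni])
    show "u \<xi> \<in> borel_measurable lborel" using measurable_compose_Pair1[of \<xi> lborel "case_prod u" lborel borel] by simp
    show "AE t in lborel. norm (u \<xi> t) \<le> norm (n t)"
      by (intro AE_I2) (simp add: order_trans[OF un abs_ge_self])
  qed
  let ?I = "\<lambda>\<xi>::'a. indicator (sym_box N) \<xi> :: complex"
  define K where "K = (\<lambda>\<xi> z. ?I \<xi> * (u \<xi> (fst z) * cnj (u \<xi> (snd z))))"
  have [measurable]: "fst \<in> borel_measurable (borel :: (real \<times> real) measure)" "snd \<in> borel_measurable (borel :: (real \<times> real) measure)"
    by (intro borel_measurable_continuous_onI continuous_intros)+
  have Ii: "integrable lborel ?I"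
    using integrable_cut_phase[of a k N 0] by (simp add: cut_phase_def[abs_def])
  have Ki: "integrable (lborel \<Otimes>\<^sub>M lborel) (case_prod K)"
  proof (rule Bochner_Integration.integrable_bound)
    have nc: "integrable lborel (\<lambda>t. complex_of_real (n t))" using ni by simp
    have nn: "integrable lborel (\<lambda>z. complex_of_real (n (fst z)) * complex_of_real (n (snd z)))"
      using integrable_pair_mult[OF nc nc] unfolding lborel_prod by (simp add: case_prod_unfold)
    show "integrable (lborel \<Otimes>\<^sub>M lborel) (\<lambda>(\<xi>, z). ?I \<xi> * (complex_of_real (n (fst z)) * complex_of_real (n (snd z))))"
      by (rule integrable_pair_mult[OF Ii nn])
    have "(\<lambda>q::'a \<times> real \<times> real. (fst q, h (snd q))) \<in> (lborel \<Otimes>\<^sub>M lborel) \<rightarrow>\<^sub>M (lborel \<Otimes>\<^sub>M lborel)"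
      if "h \<in> borel_measurable borel" for h :: "real \<times> real \<Rightarrow> real"
      using that by (intro measurable_Pair measurable_fst measurable_compose[OF measurable_snd]) simp
    from measurable_compose[OF this um]
    have [measurable]: "(\<lambda>q::'a \<times> real \<times> real. u (fst q) (h (snd q))) \<in> borel_measurable (lborel \<Otimes>\<^sub>M lborel)"
      if "h \<in> borel_measurable borel" for h :: "real \<times> real \<Rightarrow> real"
      using that by simp
    show "case_prod K \<in> borel_measurable (lborel \<Otimes>\<^sub>M lborel)"
      unfolding K_def case_prod_unfold by measurable
    have "cmod (K \<xi> z) \<le> cmod (?I \<xi>) * (\<bar>n (fst z)\<bar> * \<bar>n (snd z)\<bar>)" for \<xi> z
      unfolding K_def norm_mult complex_mod_cnj using un order_trans[OF un abs_ge_self]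
      by (intro mult_left_mono mult_mono) auto
    then show "AE q in lborel \<Otimes>\<^sub>M lborel. norm (case_prod K q) \<le>
        norm ((\<lambda>(\<xi>, z). ?I \<xi> * (complex_of_real (n (fst z)) * complex_of_real (n (snd z)))) q)"
      by (simp add: case_prod_unfold norm_mult)
  qed
  define S where "S = (LINT \<xi>|lborel. indicator (sym_box N) \<xi> * (cmod (V \<xi>))\<^sup>2)"
  have K1: "(LINT z|lborel. K \<xi> z) = complex_of_real (indicator (sym_box N) \<xi> * (cmod (V \<xi>))\<^sup>2)" for \<xi>
  proof -
    have uc: "integrable lborel (\<lambda>t. cnj (u \<xi> t))" using ui by simp
    have "(LINT z|lborel. K \<xi> z) = ?I \<xi> * (LINT z|lborel. u \<xi> (fst z) * cnj (u \<xi> (snd z)))"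
      unfolding K_def by simp
    also have "(LINT z|lborel. u \<xi> (fst z) * cnj (u \<xi> (snd z))) = (LINT (t, s)|(lborel \<Otimes>\<^sub>M lborel). u \<xi> t * cnj (u \<xi> s))"
      by (simp add: lborel_prod case_prod_unfold)
    also have "\<dots> = (LINT t|lborel. (LINT s|lborel. u \<xi> t * cnj (u \<xi> s)))"
      by (rule lborel_pair.integral_fst[OF integrable_pair_mult[OF ui uc], symmetric])
    also have "\<dots> = V \<xi> * cnj (V \<xi>)" by (simp add: V)
    finally show ?thesis by (simp only: of_real_mult of_real_indicator complex_norm_square)
  qed
  have K2: "(LINT \<xi>|lborel. K \<xi> (t, s)) = ft_pairing (cut_phase a k N (t - s)) (\<lambda>x. \<phi> (x, t)) (\<lambda>x. \<phi> (x, s))" for t s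
    unfolding ft_pairing_def
  proof (intro Bochner_Integration.integral_cong refl)
    fix \<xi>
    have "cis (- (t * power_phase a k \<xi>)) * cis (s * power_phase a k \<xi>) = cis (- ((t - s) * power_phase a k \<xi>))"
      by (simp add: cis_mult left_diff_distrib)
    then show "K \<xi> (t, s) = cut_phase a k N (t - s) \<xi> * ft (\<lambda>x. \<phi> (x, t)) \<xi> * cnj (ft (\<lambda>x. \<phi> (x, s)) \<xi>)"
      unfolding K_def u_def cut_phase_def by (simp add: cis_cnj mult_ac)
  qed
  have Si: "integrable lborel (\<lambda>\<xi>. complex_of_real (indicator (sym_box N) \<xi> * (cmod (V \<xi>))\<^sup>2))"
    using lborel_pair.integrable_fst[OF Ki] unfolding K1 .
  define F where "F = (\<lambda>t. LINT x|lborel. cmod (\<phi> (x, t)) powr p)"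
  \<comment> \<open>The fixed-time bound sees the slices through
    \<open>(F t * F s) powr (1 / p)\<close>. With the root taken here it splits as
    \<open>H t * H s\<close>, and by Tonelli the \<open>p\<close>-mass of \<open>H\<close> in time
    is that of \<open>\<phi>\<close>.\<close>
  define H where "H = (\<lambda>t. F t powr (1 / p))"
  have F0: "F t \<ge> 0" for t by (simp add: F_def)
  have [measurable]: "F \<in> borel_measurable borel" unfolding F_def by measurable
  have [measurable]: "H \<in> borel_measurable borel" unfolding H_def by measurable
  have HM: "(\<integral>\<^sup>+t. ennreal (H t powr p) \<partial>lborel) \<le> ennreal M"
  proof -
    have "(\<integral>\<^sup>+t. ennreal (H t powr p) \<partial>lborel) = (\<integral>\<^sup>+t. (\<integral>\<^sup>+x. ennreal (cmod (\<phi> (x, t)) powr p) \<partial>lborel) \<partial>lborel)"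
    proof (intro nn_integral_cong)
      fix t
      have "H t powr p = F t" using p F0 by (simp add: H_def powr_powr)
      moreover have "(\<integral>\<^sup>+x. ennreal (cmod (\<phi> (x, t)) powr p) \<partial>lborel) = ennreal (F t)"
        unfolding F_def using bdd_integrable_powr[OF slice[of t], of p] p by (intro nn_integral_eq_integral) auto
      ultimately show "ennreal (H t powr p) = (\<integral>\<^sup>+x. ennreal (cmod (\<phi> (x, t)) powr p) \<partial>lborel)" by simp
    qed
    also have "\<dots> = (\<integral>\<^sup>+z. ennreal (cmod (\<phi> z) powr p) \<partial>(lborel \<Otimes>\<^sub>M lborel))"
      by (rule lborel_pair.nn_integral_snd) measurable
    finally show ?thesis using \<phi>M by (simp add: lborel_prod)
  qed
  have "(\<integral>\<^sup>+\<xi>. ennreal (indicator (sym_box N) \<xi> * (cmod (V \<xi>))\<^sup>2) \<partial>lborel) = ennreal S"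
    unfolding S_def using integrable_Re[OF Si] by (intro nn_integral_eq_integral) auto
  also have "ennreal S = ennreal (cmod (LINT \<xi>|lborel. (LINT z|lborel. K \<xi> z)))"
  proof -
    have "S \<ge> 0" unfolding S_def by (intro integral_nonneg_AE) auto
    then show ?thesis unfolding K1 integral_complex_of_real by (simp add: S_def)
  qed
  also have "(LINT \<xi>|lborel. (LINT z|lborel. K \<xi> z)) = (LINT z|lborel. (LINT \<xi>|lborel. K \<xi> z))"
    by (rule lborel_pair.Fubini_integral[OF Ki, symmetric])
  also have "ennreal (cmod \<dots>) \<le> (\<integral>\<^sup>+z. ennreal (cmod (LINT \<xi>|lborel. K \<xi> z)) \<partial>lborel)"
    by (intro integral_norm_bound_ennreal lborel_pair.integrable_snd[OF Ki])
  also have "\<dots> = (\<integral>\<^sup>+t. (\<integral>\<^sup>+s. ennreal (cmod (LINT \<xi>|lborel. K \<xi> (t, s))) \<partial>lborel) \<partial>lborel)"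
  proof -
    define G where "G = (\<lambda>z. LINT \<xi>|lborel. K \<xi> z)"
    have [measurable]: "G \<in> borel_measurable (lborel \<Otimes>\<^sub>M lborel)"
      using borel_measurable_integrable[OF lborel_pair.integrable_snd[OF Ki]] by (simp add: lborel_prod G_def)
    have "(\<integral>\<^sup>+z. ennreal (cmod (G z)) \<partial>(lborel \<Otimes>\<^sub>M lborel)) = (\<integral>\<^sup>+t. (\<integral>\<^sup>+s. ennreal (cmod (G (t, s))) \<partial>lborel) \<partial>lborel)"
      by (intro lborel.nn_integral_fst[symmetric]) measurable
    then show ?thesis by (simp only: G_def lborel_prod)
  qed
  also have "\<dots> \<le> (\<integral>\<^sup>+t. (\<integral>\<^sup>+s. ennreal C * ennreal (H t * H s * \<bar>s - t\<bar> powr - (2 - 2 / p)) \<partial>lborel) \<partial>lborel)"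
  \<comment> \<open>The inner bound is only almost everywhere: \<open>fixed\<close> excludes
    \<open>\<tau> = 0\<close>, and at \<open>s = t\<close> the right-hand side is 0 because
    \<open>0 powr\<close> any exponent is 0. A single \<open>s\<close> is a null set.\<close>
  proof (rule nn_integral_mono, rule nn_integral_mono_AE)
    fix t
    have "ennreal (cmod (LINT \<xi>|lborel. K \<xi> (t, s))) \<le> ennreal C * ennreal (H t * H s * \<bar>s - t\<bar> powr - (2 - 2 / p))"
      if "s \<noteq> t" for s
    proof -
      have "cmod (LINT \<xi>|lborel. K \<xi> (t, s)) \<le> C * \<bar>t - s\<bar> powr - (2 - 2 / p) * (F t * F s) powr (1 / p)"
        unfolding K2 F_def by (rule fixed[OF _ slice slice]) (use that in simp)
      also have "\<dots> = C * (H t * H s * \<bar>s - t\<bar> powr - (2 - 2 / p))"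
        using F0 by (simp add: H_def powr_mult abs_minus_commute mult_ac)
      finally show ?thesis using C by (simp add: ennreal_mult'[symmetric] ennreal_leI)
    qed
    then show "AE s in lborel. ennreal (cmod (LINT \<xi>|lborel. K \<xi> (t, s))) \<le> ennreal C * ennreal (H t * H s * \<bar>s - t\<bar> powr - (2 - 2 / p))"
      using AE_lborel_singleton[of t] by (auto elim!: eventually_mono)
  qed
  also have "\<dots> = ennreal C * (\<integral>\<^sup>+t. (\<integral>\<^sup>+s. ennreal (H t * H s * \<bar>s - t\<bar> powr - (2 - 2 / p)) \<partial>lborel) \<partial>lborel)"
    by (simp add: nn_integral_cmult)
  also have "\<dots> \<le> ennreal C * ennreal (2 * (2 / (1 - (2 - 2 / p)) + 3) * M powr (2 / p))"
    by (intro mult_left_mono hls_diagonal p M HM refl) (auto simp: H_def)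
  also have "\<dots> = ennreal (C * (2 * (2 / (1 - (2 - 2 / p)) + 3)) * M powr (2 / p))"
    using C by (simp add: ennreal_mult'[symmetric] mult.assoc)
  finally show ?thesis by (simp add: V_def)
qed

lemma nn_integral_le_of_boxes:
  fixes f :: "'a::euclidean_space \<Rightarrow> real"
  assumes [measurable]: "f \<in> borel_measurable borel" and f0: "\<And>x. f x \<ge> 0"
    and le: "\<And>N. N > 0 \<Longrightarrow> (\<integral>\<^sup>+x. ennreal (indicator (sym_box N) x * f x) \<partial>lborel) \<le> B"
  shows "(\<integral>\<^sup>+x. ennreal (f x) \<partial>lborel) \<le> B"
proof -
  \<comment> \<open>\<open>Suc n\<close> keeps the half-side positive, as \<open>le\<close>
    demands.\<close>
  let ?g = "\<lambda>n::nat. \<lambda>x. ennreal (indicator (sym_box (real (Suc n))) x * f x)"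
  have "(\<lambda>n. \<integral>\<^sup>+x. ?g n x \<partial>lborel) \<longlonglongrightarrow> (\<integral>\<^sup>+x. ennreal (f x) \<partial>lborel)"
  proof (rule nn_integral_LIMSEQ)
    show "incseq ?g"
    proof (intro incseq_SucI le_funI ennreal_leI mult_right_mono f0)
      fix n and x :: 'a
      show "indicator (sym_box (real (Suc n))) x \<le> (indicator (sym_box (real (Suc (Suc n)))) x :: real)"
        by (auto simp: indicator_def sym_box_def intro: order_trans)
    qed
    fix x :: 'a
    obtain m :: nat where m: "norm x \<le> real m" using real_arch_simple by blast
    have "?g n x = ennreal (f x)" if "n \<ge> m" for n
    proof -
      have "\<bar>x \<bullet> b\<bar> \<le> real (Suc n)" if "b \<in> Basis" for b
        using Basis_le_norm[OF that, of x] m \<open>n \<ge> m\<close> by linarith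
      then show ?thesis by (simp add: sym_box_def)
    qed
    then show "(\<lambda>n. ?g n x) \<longlonglongrightarrow> ennreal (f x)"
      by (intro tendsto_eventually eventually_sequentiallyI[of m]) auto
  qed measurable
  then show ?thesis by (rule LIMSEQ_le_const2) (use le in auto)
qed

lemma integrable_inverse_1_plus_square: "integrable lborel (\<lambda>x::real. inverse (1 + x\<^sup>2))"
proof -
  have "einterval (-\<infinity>) \<infinity> = UNIV" by (auto simp: einterval_def)
  then show ?thesis using Sinc_Integral.integrable_inverse_1_plus_square by (simp add: set_integrable_def)
qed

section \<open>Schwartz functions\<close>

text \<open>The decay is stated as a product over the coordinates, which is integrable by the
  product formula and passes to slices by dropping the factor of the last coordinate. The weights
  \<open>1\<close> and \<open>norm x ^ (2 * d)\<close> suffice, since the product of the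
  \<open>1 + (x \<bullet> b)\<^sup>2\<close> is at most
  \<open>2 ^ d * (1 + norm x ^ (2 * d))\<close>.\<close>

lemma schwartz_decay:
  fixes \<phi> :: "'a::euclidean_space \<Rightarrow> complex"
  assumes "schwartz \<phi>"
  shows "\<exists>K. \<forall>x. cmod (\<phi> x) \<le> K * (\<Prod>b\<in>Basis. inverse (1 + (x \<bullet> b)\<^sup>2))"
proof -
  define d where "d = DIM('a)"
  have b: "bounded (range (\<lambda>x. norm x ^ N *\<^sub>R \<phi> x))" for N
    using assms unfolding schwartz_def by (metis lists.Nil partial_deriv.simps(1))
  obtain K0 where K0: "\<And>x. norm (norm x ^ 0 *\<^sub>R \<phi> x) \<le> K0" using b[of 0] unfolding bounded_iff by blast
  obtain K1 where K1: "\<And>x. norm (norm x ^ (2 * d) *\<^sub>R \<phi> x) \<le> K1" using b[of "2 * d"] unfolding bounded_iff by blast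
  have "cmod (\<phi> x) \<le> 2 ^ d * (K0 + K1) * (\<Prod>b\<in>Basis. inverse (1 + (x \<bullet> b)\<^sup>2))" for x
  proof -
    define P where "P = (\<Prod>b\<in>Basis. 1 + (x \<bullet> b)\<^sup>2)"
    have P1: "P > 0" unfolding P_def by (intro prod_pos) (auto simp: add_pos_nonneg)
    have "P \<le> (\<Prod>b\<in>(Basis::'a set). 1 + (norm x)\<^sup>2)"
      unfolding P_def by (intro prod_mono) (auto simp: abs_le_square_iff[symmetric] Basis_le_norm)
    also have "\<dots> = (1 + (norm x)\<^sup>2) ^ d" by (simp add: d_def)
    also have "\<dots> \<le> 2 ^ d * (1 + norm x ^ (2 * d))"
    proof -
      have "1 + (norm x)\<^sup>2 \<le> 2 * max 1 ((norm x)\<^sup>2)" by simp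
      then have "(1 + (norm x)\<^sup>2) ^ d \<le> (2 * max 1 ((norm x)\<^sup>2)) ^ d" by (intro power_mono) auto
      also have "\<dots> = 2 ^ d * (max 1 ((norm x)\<^sup>2)) ^ d" by (rule power_mult_distrib)
      also have "(max 1 ((norm x)\<^sup>2)) ^ d \<le> 1 + norm x ^ (2 * d)"
        by (cases "(norm x)\<^sup>2 \<le> 1") (auto simp: max_def power_mult)
      finally show ?thesis by simp
    qed
    finally have "cmod (\<phi> x) * P \<le> cmod (\<phi> x) * (2 ^ d * (1 + norm x ^ (2 * d)))"
      by (intro mult_left_mono) auto
    also have "\<dots> = 2 ^ d * (cmod (\<phi> x) + norm x ^ (2 * d) * cmod (\<phi> x))" by (simp add: algebra_simps)
    also have "\<dots> \<le> 2 ^ d * (K0 + K1)"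
      using K0[of x] K1[of x] by (intro mult_left_mono add_mono) (auto simp: norm_mult norm_power)
    finally have "cmod (\<phi> x) \<le> 2 ^ d * (K0 + K1) / P" using P1 by (simp add: pos_le_divide_eq)
    then show ?thesis by (simp add: P_def divide_inverse prod_inversef[symmetric] o_def)
  qed
  then show ?thesis by blast
qed

lemma integrable_prod_inverse_square:
  "integrable lborel (\<lambda>x::'a::euclidean_space. \<Prod>b\<in>Basis. inverse (1 + (x \<bullet> b)\<^sup>2))"
  by (rule integrable_lborel_prod[where f = "\<lambda>b x. inverse (1 + x\<^sup>2)"]) (rule integrable_inverse_1_plus_square)

lemma prod_inverse_square_bounds:
  "0 \<le> (\<Prod>b\<in>(Basis::'a::euclidean_space set). inverse (1 + (x \<bullet> b)\<^sup>2))"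
  "(\<Prod>b\<in>(Basis::'a::euclidean_space set). inverse (1 + (x \<bullet> b)\<^sup>2)) \<le> 1"
  by (auto intro!: prod_nonneg prod_le_1 simp: inverse_le_1_iff add_pos_nonneg)

lemma bdd_integrable_decay:
  fixes f :: "'a::euclidean_space \<Rightarrow> complex"
  assumes [measurable]: "f \<in> borel_measurable borel"
    and le: "\<And>x. cmod (f x) \<le> K * (\<Prod>b\<in>Basis. inverse (1 + (x \<bullet> b)\<^sup>2))"
  shows "bdd_integrable f"
proof -
  have K: "K \<ge> 0" using order_trans[OF norm_ge_zero le[of 0]] by simp
  have "integrable lborel (\<lambda>x::'a. K * (\<Prod>b\<in>Basis. inverse (1 + (x \<bullet> b)\<^sup>2)))"
    by (intro integrable_mult_right integrable_prod_inverse_square)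
  then have "integrable lborel f"
    by (rule Bochner_Integration.integrable_bound)
      (auto intro!: AE_I2 order_trans[OF le] abs_ge_self)
  moreover have "cmod (f x) \<le> K" for x
    using order_trans[OF le mult_left_mono[OF prod_inverse_square_bounds(2) K]] by simp
  ultimately show ?thesis unfolding bdd_integrable_def by blast
qed

lemma schwartz_continuous:
  assumes "schwartz \<phi>"
  shows "continuous_on UNIV \<phi>"
proof -
  have "\<phi> differentiable (at x)" for x
    using assms unfolding schwartz_def by (metis lists.Nil partial_deriv.simps(1))
  then show ?thesis
    by (simp add: continuous_at_imp_continuous_on differentiable_imp_continuous_within)
qed

lemma schwartz_bdd_integrable:
  assumes "schwartz \<phi>"
  shows "bdd_integrable \<phi>"
proof -
  obtain K where "\<And>x. cmod (\<phi> x) \<le> K * (\<Prod>b\<in>Basis. inverse (1 + (x \<bullet> b)\<^sup>2))"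
    using schwartz_decay[OF assms] by blast
  then show ?thesis
    by (intro bdd_integrable_decay borel_measurable_continuous_onI schwartz_continuous assms)
qed

lemma prod_Basis_prod_eq:
  fixes g :: "'a::euclidean_space \<times> 'b::euclidean_space \<Rightarrow> 'c::comm_monoid_mult"
  shows "prod g Basis = (\<Prod>u\<in>Basis. g (u, 0)) * (\<Prod>v\<in>Basis. g (0, v))"
proof -
  have i: "inj_on (\<lambda>u. (u::'a, 0::'b)) Basis" "inj_on (\<lambda>u. (0::'a, u::'b)) Basis"
    by (auto intro!: inj_onI)
  have d: "(\<lambda>u. (u::'a, 0::'b)) ` Basis \<inter> (\<lambda>u. (0::'a, u::'b)) ` Basis = {}"
    by auto
  show ?thesis
    by (simp add: Basis_prod_def prod.union_disjoint[OF _ _ d] prod.reindex[OF i(1)] prod.reindex[OF i(2)])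
qed

lemma schwartz_slice_bdd_integrable:
  fixes \<phi> :: "'a::euclidean_space \<times> real \<Rightarrow> complex"
  assumes "schwartz \<phi>"
  shows "bdd_integrable (\<lambda>x. \<phi> (x, t))"
proof -
  obtain K where K: "\<And>x. cmod (\<phi> x) \<le> K * (\<Prod>b\<in>Basis. inverse (1 + (x \<bullet> b)\<^sup>2))"
    using schwartz_decay[OF assms] by blast
  have K0: "K \<ge> 0" using order_trans[OF norm_ge_zero K[of 0]] by simp
  have "continuous_on UNIV (\<lambda>x. \<phi> (x, t))"
    by (rule continuous_on_compose2[OF schwartz_continuous[OF assms]]) (auto intro!: continuous_intros)
  moreover have "cmod (\<phi> (x, t)) \<le> K * (\<Prod>b\<in>Basis. inverse (1 + (x \<bullet> b)\<^sup>2))" for x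
  proof -
    have "cmod (\<phi> (x, t)) \<le> K * (\<Prod>b\<in>Basis. inverse (1 + ((x, t) \<bullet> b)\<^sup>2))" by (rule K)
    also have "(\<Prod>b\<in>Basis. inverse (1 + ((x, t) \<bullet> b)\<^sup>2)) = (\<Prod>b\<in>Basis. inverse (1 + (x \<bullet> b)\<^sup>2)) * (\<Prod>b\<in>Basis. inverse (1 + (t \<bullet> b)\<^sup>2))"
      by (simp add: prod_Basis_prod_eq)
    also have "\<dots> \<le> (\<Prod>b\<in>Basis. inverse (1 + (x \<bullet> b)\<^sup>2)) * 1"
      by (intro mult_left_mono prod_inverse_square_bounds)
    finally show ?thesis using K0 by (simp add: mult_left_mono)
  qed
  ultimately show ?thesis
    by (intro bdd_integrable_decay borel_measurable_continuous_onI)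
qed

section \<open>Polynomials times Gaussians\<close>

lemma real_polynomial_function_has_derivative:
  assumes "real_polynomial_function P"
  shows "\<exists>D. (\<forall>x. (P has_derivative D x) (at x)) \<and> (\<forall>v. real_polynomial_function (\<lambda>x. D x v))"
  using assms
proof (induction rule: real_polynomial_function.induct)
  case (linear f)
  then show ?case
    by (intro exI[of _ "\<lambda>x. f"]) (auto intro: bounded_linear_imp_has_derivative real_polynomial_function.intros(2))
next
  case (const c)
  then show ?case
    by (intro exI[of _ "\<lambda>x v. 0"]) (auto intro: real_polynomial_function.intros(2))
next
  case (add f g)
  then obtain D E where "\<And>x. (f has_derivative D x) (at x)" "\<And>v. real_polynomial_function (\<lambda>x. D x v)"
    "\<And>x. (g has_derivative E x) (at x)" "\<And>v. real_polynomial_function (\<lambda>x. E x v)" by blast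
  then show ?case
    by (intro exI[of _ "\<lambda>x v. D x v + E x v"]) (auto intro!: has_derivative_add real_polynomial_function.intros(3))
next
  case (mult f g)
  then obtain D E where "\<And>x. (f has_derivative D x) (at x)" "\<And>v. real_polynomial_function (\<lambda>x. D x v)"
    "\<And>x. (g has_derivative E x) (at x)" "\<And>v. real_polynomial_function (\<lambda>x. E x v)" by blast
  then show ?case using mult.hyps
    by (intro exI[of _ "\<lambda>x v. f x * E x v + D x v * g x"])
      (auto intro!: has_derivative_mult real_polynomial_function.intros(3,4))
qed

lemma real_polynomial_function_growth:
  fixes P :: "'a::real_normed_vector \<Rightarrow> real"
  assumes "real_polynomial_function P"
  shows "\<exists>K n. K \<ge> 0 \<and> (\<forall>x. \<bar>P x\<bar> \<le> K * (1 + norm x) ^ n)"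
  using assms
proof (induction rule: real_polynomial_function.induct)
  case (linear f)
  obtain K where K: "K > 0" "\<And>x. norm (f x) \<le> norm x * K" using bounded_linear.pos_bounded[OF linear] by blast
  have "\<bar>f x\<bar> \<le> K * (1 + norm x) ^ 1" for x
    using K(2)[of x] K(1) by (simp add: algebra_simps)
  then show ?case using K(1) by (intro exI[of _ K] exI[of _ 1]) auto
next
  case (const c)
  then show ?case by (intro exI[of _ "\<bar>c\<bar>"] exI[of _ 0]) auto
next
  case (add f g)
  then obtain K n L m where f: "K \<ge> 0" "\<And>x. \<bar>f x\<bar> \<le> K * (1 + norm x) ^ n"
    and g: "L \<ge> 0" "\<And>x. \<bar>g x\<bar> \<le> L * (1 + norm x) ^ m" by blast
  have "\<bar>f x + g x\<bar> \<le> (K + L) * (1 + norm x) ^ (n + m)" for x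
  proof -
    have "\<bar>f x\<bar> \<le> K * (1 + norm x) ^ (n + m)"
      by (rule order_trans[OF f(2)], intro mult_left_mono power_increasing f) auto
    moreover have "\<bar>g x\<bar> \<le> L * (1 + norm x) ^ (n + m)"
      by (rule order_trans[OF g(2)], intro mult_left_mono power_increasing g) auto
    ultimately show ?thesis by (simp add: distrib_right abs_triangle_ineq[THEN order_trans])
  qed
  then show ?case using f(1) g(1) by (intro exI[of _ "K + L"] exI[of _ "n + m"]) auto
next
  case (mult f g)
  then obtain K n L m where f: "K \<ge> 0" "\<And>x. \<bar>f x\<bar> \<le> K * (1 + norm x) ^ n"
    and g: "L \<ge> 0" "\<And>x. \<bar>g x\<bar> \<le> L * (1 + norm x) ^ m" by blast
  have "\<bar>f x * g x\<bar> \<le> (K * L) * (1 + norm x) ^ (n + m)" for x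
  proof -
    have "\<bar>f x * g x\<bar> \<le> (K * (1 + norm x) ^ n) * (L * (1 + norm x) ^ m)"
      unfolding abs_mult using f g by (intro mult_mono) auto
    then show ?thesis by (simp add: power_add mult_ac)
  qed
  then show ?case using f(1) g(1) by (intro exI[of _ "K * L"] exI[of _ "n + m"]) auto
qed

lemma poly_gauss_bounded:
  fixes P Q :: "'a::real_normed_vector \<Rightarrow> real"
  assumes P: "real_polynomial_function P" and m: "m > 0" and Q: "\<And>x. Q x \<ge> m * (norm x)\<^sup>2"
  shows "bounded (range (\<lambda>x. norm x ^ N *\<^sub>R complex_of_real (P x * exp (- Q x))))"
proof -
  obtain K n where K: "K \<ge> 0" "\<And>x. \<bar>P x\<bar> \<le> K * (1 + norm x) ^ n"
    using real_polynomial_function_growth[OF P] by blast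
  define M where "M = real (N + n)"
  have "norm (norm x ^ N *\<^sub>R complex_of_real (P x * exp (- Q x))) \<le> K * exp (M\<^sup>2 / (4 * m))" for x
  proof -
    define r where "r = norm x"
    have r: "r \<ge> 0" by (simp add: r_def)
    have "norm (norm x ^ N *\<^sub>R complex_of_real (P x * exp (- Q x))) = r ^ N * \<bar>P x\<bar> * exp (- Q x)"
      by (simp add: r_def norm_mult abs_mult)
    also have "\<dots> \<le> (1 + r) ^ N * (K * (1 + r) ^ n) * exp (- (m * r\<^sup>2))"
      using r K Q[of x] by (intro mult_mono power_mono) (auto simp: r_def)
    also have "\<dots> = K * ((1 + r) ^ (N + n) * exp (- (m * r\<^sup>2)))"
      by (simp add: power_add mult_ac)
    \<comment> \<open>\<open>1 + r \<le> exp r\<close> turns the polynomial growth into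
      \<open>exp (M * r)\<close>, and completing the square against \<open>m * r\<^sup>2\<close>
      leaves the constant \<open>exp (M\<^sup>2 / (4 * m))\<close>.\<close>
    also have "(1 + r) ^ (N + n) \<le> exp r ^ (N + n)" using r by (intro power_mono) auto
    also have "exp r ^ (N + n) = exp (M * r)" by (simp add: M_def exp_of_nat_mult[symmetric])
    also have "exp (M * r) * exp (- (m * r\<^sup>2)) = exp (M * r - m * r\<^sup>2)"
      by (simp add: exp_diff exp_minus divide_inverse)
    also have "M * r - m * r\<^sup>2 \<le> M\<^sup>2 / (4 * m)"
    proof -
      have "0 \<le> (2 * m * r - M)\<^sup>2" by simp
      then show ?thesis using m by (simp add: field_simps power2_eq_square)
    qed
    finally show ?thesis using K(1) by (simp add: mult_left_mono)
  qed
  then show ?thesis unfolding bounded_iff by blast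
qed

text \<open>Functions \<open>P * exp (- Q)\<close> with polynomial \<open>P\<close> are closed under
  derivatives in a fixed direction \<open>v\<close>, the new polynomial being the derivative of
  \<open>P\<close> minus \<open>P\<close> times that of \<open>Q\<close>. Induction over the list of
  directions reduces the claim to the boundedness of such functions against powers of the norm,
  where the quadratic lower bound on \<open>Q\<close> enters.\<close>

lemma schwartz_gauss:
  fixes Q :: "'a::euclidean_space \<Rightarrow> real"
  assumes Q: "real_polynomial_function Q" and m: "m > 0" and Qm: "\<And>x. Q x \<ge> m * (norm x)\<^sup>2"
  shows "schwartz (\<lambda>x. complex_of_real (c * exp (- Q x)))"
proof -
  obtain DQ where DQ: "\<And>x. (Q has_derivative DQ x) (at x)" "\<And>v. real_polynomial_function (\<lambda>x. DQ x v)"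
    using real_polynomial_function_has_derivative[OF Q] by blast
  have der: "\<exists>D. (\<forall>x. ((\<lambda>x. complex_of_real (P x * exp (- Q x))) has_derivative D x) (at x)) \<and>
      (\<forall>v. \<exists>P'. real_polynomial_function P' \<and> (\<lambda>x. D x v) = (\<lambda>x. complex_of_real (P' x * exp (- Q x))))"
    if P: "real_polynomial_function P" for P
  proof -
    obtain DP where DP: "\<And>x. (P has_derivative DP x) (at x)" "\<And>v. real_polynomial_function (\<lambda>x. DP x v)"
      using real_polynomial_function_has_derivative[OF P] by blast
    \<comment> \<open>The difference is written with \<open>- 1 *\<close> so that it is visibly
      built from constants, sums and products, the constructors of polynomial functions.\<close>
    define D where "D = (\<lambda>x v. complex_of_real ((DP x v + - 1 * (P x * DQ x v)) * exp (- Q x)))"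
    have "((\<lambda>x. complex_of_real (P x * exp (- Q x))) has_derivative D x) (at x)" for x
    proof -
      have "((\<lambda>x. exp (- Q x)) has_derivative (\<lambda>v. exp (- Q x) * (- DQ x v))) (at x)"
        by (rule has_derivative_exp[OF has_derivative_minus[OF DQ(1)], THEN has_derivative_eq_rhs]) (simp add: mult.commute)
      from has_derivative_of_real[OF has_derivative_mult[OF DP(1) this]]
      show ?thesis unfolding D_def by (rule has_derivative_eq_rhs) (simp add: algebra_simps)
    qed
    moreover have "\<exists>P'. real_polynomial_function P' \<and> (\<lambda>x. D x v) = (\<lambda>x. complex_of_real (P' x * exp (- Q x)))" for v
    proof (intro exI conjI)
      show "real_polynomial_function (\<lambda>x. DP x v + - 1 * (P x * DQ x v))"
        by (intro real_polynomial_function.intros(2-4) DP DQ P)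
      show "(\<lambda>x. D x v) = (\<lambda>x. complex_of_real ((DP x v + - 1 * (P x * DQ x v)) * exp (- Q x)))"
        by (simp only: D_def)
    qed
    ultimately show ?thesis by blast
  qed
  have ex: "\<exists>P. real_polynomial_function P \<and>
      partial_deriv bs (\<lambda>x. complex_of_real (c * exp (- Q x))) = (\<lambda>x. complex_of_real (P x * exp (- Q x)))" for bs
  proof (induction bs)
    case Nil
    show ?case by (intro exI[of _ "\<lambda>x. c"]) (simp add: real_polynomial_function.intros(2))
  next
    case (Cons b bs)
    then obtain P where P: "real_polynomial_function P"
      "partial_deriv bs (\<lambda>x. complex_of_real (c * exp (- Q x))) = (\<lambda>x. complex_of_real (P x * exp (- Q x)))" by blast
    obtain D where D: "\<And>x. ((\<lambda>x. complex_of_real (P x * exp (- Q x))) has_derivative D x) (at x)"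
      "\<And>v. \<exists>P'. real_polynomial_function P' \<and> (\<lambda>x. D x v) = (\<lambda>x. complex_of_real (P' x * exp (- Q x)))"
      using der[OF P(1)] by blast
    have "partial_deriv (b # bs) (\<lambda>x. complex_of_real (c * exp (- Q x))) = (\<lambda>x. D x b)"
      using frechet_derivative_at[OF D(1)] P(2) by simp
    then show ?case using D(2)[of b] by auto
  qed
  show ?thesis unfolding schwartz_def
  proof (intro ballI conjI allI)
    fix bs :: "'a list" and x :: 'a and N :: nat
    obtain P where P: "real_polynomial_function P"
      "partial_deriv bs (\<lambda>x. complex_of_real (c * exp (- Q x))) = (\<lambda>x. complex_of_real (P x * exp (- Q x)))"
      using ex by blast
    show "partial_deriv bs (\<lambda>x. complex_of_real (c * exp (- Q x))) differentiable (at x)"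
      using der[OF P(1)] unfolding P(2) differentiable_def by blast
    show "bounded (range (\<lambda>x. norm x ^ N *\<^sub>R partial_deriv bs (\<lambda>x. complex_of_real (c * exp (- Q x))) x))"
      unfolding P(2) by (rule poly_gauss_bounded[OF P(1) m Qm])
  qed
qed

section \<open>Sufficiency\<close>

lemma restriction_sufficient:
  fixes a :: "'a::euclidean_space \<Rightarrow> real"
  assumes a: "\<And>b. b \<in> Basis \<Longrightarrow> a b \<noteq> 0" and k: "\<And>b. b \<in> Basis \<Longrightarrow> k b \<ge> 2"
    and p: "p = 2 - 2 / (2 + (\<Sum>b\<in>Basis. 1 / real (k b)))"
  shows "\<exists>C. \<forall>\<phi>. schwartz \<phi> \<longrightarrow>
    integrable lborel (\<lambda>\<xi>. (cmod (fourier \<phi> (\<xi>, power_phase a k \<xi>)))\<^sup>2) \<and>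
    (LINT \<xi>|lborel. (cmod (fourier \<phi> (\<xi>, power_phase a k \<xi>)))\<^sup>2) powr (1 / 2) \<le> C * Lp_norm p \<phi>"
proof -
  have h: "(\<Sum>b\<in>(Basis::'a set). 1 / real (k b)) > 0" using k by (intro sum_pos) (auto, force)
  have p12: "1 < p" "p < 2" using h by (auto simp: p field_simps)
  obtain C0 where C0: "C0 \<ge> 0" and fixed: "\<And>N \<tau> f g. N > 0 \<Longrightarrow> \<tau> \<noteq> 0 \<Longrightarrow> bdd_integrable f \<Longrightarrow> bdd_integrable g \<Longrightarrow>
    cmod (ft_pairing (cut_phase a k N \<tau>) f g) \<le> C0 * \<bar>\<tau>\<bar> powr - (2 - 2 / p) *
      ((LINT x|lborel. cmod (f x) powr p) * (LINT x|lborel. cmod (g x) powr p)) powr (1 / p)"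
    using fixed_time_estimate[of a k p] a k p by blast
  define C1 where "C1 = C0 * (2 * (2 / (1 - (2 - 2 / p)) + 3))"
  have C1: "C1 \<ge> 0" unfolding C1_def using C0 p12 by (intro mult_nonneg_nonneg add_nonneg_nonneg divide_nonneg_nonneg) (auto simp: field_simps)
  define c0 where "c0 = (2 * pi) powr (- (real DIM('a \<times> real) / 2))"
  have c0: "c0 \<ge> 0" by (simp add: c0_def)
  have "integrable lborel (\<lambda>\<xi>. (cmod (fourier \<phi> (\<xi>, power_phase a k \<xi>)))\<^sup>2) \<and>
    (LINT \<xi>|lborel. (cmod (fourier \<phi> (\<xi>, power_phase a k \<xi>)))\<^sup>2) powr (1 / 2) \<le> c0 * C1 powr (1 / 2) * Lp_norm p \<phi>"
    if \<phi>: "schwartz \<phi>" for \<phi> :: "'a \<times> real \<Rightarrow> complex"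
  proof -
    have b: "bdd_integrable \<phi>" by (rule schwartz_bdd_integrable[OF \<phi>])
    then have \<phi>i: "integrable lborel \<phi>" by (simp add: bdd_integrable_def)
    have \<phi>m: "\<phi> \<in> borel_measurable borel" by (rule bdd_integrable_measurable[OF b])
    define g where "g = (\<lambda>\<xi>. (cmod (ft \<phi> (\<xi>, power_phase a k \<xi>)))\<^sup>2)"
    have "(\<lambda>\<xi>. (\<xi>, power_phase a k \<xi>)) \<in> borel \<rightarrow>\<^sub>M (borel \<Otimes>\<^sub>M borel)" by measurable
    then have "(\<lambda>\<xi>. (\<xi>, power_phase a k \<xi>)) \<in> borel \<rightarrow>\<^sub>M borel" by (simp add: borel_prod)
    from measurable_compose[OF this borel_measurable_ft[OF \<phi>m]]
    have gm [measurable]: "g \<in> borel_measurable borel" unfolding g_def by measurable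
    define I where "I = (LINT z|lborel. cmod (\<phi> z) powr p)"
    have I0: "I \<ge> 0" by (simp add: I_def)
    have I: "(\<integral>\<^sup>+z. ennreal (cmod (\<phi> z) powr p) \<partial>lborel) = ennreal I"
      unfolding I_def using bdd_integrable_powr[OF b, of p] p12 by (intro nn_integral_eq_integral) auto
    have key: "(\<integral>\<^sup>+\<xi>. ennreal (g \<xi>) \<partial>lborel) \<le> ennreal (C1 * M powr (2 / p))" if "M > 0" "M \<ge> I" for M
    proof (rule nn_integral_le_of_boxes[OF gm])
      fix N :: real assume "N > 0"
      then show "(\<integral>\<^sup>+\<xi>. ennreal (indicator (sym_box N) \<xi> * g \<xi>) \<partial>lborel) \<le> ennreal (C1 * M powr (2 / p))"
        unfolding g_def C1_def using that I
        by (intro box_restriction_estimate fixed p12 C0 \<phi>i schwartz_slice_bdd_integrable \<phi>) (auto intro: ennreal_leI)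
    qed (simp add: g_def)
    have gi: "integrable lborel g"
    proof (rule integrableI_bounded)
      have "(\<integral>\<^sup>+\<xi>. ennreal (norm (g \<xi>)) \<partial>lborel) = (\<integral>\<^sup>+\<xi>. ennreal (g \<xi>) \<partial>lborel)" by (simp add: g_def)
      also have "\<dots> \<le> ennreal (C1 * (I + 1) powr (2 / p))" using I0 by (intro key) auto
      finally show "(\<integral>\<^sup>+\<xi>. ennreal (norm (g \<xi>)) \<partial>lborel) < \<infinity>" by (rule order_le_less_trans) simp
    qed measurable
    define X where "X = (LINT \<xi>|lborel. g \<xi>)"
    have X0: "X \<ge> 0" by (simp add: X_def g_def)
    have XM: "X \<le> C1 * M powr (2 / p)" if "M > 0" "M \<ge> I" for M
    proof -
      have "ennreal X = (\<integral>\<^sup>+\<xi>. ennreal (g \<xi>) \<partial>lborel)"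
        unfolding X_def by (rule nn_integral_eq_integral[OF gi, symmetric]) (simp add: g_def)
      then have "ennreal X \<le> ennreal (C1 * M powr (2 / p))" using key[OF that] by simp
      then show ?thesis by (subst (asm) ennreal_le_iff) (use C1 in simp_all)
    qed
    have X: "X \<le> C1 * I powr (2 / p)"
    proof (cases "I = 0")
      case False
      then show ?thesis using XM[of I] I0 by simp
    next
      case True
      have "X \<le> 0"
      proof (rule ccontr)
        assume "\<not> X \<le> 0"
        \<comment> \<open>Taking \<open>M = Y powr (p / 2)\<close> turns the bound into
          \<open>X \<le> C1 * Y\<close>, against \<open>X = (C1 + 1) * Y\<close>.\<close>
        define Y where "Y = X / (C1 + 1)"
        have Y: "Y > 0" using C1 \<open>\<not> X \<le> 0\<close> by (simp add: Y_def)
        have "(Y powr (p / 2)) powr (2 / p) = Y" using Y p12 by (simp add: powr_powr)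
        then have "X \<le> C1 * Y" using XM[of "Y powr (p / 2)"] True Y by simp
        moreover have "X = (C1 + 1) * Y" using C1 by (simp add: Y_def)
        ultimately show False using Y by (simp add: distrib_right)
      qed
      then show ?thesis using True by simp
    qed
    have fg: "(\<lambda>\<xi>. (cmod (fourier \<phi> (\<xi>, power_phase a k \<xi>)))\<^sup>2) = (\<lambda>\<xi>. c0\<^sup>2 * g \<xi>)"
      by (simp add: fourier_eq_ft g_def norm_mult power_mult_distrib c0_def)
    have "(LINT \<xi>|lborel. c0\<^sup>2 * g \<xi>) powr (1 / 2) = (c0\<^sup>2 * X) powr (1 / 2)" by (simp add: X_def)
    also have "\<dots> \<le> (c0\<^sup>2 * (C1 * I powr (2 / p))) powr (1 / 2)"
      using X X0 by (intro powr_mono2 mult_left_mono) auto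
    also have "\<dots> = (c0\<^sup>2) powr (1 / 2) * (C1 powr (1 / 2) * I powr (1 / p))"
      by (simp add: powr_mult powr_powr)
    also have "(c0\<^sup>2) powr (1 / 2) = c0" using c0 by (simp add: powr_half_sqrt)
    finally show ?thesis using gi unfolding fg by (simp add: Lp_norm_def I_def mult.assoc)
  qed
  then show ?thesis by blast
qed

section \<open>Dilations and necessity\<close>

definition diag :: "('a::euclidean_space \<Rightarrow> real) \<Rightarrow> 'a \<Rightarrow> 'a" where
  "diag s x = (\<Sum>b\<in>Basis. (s b * (x \<bullet> b)) *\<^sub>R b)"

lemma diag_inner: "b \<in> Basis \<Longrightarrow> diag s x \<bullet> b = s b * (x \<bullet> b)"
  by (simp add: diag_def)

lemma borel_measurable_diag [measurable]: "diag s \<in> borel_measurable borel"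
  unfolding diag_def by measurable

lemma integral_diag:
  fixes f :: "'a::euclidean_space \<Rightarrow> 'b::{banach, second_countable_topology}"
  assumes [measurable]: "f \<in> borel_measurable borel" and s: "\<And>b. b \<in> Basis \<Longrightarrow> s b > 0"
  shows "(LINT x|lborel. f (diag s x)) = inverse (\<Prod>b\<in>Basis. s b) *\<^sub>R (LINT x|lborel. f x)"
proof -
  have P: "(\<Prod>b\<in>(Basis::'a set). s b) > 0" using s by (rule prod_pos)
  have e: "(\<Prod>b\<in>Basis. \<bar>s b\<bar>) = (\<Prod>b\<in>(Basis::'a set). s b)"
    by (intro prod.cong refl) (simp add: less_imp_le[OF s])
  have l: "lborel = density (distr lborel borel (diag s)) (\<lambda>_. ennreal (\<Prod>b\<in>(Basis::'a set). s b))"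
    using lborel_affine_euclidean[of s 0] s unfolding diag_def[abs_def] e by force
  have "(LINT x|lborel. f x) = (LINT x|density (distr lborel borel (diag s)) (\<lambda>_. ennreal (\<Prod>b\<in>(Basis::'a set). s b)). f x)"
    using l by simp
  also have "\<dots> = (LINT x|distr lborel borel (diag s). (\<Prod>b\<in>(Basis::'a set). s b) *\<^sub>R f x)"
    using P by (subst integral_density) auto
  also have "\<dots> = (LINT x|lborel. (\<Prod>b\<in>(Basis::'a set). s b) *\<^sub>R f (diag s x))"
    by (subst integral_distr) auto
  also have "\<dots> = (\<Prod>b\<in>(Basis::'a set). s b) *\<^sub>R (LINT x|lborel. f (diag s x))"
    by simp
  finally have "(LINT x|lborel. f x) = (\<Prod>b\<in>(Basis::'a set). s b) *\<^sub>R (LINT x|lborel. f (diag s x))" .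
  moreover have "(\<Prod>b\<in>(Basis::'a set). s b) \<noteq> 0" by (rule less_imp_neq[OF P, symmetric])
  ultimately show ?thesis by (simp only: scaleR_scaleR left_inverse scaleR_one not_False_eq_True)
qed

lemma ft_diag:
  fixes f :: "'a::euclidean_space \<Rightarrow> complex"
  assumes [measurable]: "f \<in> borel_measurable borel" and s: "\<And>b. b \<in> Basis \<Longrightarrow> s b > 0"
  shows "ft (\<lambda>x. f (diag s x)) \<zeta> = inverse (\<Prod>b\<in>Basis. s b) *\<^sub>R ft f (diag (\<lambda>b. inverse (s b)) \<zeta>)"
proof -
  let ?\<eta> = "diag (\<lambda>b. inverse (s b)) \<zeta>"
  have "x \<bullet> \<zeta> = diag s x \<bullet> ?\<eta>" for x
    unfolding euclidean_inner[of x \<zeta>] euclidean_inner[of "diag s x" ?\<eta>]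
    by (intro sum.cong refl) (use s in \<open>force simp: diag_inner\<close>)
  then have "ft (\<lambda>x. f (diag s x)) \<zeta> = (LINT x|lborel. (\<lambda>y. f y * cis (- (y \<bullet> ?\<eta>))) (diag s x))"
    by (simp add: ft_def)
  also have "\<dots> = inverse (\<Prod>b\<in>Basis. s b) *\<^sub>R (LINT y|lborel. f y * cis (- (y \<bullet> ?\<eta>)))"
    by (rule integral_diag[OF _ s]) measurable
  finally show ?thesis by (simp add: ft_def)
qed

text \<open>Its transform is again a product of Gaussians and vanishes nowhere, so the left-hand
  side of the restriction inequality is strictly positive; the scaling argument rests on
  that.\<close>

definition std_gauss :: "'a::euclidean_space \<Rightarrow> complex" where
  "std_gauss z = complex_of_real (\<Prod>b\<in>Basis. std_normal_density (z \<bullet> b))"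

lemma borel_measurable_std_gauss [measurable]: "std_gauss \<in> borel_measurable borel"
  unfolding std_gauss_def by measurable

lemma schwartz_std_gauss_diag:
  fixes s :: "'a::euclidean_space \<Rightarrow> real"
  assumes s: "\<And>b. b \<in> Basis \<Longrightarrow> s b > 0"
  shows "schwartz (\<lambda>z. std_gauss (diag s z))"
proof -
  define Q where "Q = (\<lambda>z::'a. \<Sum>b\<in>Basis. (s b)\<^sup>2 / 2 * (z \<bullet> b)\<^sup>2)"
  define m where "m = Min ((\<lambda>b. (s b)\<^sup>2 / 2) ` (Basis::'a set))"
  have m: "m > 0" unfolding m_def using s by (subst Min_gr_iff) (auto simp: less_imp_neq[OF s, symmetric])
  have mb: "m \<le> (s b)\<^sup>2 / 2" if "b \<in> Basis" for b unfolding m_def using that by (intro Min_le) auto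
  have Qp: "real_polynomial_function Q"
    unfolding Q_def power2_eq_square[of "_ \<bullet> _"]
    by (intro real_polynomial_function_sum real_polynomial_function.intros bounded_linear_inner_left) auto
  have Qm: "Q z \<ge> m * (norm z)\<^sup>2" for z
  proof -
    have "m * (norm z)\<^sup>2 = (\<Sum>b\<in>Basis. m * (z \<bullet> b)\<^sup>2)"
      unfolding power2_norm_eq_inner euclidean_inner[of z z] by (simp add: sum_distrib_left power2_eq_square)
    also have "\<dots> \<le> Q z" unfolding Q_def by (intro sum_mono mult_right_mono mb) auto
    finally show ?thesis .
  qed
  have "std_gauss (diag s z) = complex_of_real ((1 / sqrt (2 * pi)) ^ DIM('a) * exp (- Q z))" for z
  proof -
    have "(\<Prod>b\<in>Basis. std_normal_density (diag s z \<bullet> b)) = (\<Prod>b\<in>(Basis::'a set). 1 / sqrt (2 * pi) * exp (- ((s b)\<^sup>2 / 2 * (z \<bullet> b)\<^sup>2)))"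
      by (intro prod.cong refl) (simp add: std_normal_density_def diag_inner power_mult_distrib)
    also have "\<dots> = (1 / sqrt (2 * pi)) ^ DIM('a) * exp (- Q z)"
      by (simp only: prod.distrib prod_constant exp_sum[OF finite_Basis, symmetric] sum_negf Q_def)
    finally show ?thesis by (simp only: std_gauss_def)
  qed
  then show ?thesis by (simp only: schwartz_gauss[OF Qp m Qm])
qed

lemma ft_std_gauss_nonzero: "ft std_gauss (\<zeta>::'a::euclidean_space) \<noteq> 0"
proof -
  have "ft std_gauss \<zeta> = ft (\<lambda>z. \<Prod>b\<in>Basis. complex_of_real (std_normal_density (z \<bullet> b))) \<zeta>"
    by (simp add: std_gauss_def[abs_def])
  also have "\<dots> = (\<Prod>b\<in>Basis. LINT x|lborel. complex_of_real (std_normal_density x) * cis (- (x * (\<zeta> \<bullet> b))))"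
    by (rule ft_prod) simp
  also have "\<dots> = (\<Prod>b\<in>Basis. complex_of_real (sqrt (2 * pi) * std_normal_density (\<zeta> \<bullet> b)))"
    by (subst fourier_normal_density) simp_all
  finally show ?thesis by (simp add: std_normal_density_def)
qed

text \<open>The scale \<open>l powr (1 / k b)\<close> in direction \<open>b\<close> makes every
  monomial shrink by the same factor \<open>l\<close>. Dividing the last coordinate by
  \<open>l\<close> as well then maps the surface onto itself.\<close>

lemma power_phase_diag:
  fixes a :: "'a::euclidean_space \<Rightarrow> real"
  assumes k: "\<And>b. b \<in> Basis \<Longrightarrow> k b \<ge> 2" and l: "l > 0"
  shows "power_phase a k (diag (\<lambda>b. inverse (l powr (1 / real (k b)))) \<xi>) = inverse l * power_phase a k \<xi>"
  unfolding power_phase_def sum_distrib_left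
proof (intro sum.cong refl)
  fix b :: 'a assume b: "b \<in> Basis"
  have "(l powr (1 / real (k b))) ^ k b = l"
    using k[OF b] l by (simp add: powr_realpow[symmetric] powr_powr)
  then show "a b * (diag (\<lambda>b. inverse (l powr (1 / real (k b)))) \<xi> \<bullet> b) ^ k b = inverse l * (a b * (\<xi> \<bullet> b) ^ k b)"
    using b by (simp add: diag_inner power_mult_distrib power_inverse)
qed

text \<open>On dilated Gaussians the inequality becomes \<open>A * l powr e \<le> B\<close> for all
  \<open>l > 0\<close>, with \<open>A > 0\<close> and \<open>e = (h + 1) / p - (1 + h / 2)\<close>.
  In the square integral the transform contributes the power \<open>- 2 * (h + 1)\<close> of
  \<open>l\<close> and the change of variables in frequency the power \<open>h\<close>; the $L^p$
  norm scales with \<open>- (h + 1) / p\<close>. A nonzero \<open>e\<close> is refuted by extreme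
  \<open>l\<close>, and \<open>e = 0\<close> is the stated value of \<open>p\<close>.\<close>

lemma restriction_necessary:
  fixes a :: "'a::euclidean_space \<Rightarrow> real"
  assumes k: "\<And>b. b \<in> Basis \<Longrightarrow> k b \<ge> 2" and p: "p \<ge> 1"
    and C: "\<And>\<phi>. schwartz \<phi> \<Longrightarrow>
    integrable lborel (\<lambda>\<xi>. (cmod (fourier \<phi> (\<xi>, power_phase a k \<xi>)))\<^sup>2) \<and>
    (LINT \<xi>|lborel. (cmod (fourier \<phi> (\<xi>, power_phase a k \<xi>)))\<^sup>2) powr (1 / 2) \<le> C * Lp_norm p \<phi>"
  shows "p = 2 - 2 / (2 + (\<Sum>b\<in>Basis. 1 / real (k b)))"
proof -
  define h where "h = (\<Sum>b\<in>(Basis::'a set). 1 / real (k b))"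
  have h: "h > 0" unfolding h_def using k by (intro sum_pos) (auto, force)
  define c0 where "c0 = (2 * pi) powr (- (real DIM('a \<times> real) / 2))"
  have c0: "c0 > 0" by (simp add: c0_def)
  \<comment> \<open>A basis vector of the product space is \<open>(u, 0)\<close> or
    \<open>(0, 1)\<close>; the test on \<open>snd b\<close> separates the directions of
    \<open>\<xi>\<close> from the last one.\<close>
  define s where "s = (\<lambda>l b. if snd b = (0::real) then l powr (1 / real (k (fst b :: 'a))) else l)"
  define q where "q = (\<lambda>l (b::'a). inverse (l powr (1 / real (k b))))"
  have spos: "s l b > 0" if "l > 0" for l b using that by (simp add: s_def)
  have qpos: "q l b > 0" if "l > 0" for l b using that by (simp add: q_def)
  have sprod: "(\<Prod>b\<in>Basis. s l b) = l powr (h + 1)" if "l > 0" for l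
    using that by (simp add: prod_Basis_prod_eq s_def h_def powr_add powr_sum)
  have qprod: "inverse (\<Prod>b\<in>Basis. q l b) = l powr h" if "l > 0" for l
    using that by (simp add: q_def h_def powr_sum prod_inversef[symmetric] o_def)
  have sdiag: "diag (\<lambda>b. inverse (s l b)) (\<xi>, power_phase a k \<xi>) = (diag (q l) \<xi>, power_phase a k (diag (q l) \<xi>))"
    if l: "l > 0" for l \<xi>
  proof -
    have "diag (\<lambda>b. inverse (s l b)) (\<xi>, y) = (diag (q l) \<xi>, inverse l * y)" for y
      by (simp add: diag_def sum_Basis_prod_eq s_def prod_eq_iff fst_sum snd_sum q_def)
    then show ?thesis unfolding q_def by (simp only: power_phase_diag[OF k l])
  qed
  define g where "g = (\<lambda>\<xi>. (cmod (ft std_gauss (\<xi>, power_phase a k \<xi>)))\<^sup>2)"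
  have "(\<lambda>\<xi>. (\<xi>, power_phase a k \<xi>)) \<in> borel \<rightarrow>\<^sub>M (borel \<Otimes>\<^sub>M borel)" by measurable
  then have "(\<lambda>\<xi>. (\<xi>, power_phase a k \<xi>)) \<in> borel \<rightarrow>\<^sub>M borel" by (simp add: borel_prod)
  from measurable_compose[OF this borel_measurable_ft[OF borel_measurable_std_gauss]]
  have gm [measurable]: "g \<in> borel_measurable borel" unfolding g_def by measurable
  have gpos: "g \<xi> > 0" for \<xi> by (simp add: g_def ft_std_gauss_nonzero)
  define I where "I = (LINT \<xi>|lborel. g \<xi>)"
  define J where "J = (LINT z|lborel. cmod (std_gauss (z :: 'a \<times> real)) powr p)"
  have J: "J \<ge> 0" by (simp add: J_def)
  have F: "(cmod (fourier (\<lambda>z. std_gauss (diag (s l) z)) (\<xi>, power_phase a k \<xi>)))\<^sup>2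
      = c0\<^sup>2 * (l powr - (h + 1))\<^sup>2 * g (diag (q l) \<xi>)" if l: "l > 0" for l \<xi>
  proof -
    have "fourier (\<lambda>z. std_gauss (diag (s l) z)) (\<xi>, power_phase a k \<xi>)
        = complex_of_real c0 * (l powr - (h + 1) *\<^sub>R ft std_gauss (diag (q l) \<xi>, power_phase a k (diag (q l) \<xi>)))"
      unfolding fourier_eq_ft ft_diag[OF borel_measurable_std_gauss spos[OF l]] sdiag[OF l] sprod[OF l] c0_def powr_minus[symmetric] ..
    then show ?thesis using c0 by (simp only: norm_mult norm_of_real norm_scaleR g_def power_mult_distrib power2_abs mult.assoc)
  qed
  have sch: "schwartz (\<lambda>z. std_gauss (diag (s l) z))" if "l > 0" for l
    by (rule schwartz_std_gauss_diag) (rule spos[OF that])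
  \<comment> \<open>At \<open>l = 1\<close> the dilations are trivial, so the hypothesis for the
    undilated Gaussian supplies the integrability.\<close>
  have gi: "integrable lborel g"
  proof -
    have "diag (q 1) \<xi> = \<xi>" for \<xi> by (simp add: q_def diag_def euclidean_representation)
    then have "integrable lborel (\<lambda>\<xi>. c0\<^sup>2 * (1 powr - (h + 1))\<^sup>2 * g \<xi>)"
      using C[OF sch[of 1]] by (simp add: F)
    then show ?thesis using c0 by simp
  qed
  have I: "I > 0"
  proof -
    have "I \<ge> 0" unfolding I_def using gpos by (intro integral_nonneg_AE) (auto simp: less_imp_le)
    moreover have "I \<noteq> 0"
    proof
      assume "I = 0"
      then have "AE \<xi> in lborel. g \<xi> = 0"
        unfolding I_def using integral_nonneg_eq_0_iff_AE[OF gi] gpos by (simp add: less_imp_le)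
      then have "AE \<xi> in (lborel :: 'a measure). False" by (rule AE_mp) (use gpos in \<open>auto simp: less_le\<close>)
      then have "emeasure (lborel :: 'a measure) {x \<in> space lborel. \<not> False} = 0" by (rule AE_E2)
      then show False by simp
    qed
    ultimately show ?thesis by simp
  qed
  have ineq: "c0 * I powr (1 / 2) * l powr - (1 + h / 2) \<le> C * J powr (1 / p) * l powr - ((h + 1) / p)" if l: "l > 0" for l
  proof -
    have "(LINT \<xi>|lborel. (cmod (fourier (\<lambda>z. std_gauss (diag (s l) z)) (\<xi>, power_phase a k \<xi>)))\<^sup>2)
       = c0\<^sup>2 * (l powr - (h + 1))\<^sup>2 * (l powr h * I)"
      unfolding F[OF l] using integral_diag[OF gm qpos[OF l]] by (simp add: I_def qprod[OF l])
    also have "\<dots> = (c0 * (I powr (1 / 2) * l powr - (1 + h / 2)))\<^sup>2"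
    proof -
      have "(l powr - (h + 1))\<^sup>2 * l powr h = l powr (- (h + 1) + - (h + 1) + h)"
        by (simp only: powr_add power2_eq_square)
      also have "\<dots> = l powr (- (1 + h / 2) + - (1 + h / 2))" by (rule arg_cong[where f = "\<lambda>x. l powr x"]) simp
      also have "\<dots> = (l powr - (1 + h / 2))\<^sup>2" by (simp only: powr_add power2_eq_square)
      finally have e: "(l powr - (h + 1))\<^sup>2 * l powr h = (l powr - (1 + h / 2))\<^sup>2" .
      have "(I powr (1 / 2))\<^sup>2 = I" using I by (simp add: powr_half_sqrt)
      then show ?thesis by (simp only: power_mult_distrib e[symmetric] mult_ac)
    qed
    also have "\<dots> powr (1 / 2) = c0 * I powr (1 / 2) * l powr - (1 + h / 2)"
      using c0 by (simp add: powr_half_sqrt)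
    finally have L: "(LINT \<xi>|lborel. (cmod (fourier (\<lambda>z. std_gauss (diag (s l) z)) (\<xi>, power_phase a k \<xi>)))\<^sup>2) powr (1 / 2)
      = c0 * I powr (1 / 2) * l powr - (1 + h / 2)" .
    have "(LINT z|lborel. cmod (std_gauss (diag (s l) z)) powr p) = inverse (l powr (h + 1)) *\<^sub>R J"
      unfolding J_def sprod[OF l, symmetric] by (rule integral_diag[OF _ spos[OF l]]) measurable
    then have "Lp_norm p (\<lambda>z. std_gauss (diag (s l) z)) = (l powr - (h + 1) * J) powr (1 / p)"
      by (simp only: Lp_norm_def powr_minus real_scaleR_def)
    also have "\<dots> = J powr (1 / p) * l powr - ((h + 1) / p)"
      using J by (simp add: powr_mult powr_powr minus_divide_left)
    finally show ?thesis using C[OF sch[OF l]] unfolding L by (simp only: mult.assoc)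
  qed
  define e where "e = (h + 1) / p - (1 + h / 2)"
  define A where "A = c0 * I powr (1 / 2)"
  define B where "B = C * J powr (1 / p)"
  have A: "A > 0" using c0 I by (simp add: A_def)
  have AB: "A * l powr e \<le> B" if l: "l > 0" for l
  proof -
    have "A * l powr - (1 + h / 2) * l powr ((h + 1) / p) \<le> B * l powr - ((h + 1) / p) * l powr ((h + 1) / p)"
      using ineq[OF l] unfolding A_def B_def by (intro mult_right_mono) auto
    moreover have "- (1 + h / 2) + (h + 1) / p = e" by (simp add: e_def)
    ultimately have "A * l powr e \<le> B * l powr (- ((h + 1) / p) + (h + 1) / p)"
      by (simp only: mult.assoc powr_add[symmetric])
    then show ?thesis using l by simp
  qed
  have "e = 0"
  proof (rule ccontr)
    assume e: "e \<noteq> 0"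
    \<comment> \<open>\<open>l = Y powr (1 / e)\<close> covers both signs of \<open>e\<close> at
      once: the left-hand side of \<open>AB\<close> becomes
      \<open>\<bar>B\<bar> + 1\<close>.\<close>
    define Y where "Y = (\<bar>B\<bar> + 1) / A"
    have Y: "Y > 0" using A by (simp add: Y_def add_nonneg_pos)
    have "(Y powr (1 / e)) powr e = Y" using Y e by (simp add: powr_powr)
    then have "A * Y \<le> B" using AB[of "Y powr (1 / e)"] Y by simp
    then show False using A by (simp add: Y_def)
  qed
  then have "p * (2 + h) = 2 + 2 * h" using p by (simp add: e_def field_simps)
  then show ?thesis unfolding h_def[symmetric] using h by (simp add: field_simps)
qed

text \<open>\<open>'m\<close> indexes the coordinates of \<open>\<xi>'\<close>; being a type it is
  nonempty, which matches the dimension of the whole space being at least 2. The integrability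
  clause gives the inequality its meaning, since a non-integrable square would have Bochner integral
  0.\<close>

theorem theorem1p3:
  fixes a :: "'m::finite \<Rightarrow> real" and k :: "'m \<Rightarrow> nat"
    and R :: "real ^ 'm \<Rightarrow> real" and p :: real
  assumes "\<And>j. a j \<noteq> 0"
    and "\<And>j. k j \<ge> 2"
    and "\<And>\<xi>'. R \<xi>' = (\<Sum>j\<in>UNIV. a j * (\<xi>' $ j) ^ k j)"
    and "p \<ge> 1"
  shows "(\<exists>C::real. \<forall>\<phi> :: (real ^ 'm) \<times> real \<Rightarrow> complex. schwartz \<phi> \<longrightarrow>
            integrable lborel (\<lambda>\<xi>' :: real ^ 'm. (cmod (fourier \<phi> (\<xi>', R \<xi>')))\<^sup>2) \<and>
            (LINT \<xi>' :: real ^ 'm|lborel. (cmod (fourier \<phi> (\<xi>', R \<xi>')))\<^sup>2) powr (1 / 2)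
              \<le> C * Lp_norm p \<phi>)
         \<longleftrightarrow> p = 2 - 2 / (2 + (\<Sum>j\<in>UNIV. 1 / real (k j)))"
proof -
  \<comment> \<open>Coordinates are matched with basis vectors by \<open>e\<close>, and coefficients
    and exponents are carried over by \<open>inv e\<close>. Away from the basis these take their
    value at some arbitrary index, so their assumptions hold there too.\<close>
  define e where "e = (\<lambda>j::'m. axis j (1::real))"
  have e: "inj e" by (auto simp: inj_def e_def axis_eq_axis)
  have Basis: "(Basis :: (real ^ 'm) set) = range e"
    by (auto simp: Basis_vec_def e_def)
  define a' where "a' = a \<circ> inv e"
  define k' where "k' = k \<circ> inv e"
  have sum_Basis: "(\<Sum>b\<in>Basis. f b) = (\<Sum>j\<in>UNIV. f (e j))" for f :: "real ^ 'm \<Rightarrow> real"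
    unfolding Basis by (simp add: sum.reindex[OF e])
  have R: "R = power_phase a' k'"
    by (simp add: fun_eq_iff assms(3) power_phase_def sum_Basis a'_def k'_def inv_f_f[OF e])
      (simp add: e_def inner_axis)
  have h: "(\<Sum>j\<in>UNIV. 1 / real (k j)) = (\<Sum>b\<in>Basis. 1 / real (k' b))"
    by (simp add: sum_Basis k'_def inv_f_f[OF e])
  have a': "a' b \<noteq> 0" and k': "k' b \<ge> 2" for b by (simp_all add: a'_def k'_def assms)
  show ?thesis
    unfolding R h using restriction_sufficient[of a' k' p] restriction_necessary[of k' p a'] a' k' assms(4)
    by blast
qed

end
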